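(* Let $X,U$ be Hilbert spaces, let $A$ be a lower semibounded self-adjoint operator in $X$ with $\kappa=\min\sigma(A)$, let $\beta\le 0$ and $B\in\mathcal{L}(U,X_\beta)$. Let $T>0$ and assume that the system $\dot w+Aw=Bu$, $w(0)=w_0\in X$, is null-controllable in time $T$. Then its control cost $C_T$ satisfies $$C_T^2\ \ge\ \lVert B\rVert_{\mathcal{L}(U,X_\beta)}^{-2}\,(1+\kappa^2)^{\beta}\cdot\begin{cases}\dfrac1T & \text{if }\kappa=0,\\[2ex] \dfrac{2\kappa}{\exp(2\kappa T)-1} & \text{if }\kappa\ne 0.\end{cases}$$
   Context: $X$ and $U$ are Hilbert spaces with norms $\lVert\cdot\rVert$ and $\lVert\cdot\rVert_U$. For $\beta\in\mathbb{R}$ put $\lVert x\rVert_\beta=\lVert (I+A^2)^{\beta/2}x\rVert$. For $\beta>0$, $X_\beta=\mathcal{D}((I+A^2)^{\beta/2})$ with this norm; for $\beta\le 0$, $X_\beta\supset X$ is the completion of $X$ with respect to $\lVert\cdot\rVert_\beta$ (so $X_0=X$). Duals are taken with respect to the pivot space $X$, so the dual of $X_\beta$ is $X_{-\beta}$, and for $\beta\le 0$ and $B\in\mathcal{L}(U,X_\beta)$ (bounded linear operators) one has $B^*\in\mathcal{L}(X_{-\beta},U)$. The symbol $\mathrm{e}^{-At}$ also denotes the unique extension of the semigroup generated by $-A$ from $X$ to $X_\beta$. For $t>0$, $\mathrm{e}^{-At}$ maps $X$ into $X_{-\beta}$. For a control function $u\in L^2([0,T],U)$ the mild solution of $\dot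 w+Aw=Bu$, $w(0)=w_0\in X$, is $w(t)=\mathrm{e}^{-At}w_0+\int_0^t\mathrm{e}^{-A(t-s)}Bu(s)\,\mathrm{d}s$, $t\in[0,T]$ (integral in $X_\beta$). The system is null-controllable in time $T>0$ if for every $w_0\in X$ there is $u\in L^2([0,T],U)$ with $w(T)=0$. In this case, with $\mathcal{B}^Tu=\int_0^T\mathrm{e}^{-A(T-s)}Bu(s)\,\mathrm{d}s$, the control cost in time $T$ is $$C_T=\sup_{\lVert w_0\rVert=1}\min\{\lVert u\rVert_{L^2([0,T],U)}:\ \mathrm{e}^{-AT}w_0+\mathcal{B}^Tu=0\},$$ which equals the smallest constant $C_{\mathrm{obs}}$ such that $\lVert\mathrm{e}^{-AT}f_0\rVert^2\le C_{\mathrm{obs}}^2\int_0^T\lVert B^*\mathrm{e}^{-At}f_0\rVert_U^2\,\mathrm{d}t$ for all $f_0\in X$. *)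

theory Defs
  imports "HOL-Analysis.Analysis" "HOL-Computational_Algebra.Polynomial"
begin

section \<open>Hilbert spaces over the real or complex numbers\<close>

text \<open>By the Gelfand--Mazur theorem the only models of the following class are the real and the
  complex numbers, so that the theory covers real and complex Hilbert spaces alike.\<close>

class rc_field = real_normed_field +
  fixes conj :: "'a \<Rightarrow> 'a"
  assumes conj_add: "conj (a + b) = conj a + conj b"
    and conj_mult: "conj (a * b) = conj a * conj b"
    and conj_conj: "conj (conj a) = a"
    and conj_scaleR: "conj (r *\<^sub>R a) = r *\<^sub>R conj a"
    and mult_conj: "a * conj a = (norm a)\<^sup>2 *\<^sub>R 1"

instantiation real :: rc_field
begin
definition conj_real :: "real \<Rightarrow> real" where "conj_real a = a"
instance by standard (auto simp: conj_real_def power2_eq_square)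
end

instantiation complex :: rc_field
begin
definition conj_complex :: "complex \<Rightarrow> complex" where "conj_complex = cnj"
instance by standard (auto simp: conj_complex_def complex_norm_square[symmetric] scaleR_conv_of_real)
end

locale normed_space_over = vector_space scale
  for scale :: "'k::rc_field \<Rightarrow> 'a::real_normed_vector \<Rightarrow> 'a" +
  assumes scale_of_real: "scale (of_real r) x = r *\<^sub>R x"
    and norm_scale: "norm (scale c x) = norm c * norm x"

locale hilbert_space = normed_space_over scale
  for scale :: "'k::rc_field \<Rightarrow> 'a::banach \<Rightarrow> 'a" +
  fixes ip :: "'a \<Rightarrow> 'a \<Rightarrow> 'k"
  assumes ip_add_left: "ip (x + y) z = ip x z + ip y z"
    and ip_scale_left: "ip (scale c x) y = c * ip x y"
    and ip_conj: "ip y x = conj (ip x y)"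
    and ip_self: "ip x x = of_real ((norm x)\<^sup>2)"

lemma hilbert_space_real:
  "hilbert_space scaleR (inner :: 'a::{real_inner, banach} \<Rightarrow> 'a \<Rightarrow> real)"
  by standard (auto simp: conj_real_def inner_add_left inner_commute power2_norm_eq_inner algebra_simps)

definition bounded_operator ::
  "('k::rc_field \<Rightarrow> 'a::real_normed_vector \<Rightarrow> 'a) \<Rightarrow> ('k \<Rightarrow> 'b::real_normed_vector \<Rightarrow> 'b) \<Rightarrow> ('a \<Rightarrow> 'b) \<Rightarrow> bool"
  where "bounded_operator s1 s2 F \<longleftrightarrow>
    Vector_Spaces.linear s1 s2 F \<and> (\<exists>C. \<forall>x. norm (F x) \<le> C * norm x)"


section \<open>Unbounded operators\<close>

text \<open>An operator \<open>A\<close> with domain \<open>D\<close> is a pair of a set \<open>D\<close> and a function \<open>A\<close>; the values of \<open>A\<close>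
  outside \<open>D\<close> are never used.\<close>

definition op_graph :: "'a set \<Rightarrow> ('a \<Rightarrow> 'a) \<Rightarrow> ('a \<times> 'a) set"
  where "op_graph D A = {(x, A x) | x. x \<in> D}"

definition adjoint_graph :: "('a \<Rightarrow> 'a \<Rightarrow> 'k) \<Rightarrow> 'a set \<Rightarrow> ('a \<Rightarrow> 'a) \<Rightarrow> ('a \<times> 'a) set"
  where "adjoint_graph ip D A = {(y, z). \<forall>x\<in>D. ip (A x) y = ip x z}"

definition self_adjoint ::
  "('k::rc_field \<Rightarrow> 'a::banach \<Rightarrow> 'a) \<Rightarrow> ('a \<Rightarrow> 'a \<Rightarrow> 'k) \<Rightarrow> 'a set \<Rightarrow> ('a \<Rightarrow> 'a) \<Rightarrow> bool"
  where "self_adjoint sc ip D A \<longleftrightarrow>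
    module.subspace sc D \<and> closure D = UNIV \<and>
    (\<forall>x\<in>D. \<forall>y\<in>D. A (x + y) = A x + A y) \<and> (\<forall>c. \<forall>x\<in>D. A (sc c x) = sc c (A x)) \<and>
    adjoint_graph ip D A = op_graph D A"

definition lower_semibounded :: "('a::banach \<Rightarrow> 'a \<Rightarrow> 'k::rc_field) \<Rightarrow> 'a set \<Rightarrow> ('a \<Rightarrow> 'a) \<Rightarrow> bool"
  where "lower_semibounded ip D A \<longleftrightarrow>
    (\<exists>c::real. \<forall>x\<in>D. \<exists>r::real. ip (A x) x = of_real r \<and> c * (norm x)\<^sup>2 \<le> r)"

definition resolvent_set :: "('k::rc_field \<Rightarrow> 'a::banach \<Rightarrow> 'a) \<Rightarrow> 'a set \<Rightarrow> ('a \<Rightarrow> 'a) \<Rightarrow> 'k set"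
  where "resolvent_set sc D A = {z.
    bij_betw (\<lambda>x. A x - sc z x) D UNIV \<and> (\<exists>C. \<forall>x\<in>D. norm x \<le> C * norm (A x - sc z x))}"

definition spectrum :: "('k::rc_field \<Rightarrow> 'a::banach \<Rightarrow> 'a) \<Rightarrow> 'a set \<Rightarrow> ('a \<Rightarrow> 'a) \<Rightarrow> 'k set"
  where "spectrum sc D A = - resolvent_set sc D A"


section \<open>The operators \<open>(I + A\<^sup>2)\<^bsup>s\<^esup>\<close> for \<open>s \<le> 0\<close>\<close>

definition poly_op :: "real poly \<Rightarrow> ('a::real_vector \<Rightarrow> 'a) \<Rightarrow> 'a \<Rightarrow> 'a"
  where "poly_op p R x = (\<Sum>i\<le>degree p. coeff p i *\<^sub>R (R ^^ i) x)"

text \<open>Continuous functional calculus of an injective bounded self-adjoint operator \<open>R\<close> with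
  \<open>0 \<le> R \<le> I\<close>, hence with spectrum in \<open>[0, 1]\<close>: \<open>f(R) = lim p\<^sub>n(R)\<close> for polynomials \<open>p\<^sub>n\<close> converging to
  \<open>f\<close> uniformly. Here \<open>f\<close> is a function on \<open>(0, 1]\<close> with a continuous extension to \<open>[0, 1]\<close>; the point
  \<open>0\<close> is left out because \<open>0 powr 0 = 0\<close>, whereas \<open>t powr 0 = 1\<close> for \<open>t > 0\<close>. As \<open>(0, 1]\<close> is dense in
  \<open>[0, 1]\<close>, this amounts to uniform convergence on \<open>[0, 1]\<close> to the extension.\<close>

definition cont_fun_calc :: "('a::real_normed_vector \<Rightarrow> 'a) \<Rightarrow> (real \<Rightarrow> real) \<Rightarrow> 'a \<Rightarrow> 'a"
  where "cont_fun_calc R f x = (THE y. \<forall>p :: nat \<Rightarrow> real poly.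
    uniform_limit {0<..1} (\<lambda>n. poly (p n)) f sequentially \<longrightarrow> (\<lambda>n. poly_op (p n) R x) \<longlonglongrightarrow> y)"

definition inv_I_plus_sq :: "'a set \<Rightarrow> ('a::banach \<Rightarrow> 'a) \<Rightarrow> 'a \<Rightarrow> 'a"
  where "inv_I_plus_sq D A y = (THE x. x \<in> D \<and> A x \<in> D \<and> x + A (A x) = y)"

text \<open>\<open>(I + A\<^sup>2)\<^bsup>s\<^esup>\<close> is the \<open>-s\<close>-th power of the bounded operator \<open>(I + A\<^sup>2)\<^bsup>-1\<^esup>\<close>; only meaningful for
  \<open>s \<le> 0\<close>.\<close>

definition I_plus_sq_powr :: "'a set \<Rightarrow> ('a::banach \<Rightarrow> 'a) \<Rightarrow> real \<Rightarrow> 'a \<Rightarrow> 'a"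
  where "I_plus_sq_powr D A s = cont_fun_calc (inv_I_plus_sq D A) (\<lambda>t. t powr (- s))"

definition norm_beta :: "'a set \<Rightarrow> ('a::banach \<Rightarrow> 'a) \<Rightarrow> real \<Rightarrow> 'a \<Rightarrow> real"
  where "norm_beta D A \<beta> x = norm (I_plus_sq_powr D A (\<beta> / 2) x)"

text \<open>The Banach space \<open>'b\<close> together with the embedding \<open>\<iota>\<close> is a completion of \<open>'a\<close> with respect to the
  norm \<open>nrm\<close>. Completions are unique up to isometric isomorphism.\<close>

definition is_completion ::
  "('k::rc_field \<Rightarrow> 'a::real_normed_vector \<Rightarrow> 'a) \<Rightarrow> ('a \<Rightarrow> real) \<Rightarrow>
   ('k \<Rightarrow> 'b::banach \<Rightarrow> 'b) \<Rightarrow> ('a \<Rightarrow> 'b) \<Rightarrow> bool"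
  where "is_completion sX nrm sY \<iota> \<longleftrightarrow>
    normed_space_over sY \<and> Vector_Spaces.linear sX sY \<iota> \<and>
    (\<forall>x. norm (\<iota> x) = nrm x) \<and> closure (range \<iota>) = UNIV"


section \<open>Semigroups\<close>

definition C0_semigroup :: "(real \<Rightarrow> 'a::banach \<Rightarrow> 'a) \<Rightarrow> bool"
  where "C0_semigroup S \<longleftrightarrow>
    (\<forall>t\<ge>0. bounded_linear (S t)) \<and> (\<forall>x. S 0 x = x) \<and>
    (\<forall>s\<ge>0. \<forall>t\<ge>0. \<forall>x. S (s + t) x = S s (S t x)) \<and>
    (\<forall>x. ((\<lambda>t. S t x) \<longlongrightarrow> x) (at_right 0))"

definition generator_graph :: "(real \<Rightarrow> 'a::banach \<Rightarrow> 'a) \<Rightarrow> ('a \<times> 'a) set"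
  where "generator_graph S = {(x, y). ((\<lambda>h. (S h x - x) /\<^sub>R h) \<longlongrightarrow> y) (at_right 0)}"

text \<open>\<open>e\<^bsup>-At\<^esup>\<close>, the semigroup generated by \<open>-A\<close>, for \<open>t \<ge> 0\<close>. A semigroup is determined by its
  generator for \<open>t \<ge> 0\<close> only, hence the description of single values.\<close>

definition exp_minus :: "'a set \<Rightarrow> ('a::banach \<Rightarrow> 'a) \<Rightarrow> real \<Rightarrow> 'a \<Rightarrow> 'a"
  where "exp_minus D A t x = (THE y. \<exists>S. C0_semigroup S \<and>
    generator_graph S = op_graph D (\<lambda>x. - A x) \<and> y = S t x)"

definition extension :: "('a \<Rightarrow> 'b::banach) \<Rightarrow> ('a \<Rightarrow> 'a) \<Rightarrow> 'b \<Rightarrow> 'b"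
  where "extension \<iota> F = (THE G. bounded_linear G \<and> (\<forall>x. G (\<iota> x) = \<iota> (F x)))"


section \<open>Bochner integral and control functions\<close>

text \<open>The library's Bochner integral requires a second countable codomain; the spaces here need not be
  separable.\<close>

definition strongly_measurable :: "'t measure \<Rightarrow> ('t \<Rightarrow> 'b::real_normed_vector) \<Rightarrow> bool"
  where "strongly_measurable M f \<longleftrightarrow>
    (\<exists>s. (\<forall>n::nat. simple_function M (s n)) \<and> (AE t in M. (\<lambda>n. s n t) \<longlonglongrightarrow> f t))"

definition has_strong_integral :: "'t measure \<Rightarrow> ('t \<Rightarrow> 'b::banach) \<Rightarrow> 'b \<Rightarrow> bool"
  where "has_strong_integral M f z \<longleftrightarrow> strongly_measurable M f \<and>
    (\<exists>s. (\<forall>n::nat. Bochner_Integration.simple_bochner_integrable M (s n)) \<and>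
      (\<lambda>n. \<integral>\<^sup>+t. ennreal (norm (f t - s n t)) \<partial>M) \<longlonglongrightarrow> 0 \<and>
      (\<lambda>n. Bochner_Integration.simple_bochner_integral M (s n)) \<longlonglongrightarrow> z)"

definition L2 :: "real \<Rightarrow> (real \<Rightarrow> 'u::banach) set"
  where "L2 T = {u. strongly_measurable (lebesgue_on {0..T}) u \<and>
    integrable (lebesgue_on {0..T}) (\<lambda>t. (norm (u t))\<^sup>2)}"

definition L2_norm :: "real \<Rightarrow> (real \<Rightarrow> 'u::banach) \<Rightarrow> real"
  where "L2_norm T u = sqrt (\<integral>t. (norm (u t))\<^sup>2 \<partial>(lebesgue_on {0..T}))"


section \<open>The control problem\<close>

text \<open>\<open>z\<close> is the integral of \<open>e\<^bsup>-A(t-s)\<^esup> B u(s)\<close> over \<open>0 \<le> s \<le> t\<close>.\<close>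

definition input_map ::
  "('a \<Rightarrow> 'b::banach) \<Rightarrow> 'a set \<Rightarrow> ('a::banach \<Rightarrow> 'a) \<Rightarrow> ('u \<Rightarrow> 'b) \<Rightarrow> real \<Rightarrow> (real \<Rightarrow> 'u) \<Rightarrow> 'b \<Rightarrow> bool"
  where "input_map \<iota> D A B t u z \<longleftrightarrow>
    has_strong_integral (lebesgue_on {0..t}) (\<lambda>s. extension \<iota> (exp_minus D A (t - s)) (B (u s))) z"

definition mild_solution ::
  "('a \<Rightarrow> 'b::banach) \<Rightarrow> 'a set \<Rightarrow> ('a::banach \<Rightarrow> 'a) \<Rightarrow> ('u \<Rightarrow> 'b) \<Rightarrow> real \<Rightarrow> 'a \<Rightarrow> (real \<Rightarrow> 'u) \<Rightarrow>
   (real \<Rightarrow> 'b) \<Rightarrow> bool"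
  where "mild_solution \<iota> D A B T w0 u w \<longleftrightarrow>
    (\<forall>t\<in>{0..T}. \<exists>z. input_map \<iota> D A B t u z \<and> w t = \<iota> (exp_minus D A t w0) + z)"

definition null_controllable ::
  "('a \<Rightarrow> 'b::banach) \<Rightarrow> 'a set \<Rightarrow> ('a::banach \<Rightarrow> 'a) \<Rightarrow> ('u::banach \<Rightarrow> 'b) \<Rightarrow> real \<Rightarrow> bool"
  where "null_controllable \<iota> D A B T \<longleftrightarrow>
    (\<forall>w0. \<exists>u\<in>L2 T. \<exists>w. mild_solution \<iota> D A B T w0 u w \<and> w T = 0)"

text \<open>The admissible controls form a closed affine subspace of \<open>L\<^sup>2\<close>, so the infimum is a minimum
  whenever this subspace is nonempty.\<close>

definition control_cost ::
  "('a \<Rightarrow> 'b::banach) \<Rightarrow> 'a set \<Rightarrow> ('a::banach \<Rightarrow> 'a) \<Rightarrow> ('u::banach \<Rightarrow> 'b) \<Rightarrow> real \<Rightarrow> ennreal"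
  where "control_cost \<iota> D A B T =
    (SUP w0\<in>{w0. norm w0 = 1}.
      INF u\<in>{u\<in>L2 T. \<exists>z. input_map \<iota> D A B T u z \<and> \<iota> (exp_minus D A T w0) + z = 0}.
        ennreal (L2_norm T u))"

end

theory Submission
  imports Defs "HOL-Computational_Algebra.Fundamental_Theorem_Algebra"
begin

text \<open>Let \<open>P = (I + A\<^sup>2)\<^bsup>\<beta>/2\<^esup>\<close> and let \<open>g\<close> be a unit vector with \<open>A g \<approx> \<kappa> g\<close>. Testing the control
  identity for the initial value \<open>g\<close> with the functional \<open>x \<mapsto> \<langle>P x, g\<rangle>\<close>, which is bounded with
  respect to \<open>\<parallel>\<cdot>\<parallel>\<^sub>\<beta>\<close>, gives on one side
  \<open>\<langle>e\<^bsup>-AT\<^esup> g, P g\<rangle> \<approx> e\<^bsup>-\<kappa>T\<^esup> (1 + \<kappa>\<^sup>2)\<^bsup>\<beta>/2\<^esup>\<close>. Since \<open>P\<close> and \<open>e\<^bsup>-At\<^esup>\<close> commute, the integrand on the other side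
  is at most \<open>\<parallel>B\<parallel> \<parallel>u(s)\<parallel> \<parallel>e\<^bsup>-A(T-s)\<^esup> g\<parallel>\<close> with \<open>e\<^bsup>-A(T-s)\<^esup> g \<approx> e\<^bsup>-\<kappa>(T-s)\<^esup> g\<close>, and the Cauchy--Schwarz inequality
  yields the bound. Passing to the real part of the inner product reduces everything to a real
  Hilbert space. There the calculus \<open>f(R)\<close> for \<open>0 \<le> R \<le> I\<close> rests on \<open>\<parallel>p(R)\<parallel> \<le> sup \<bar>p\<bar>\<close> for polynomials,
  and applied to a resolvent of \<open>A\<close> it also provides the semigroup.\<close>

section \<open>Real Hilbert spaces\<close>

text \<open>As \<open>\<kappa>\<close> need not be an eigenvalue, the operators are evaluated on
  approximate eigenvectors only. For the semigroup the error is quantitative: the derivative of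
  \<open>exp (\<kappa> t) e^(-At) g\<close> is at most a constant times
  \<open>norm (A g - \<kappa> g)\<close>, uniformly on \<open>[0, T]\<close>. For \<open>P\<close>
  it is a mere limit, because \<open>P\<close> is reached through polynomials whose constants are
  not uniform. Hence the bound is proved along a sequence \<open>g n\<close> and then in the limit.
  The obstacle on the control side is that \<open>B u(s)\<close> lies in the completion, where the
  pairing with \<open>g\<close> has no direct meaning. On the range of \<open>\<iota>\<close> the
  semigroup can be moved to \<open>g\<close>, and \<open>norm (P x)\<close> is exactly the norm of
  \<open>\<iota> x\<close>; the inequality then passes to the closure with constant 1, so that no
  factor is lost. Since \<open>e^(-At)\<close> is given by a unique description, both existence and
  uniqueness of a semigroup with generator \<open>- A\<close> are proved; uniqueness comes from an
  energy estimate. The time-dependent factor of the final constant is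
  \<open>exp (- 2 \<kappa> T)\<close> divided by the integral of \<open>exp (- 2 \<kappa> s)\<close>
  over \<open>[0, T]\<close>.\<close>

locale real_hilbert =
  fixes ip :: "'a::banach \<Rightarrow> 'a \<Rightarrow> real"
  assumes ip_add_left: "ip (x + y) z = ip x z + ip y z"
    and ip_scaleR_left: "ip (r *\<^sub>R x) y = r * ip x y"
    and ip_commute: "ip x y = ip y x"
    and ip_self: "ip x x = (norm x)\<^sup>2"
begin

lemma ip_add_right: "ip x (y + z) = ip x y + ip x z"
  by (metis ip_add_left ip_commute)

lemma ip_scaleR_right: "ip x (r *\<^sub>R y) = r * ip x y"
  by (metis ip_scaleR_left ip_commute)

lemma ip_minus_left [simp]: "ip (- x) y = - ip x y"
  using ip_scaleR_left[of "-1" x y] by simp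

lemma ip_minus_right [simp]: "ip x (- y) = - ip x y"
  using ip_scaleR_right[of x "-1" y] by simp

lemma ip_diff_left: "ip (x - y) z = ip x z - ip y z"
  using ip_add_left[of x "-y" z] by simp

lemma ip_diff_right: "ip x (y - z) = ip x y - ip x z"
  using ip_add_right[of x y "-z"] by simp

lemma ip_zero_left [simp]: "ip 0 x = 0"
  using ip_scaleR_left[of 0 x x] by simp

lemma ip_zero_right [simp]: "ip x 0 = 0"
  using ip_commute[of x 0] by simp

lemmas ip_simps = ip_add_left ip_add_right ip_diff_left ip_diff_right ip_scaleR_left ip_scaleR_right

lemma norm_add_sq: "(norm (x + y))\<^sup>2 = (norm x)\<^sup>2 + 2 * ip x y + (norm y)\<^sup>2"
  using ip_commute[of x y] by (simp add: ip_simps flip: ip_self)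

lemma norm_diff_sq: "(norm (x - y))\<^sup>2 = (norm x)\<^sup>2 - 2 * ip x y + (norm y)\<^sup>2"
  using ip_commute[of x y] by (simp add: ip_simps flip: ip_self)

lemma Cauchy_Schwarz: "\<bar>ip x y\<bar> \<le> norm x * norm y"
proof (cases "y = 0")
  case False
  define r where "r = ip x y / (norm y)\<^sup>2"
  have "0 \<le> (norm (x - r *\<^sub>R y))\<^sup>2" by simp
  also have "\<dots> = (norm x)\<^sup>2 - 2 * (r * ip x y) + r * (r * (norm y)\<^sup>2)"
    unfolding norm_diff_sq[of x] by (simp add: ip_scaleR_right power_mult_distrib power2_eq_square)
  also have "r * (norm y)\<^sup>2 = ip x y" using False by (simp add: r_def)
  also have "r * ip x y = (ip x y)\<^sup>2 / (norm y)\<^sup>2" by (simp add: r_def power2_eq_square)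
  finally have "(ip x y)\<^sup>2 \<le> (norm x * norm y)\<^sup>2"
    using False by (simp add: field_simps power_mult_distrib)
  then show ?thesis by (metis abs_le_square_iff abs_mult abs_norm_cancel)
qed simp

lemma bounded_bilinear_ip: "bounded_bilinear ip"
proof
  show "\<exists>K. \<forall>a b. norm (ip a b) \<le> norm a * norm b * K"
    using Cauchy_Schwarz by (intro exI[of _ 1]) simp
qed (simp_all add: ip_simps)

sublocale ip: bounded_bilinear ip by (rule bounded_bilinear_ip)

text \<open>A minimizing sequence for the distance from \<open>x\<close> to \<open>V\<close> is
  Cauchy by the parallelogram identity, because midpoints stay in \<open>V\<close>; minimality of
  the limit forces orthogonality.\<close>

lemma projection_exists:
  assumes V: "subspace V" "closed V"
  obtains v where "v \<in> V" "\<And>w. w \<in> V \<Longrightarrow> ip w (x - v) = 0"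
proof -
  define d where "d = (INF v\<in>V. (norm (x - v))\<^sup>2)"
  have ne: "V \<noteq> {}" using V(1) subspace_0 by blast
  have bdd: "bdd_below ((\<lambda>v. (norm (x - v))\<^sup>2) ` V)" by (intro bdd_belowI[of _ 0]) auto
  have dle: "d \<le> (norm (x - v))\<^sup>2" if "v \<in> V" for v
    unfolding d_def using that by (intro cINF_lower bdd)
  have "\<exists>v\<in>V. (norm (x - v))\<^sup>2 < d + inverse (real (Suc n))" for n
  proof -
    have "d < d + inverse (real (Suc n))" by simp
    then show ?thesis unfolding d_def using cINF_less_iff[OF ne bdd] by blast
  qed
  then obtain v where vV: "\<And>n. v n \<in> V" and v: "\<And>n. (norm (x - v n))\<^sup>2 < d + inverse (real (Suc n))"
    by metis
  have close: "(norm (v m - v n))\<^sup>2 \<le> 2 * inverse (real (Suc m)) + 2 * inverse (real (Suc n))" for m n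
  proof -
    have "(1/2) *\<^sub>R (v m + v n) \<in> V" using V(1) vV by (simp add: subspace_add subspace_scale)
    then have "d \<le> (norm (x - (1/2) *\<^sub>R (v m + v n)))\<^sup>2" by (rule dle)
    also have "x - (1/2) *\<^sub>R (v m + v n) = (1/2) *\<^sub>R ((x - v m) + (x - v n))"
      by (simp add: algebra_simps flip: scaleR_2)
    also have "(norm \<dots>)\<^sup>2 = (norm ((x - v m) + (x - v n)))\<^sup>2 / 4"
      by (simp add: power_divide)
    finally have "4 * d \<le> (norm ((x - v m) + (x - v n)))\<^sup>2" by simp
    moreover have "v m - v n = (x - v n) - (x - v m)" by simp
    moreover have "(norm ((x - v n) - (x - v m)))\<^sup>2 + (norm ((x - v m) + (x - v n)))\<^sup>2
        = 2 * (norm (x - v m))\<^sup>2 + 2 * (norm (x - v n))\<^sup>2"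
      unfolding norm_add_sq norm_diff_sq using ip_commute[of "x - v n" "x - v m"] by simp
    ultimately show ?thesis using v[of m] v[of n] by simp
  qed
  have "Cauchy v"
  proof (rule metric_CauchyI)
    fix e :: real assume "0 < e"
    then obtain N where N: "inverse (real (Suc N)) < e\<^sup>2 / 4"
      using reals_Archimedean[of "e\<^sup>2 / 4"] by auto
    have "dist (v m) (v n) < e" if "N \<le> m" "N \<le> n" for m n
    proof -
      have "inverse (real (Suc m)) \<le> inverse (real (Suc N))" "inverse (real (Suc n)) \<le> inverse (real (Suc N))"
        using that by (auto intro!: le_imp_inverse_le)
      then have "(norm (v m - v n))\<^sup>2 < e\<^sup>2" using close[of m n] N by linarith
      then show ?thesis using \<open>0 < e\<close> power_less_imp_less_base[of "norm (v m - v n)" 2 e] by (simp add: dist_norm)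
    qed
    then show "\<exists>M. \<forall>m\<ge>M. \<forall>n\<ge>M. dist (v m) (v n) < e" by blast
  qed
  then obtain w where w: "v \<longlonglongrightarrow> w" using Cauchy_convergent convergent_def by blast
  have wV: "w \<in> V" using V(2) vV w closed_sequentially by blast
  have "(\<lambda>n. d + inverse (real (Suc n))) \<longlonglongrightarrow> d + 0" "(\<lambda>n. (norm (x - v n))\<^sup>2) \<longlonglongrightarrow> (norm (x - w))\<^sup>2"
    by (intro tendsto_intros w LIMSEQ_inverse_real_of_nat)+
  then have wd: "(norm (x - w))\<^sup>2 \<le> d"
    using v by (intro LIMSEQ_le[of _ "(norm (x - w))\<^sup>2" _ d]) (auto intro: less_imp_le)
  have "ip u (x - w) = 0" if u: "u \<in> V" for u
  proof (cases "u = 0")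
    case False
    \<comment> \<open>The best coefficient along \<open>u\<close>: the squared distance would drop
      by \<open>(ip u (x - w))\<^sup>2 / (norm u)\<^sup>2\<close>, so this quantity must
      vanish.\<close>
    define r where "r = ip u (x - w) / (norm u)\<^sup>2"
    have "w + r *\<^sub>R u \<in> V" using V(1) wV u by (simp add: subspace_add subspace_scale)
    then have "(norm (x - w))\<^sup>2 \<le> (norm ((x - w) - r *\<^sub>R u))\<^sup>2"
      using dle[of "w + r *\<^sub>R u"] wd unfolding diff_diff_eq by linarith
    also have "\<dots> = (norm (x - w))\<^sup>2 - (ip u (x - w))\<^sup>2 / (norm u)\<^sup>2"
      unfolding norm_diff_sq[of "x - w"] r_def using False ip_commute[of "x - w" u]
      by (simp add: ip_scaleR_right ip_scaleR_left power_mult_distrib power2_eq_square field_simps)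
    finally show ?thesis using False by (simp add: divide_le_0_iff)
  qed simp
  then show ?thesis using that wV by blast
qed

text \<open>Converts a trivial orthogonal complement into surjectivity; applied to the range of
  \<open>A - \<kappa>\<close>.\<close>

lemma closed_subspace_eq_UNIV:
  assumes "subspace V" "closed V" and "\<And>y. (\<And>v. v \<in> V \<Longrightarrow> ip v y = 0) \<Longrightarrow> y = 0"
  shows "V = UNIV"
proof -
  have "x \<in> V" for x
  proof -
    obtain v where v: "v \<in> V" "\<And>w. w \<in> V \<Longrightarrow> ip w (x - v) = 0"
      using projection_exists[OF assms(1,2)] by blast
    then have "x - v = 0" using assms(3) by blast
    with v(1) show ?thesis by simp
  qed
  then show ?thesis by auto
qed

end

text \<open>The product norm is Euclidean, so it fits the sum of the inner products. This is the
  setting for projecting onto the graph of \<open>A\<close>.\<close>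

lemma real_hilbert_prod:
  assumes "real_hilbert ip"
  shows "real_hilbert (\<lambda>p q. ip (fst p) (fst q) + ip (snd p) (snd q))"
proof -
  interpret real_hilbert ip by fact
  show ?thesis
    by standard (auto simp: ip_simps algebra_simps norm_prod_def ip_self ip_commute)
qed


section \<open>Polynomials of an operator\<close>

text \<open>Degrees may drop under addition; padding with zero coefficients lets all sums run to a
  common index.\<close>

lemma poly_op_eq_sum:
  assumes "degree p \<le> n"
  shows "poly_op p R x = (\<Sum>i\<le>n. coeff p i *\<^sub>R (R ^^ i) x)"
  unfolding poly_op_def using assms
  by (intro sum.mono_neutral_left) (auto simp: coeff_eq_0)

lemma poly_op_0 [simp]: "poly_op 0 R x = 0"
  by (simp add: poly_op_def)

lemma poly_op_const [simp]: "poly_op [:a:] R x = a *\<^sub>R x"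
  by (simp add: poly_op_def)

lemma poly_op_add: "poly_op (p + q) R x = poly_op p R x + poly_op q R x"
proof -
  define n where "n = max (degree p) (degree q)"
  have "degree (p + q) \<le> n" "degree p \<le> n" "degree q \<le> n"
    by (auto simp: n_def degree_add_le_max)
  then show ?thesis
    by (simp add: poly_op_eq_sum[of _ n] scaleR_add_left sum.distrib)
qed

lemma poly_op_smult: "poly_op (smult a p) R x = a *\<^sub>R poly_op p R x"
proof -
  have "degree (smult a p) \<le> degree p" by (rule degree_smult_le)
  then show ?thesis
    by (simp add: poly_op_eq_sum[of _ "degree p"] scaleR_right.sum)
qed

lemma poly_op_minus: "poly_op (- p) R x = - poly_op p R x"
  using poly_op_smult[of "-1" p R x] by simp

lemma poly_op_diff: "poly_op (p - q) R x = poly_op p R x - poly_op q R x"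
  using poly_op_add[of p "-q" R x] by (simp add: poly_op_minus)

context
  fixes R :: "'a::real_normed_vector \<Rightarrow> 'a"
  assumes R: "bounded_linear R"
begin

interpretation R: bounded_linear R by (rule R)

lemma poly_op_pCons: "poly_op (pCons a p) R x = a *\<^sub>R x + R (poly_op p R x)"
proof -
  have "poly_op (pCons a p) R x = (\<Sum>i\<le>Suc (degree p). coeff (pCons a p) i *\<^sub>R (R ^^ i) x)"
    by (intro poly_op_eq_sum degree_pCons_le)
  also have "\<dots> = a *\<^sub>R x + (\<Sum>i\<le>degree p. coeff p i *\<^sub>R R ((R ^^ i) x))"
    by (subst sum.atMost_Suc_shift) simp
  finally show ?thesis by (simp add: poly_op_def R.sum R.scaleR)
qed

lemma bounded_linear_poly_op: "bounded_linear (poly_op p R)"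
proof (induction p)
  case 0
  then show ?case by (simp add: bounded_linear_zero)
next
  case (pCons a p)
  then have "bounded_linear (\<lambda>x. a *\<^sub>R x + R (poly_op p R x))"
    by (intro bounded_linear_add bounded_linear_scaleR_right bounded_linear_compose[OF R])
  moreover have "poly_op (pCons a p) R = (\<lambda>x. a *\<^sub>R x + R (poly_op p R x))"
    by (rule ext) (rule poly_op_pCons)
  ultimately show ?case by simp
qed

lemma poly_op_mult: "poly_op (p * q) R x = poly_op p R (poly_op q R x)"
proof (induction p)
  case (pCons a p)
  then show ?case by (simp add: poly_op_add poly_op_smult poly_op_pCons)
qed simp

lemma poly_op_X: "poly_op [:0, 1:] R x = R x"
  by (simp add: poly_op_pCons R.zero)

lemma poly_op_commute:
  assumes F: "bounded_linear F" and "\<And>x. F (R x) = R (F x)"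
  shows "F (poly_op p R x) = poly_op p R (F x)"
proof -
  interpret F: bounded_linear F by fact
  show ?thesis
  proof (induction p)
    case (pCons a p)
    then show ?case using assms(2) by (simp add: poly_op_pCons F.add F.scaleR)
  qed (simp add: F.zero)
qed

text \<open>\<open>X - \<mu>\<close> divides \<open>p - p(\<mu>)\<close>, and the quotient gives a
  bounded operator. \<open>C\<close> depends on \<open>p\<close> and \<open>\<mu>\<close> but not on
  \<open>x\<close>.\<close>

lemma poly_op_approx_eigenvector:
  "\<exists>C\<ge>0. \<forall>x. norm (poly_op p R x - poly p \<mu> *\<^sub>R x) \<le> C * norm (R x - \<mu> *\<^sub>R x)"
proof -
  have "poly (p - [:poly p \<mu>:]) \<mu> = 0" by simp
  then obtain q where q: "p - [:poly p \<mu>:] = [:-\<mu>, 1:] * q"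
    by (metis poly_eq_0_iff_dvd dvdE)
  obtain C where C: "C \<ge> 0" "\<And>y. norm (poly_op q R y) \<le> norm y * C"
    using bounded_linear.nonneg_bounded[OF bounded_linear_poly_op[of q]] by blast
  have "poly_op p R x - poly p \<mu> *\<^sub>R x = poly_op q R (R x - \<mu> *\<^sub>R x)" for x
  proof -
    have "poly_op p R x - poly p \<mu> *\<^sub>R x = poly_op (q * [:-\<mu>, 1:]) R x"
      using q by (metis mult.commute poly_op_diff poly_op_const)
    also have "\<dots> = poly_op q R (R x - \<mu> *\<^sub>R x)"
      by (simp only: poly_op_mult) (simp add: poly_op_pCons R.zero)
    finally show ?thesis .
  qed
  with C show ?thesis by (metis mult.commute)
qed

end


section \<open>Functional calculus for a self-adjoint contraction\<close>

locale pos_contraction = real_hilbert ip for ip :: "'a::banach \<Rightarrow> 'a \<Rightarrow> real" +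
  fixes R :: "'a \<Rightarrow> 'a"
  assumes bounded_linear_R: "bounded_linear R"
    and R_sym: "ip (R x) y = ip x (R y)"
    and R_nonneg: "0 \<le> ip (R x) x"
    and R_le: "ip (R x) x \<le> (norm x)\<^sup>2"
begin

sublocale R: bounded_linear R by (rule bounded_linear_R)

lemmas poly_op_pCons = poly_op_pCons[OF bounded_linear_R]
  and poly_op_mult = poly_op_mult[OF bounded_linear_R]
  and bounded_linear_poly_op = bounded_linear_poly_op[OF bounded_linear_R]

lemma poly_op_sym: "ip (poly_op p R x) y = ip x (poly_op p R y)"
proof (induction p arbitrary: x y)
  case (pCons a p)
  have "R (poly_op p R y) = poly_op p R (R y)" for y
    by (rule poly_op_commute[OF bounded_linear_R bounded_linear_R]) simp
  with pCons show ?case by (simp add: poly_op_pCons ip_simps R_sym)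
qed simp

text \<open>On unit vectors the form \<open>ip (R x) x\<close> takes values in
  \<open>[0, 1]\<close>, so it stays away from \<open>a\<close>.\<close>

lemma bounded_below_linear_factor:
  assumes "a \<notin> {0..1}"
  shows "\<exists>c>0. \<forall>x. c * norm x \<le> norm (poly_op [:-a, 1:] R x)"
proof -
  have eq: "poly_op [:-a, 1:] R x = R x - a *\<^sub>R x" for x
    by (simp add: poly_op_pCons R.zero)
  \<comment> \<open>The distance from \<open>a\<close> to \<open>[0, 1]\<close>.\<close>
  define c where "c = (if a < 0 then - a else a - 1)"
  have "c * (norm x)\<^sup>2 \<le> \<bar>ip (R x - a *\<^sub>R x) x\<bar>" for x
    using R_nonneg[of x] R_le[of x] assms by (auto simp: c_def ip_simps ip_self algebra_simps)
  then have "c * norm x * norm x \<le> norm (R x - a *\<^sub>R x) * norm x" for x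
    using Cauchy_Schwarz[of "R x - a *\<^sub>R x" x] by (smt (verit) mult.assoc power2_eq_square)
  then have "x \<noteq> 0 \<Longrightarrow> c * norm x \<le> norm (R x - a *\<^sub>R x)" for x
    by (rule mult_right_le_imp_le[of "c * norm x" "norm x"]) auto
  then have "c * norm x \<le> norm (R x - a *\<^sub>R x)" for x
    by (cases "x = 0") auto
  moreover have "c > 0" using assms by (auto simp: c_def)
  ultimately show ?thesis by (auto simp: eq)
qed

text \<open>The real factor with roots \<open>a + i b\<close> and \<open>a - i b\<close> is
  \<open>(X - a)^2 + b^2\<close>; by symmetry of \<open>R\<close> its quadratic form is
  \<open>(norm (R x - a x))^2 + b^2 (norm x)^2\<close>.\<close>

lemma bounded_below_quadratic_factor:
  assumes "b \<noteq> 0"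
  shows "\<exists>c>0. \<forall>x. c * norm x \<le> norm (poly_op [:a\<^sup>2 + b\<^sup>2, -2 * a, 1:] R x)"
proof (intro exI conjI allI)
  show "b\<^sup>2 > 0" using assms by simp
  fix x
  let ?y = "poly_op [:a\<^sup>2 + b\<^sup>2, -2 * a, 1:] R x"
  have "ip ?y x = (norm (R x - a *\<^sub>R x))\<^sup>2 + b\<^sup>2 * (norm x)\<^sup>2"
    unfolding norm_diff_sq
    by (simp add: poly_op_pCons R.zero R.add R.diff R.scaleR R.neg ip_simps R_sym power_mult_distrib flip: ip_self)
       (simp add: algebra_simps power2_eq_square)
  then have "b\<^sup>2 * (norm x)\<^sup>2 \<le> ip ?y x" by simp
  also have "\<dots> \<le> norm ?y * norm x" using Cauchy_Schwarz[of ?y x] by linarith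
  finally have "b\<^sup>2 * norm x * norm x \<le> norm ?y * norm x" by (simp add: power2_eq_square mult.assoc)
  then show "b\<^sup>2 * norm x \<le> norm ?y" by (cases "x = 0") auto
qed

lemma bounded_below_mult:
  assumes "\<exists>c>0. \<forall>x. c * norm x \<le> norm (poly_op p R x)"
    and "\<exists>c>0. \<forall>x. c * norm x \<le> norm (poly_op q R x)"
  shows "\<exists>c>0. \<forall>x. c * norm x \<le> norm (poly_op (p * q) R x)"
proof -
  obtain c d where c: "c > 0" "\<And>x. c * norm x \<le> norm (poly_op p R x)"
    and d: "d > 0" "\<And>x. d * norm x \<le> norm (poly_op q R x)" using assms by blast
  have "(c * d) * norm x \<le> norm (poly_op (p * q) R x)" for x
    using mult_left_mono[OF d(2)[of x], of c] c(2)[of "poly_op q R x"] c(1)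
    unfolding poly_op_mult mult.assoc by linarith
  then show ?thesis using c(1) d(1) by (intro exI[of _ "c * d"]) auto
qed

end

section \<open>Factorization of real polynomials\<close>

lemma poly_map_of_real_mult:
  "map_poly complex_of_real (p * q) = map_poly complex_of_real p * map_poly complex_of_real q"
  by (rule poly_eqI) (simp add: coeff_map_poly coeff_mult)

lemma poly_map_of_real_add:
  "map_poly complex_of_real (p + q) = map_poly complex_of_real p + map_poly complex_of_real q"
  by (rule poly_eqI) (simp add: coeff_map_poly)

text \<open>The fundamental theorem of algebra gives a root \<open>a + i b\<close>. If
  \<open>b\<close> is nonzero, the remainder of \<open>q\<close> modulo
  \<open>(X - a)^2 + b^2\<close> is real, of degree at most 1 and has a nonreal root, hence is
  zero.\<close>

lemma real_poly_factor:
  fixes q :: "real poly"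
  assumes "degree q > 0"
  obtains (linear) a r where "q = [:-a, 1:] * r"
  | (quadratic) a b r where "b \<noteq> 0" "q = [:a\<^sup>2 + b\<^sup>2, -2 * a, 1:] * r"
proof -
  let ?c = "map_poly complex_of_real"
  have "degree (?c q) > 0" using assms by (simp add: degree_map_poly)
  then have "\<not> constant (poly (?c q))" by (simp add: constant_degree)
  then obtain z where z: "poly (?c q) z = 0" using fundamental_theorem_of_algebra by blast
  define a b where "a = Re z" and "b = Im z"
  show thesis
  proof (cases "b = 0")
    case True
    then have za: "z = of_real a" by (simp add: a_def b_def complex_eq_iff)
    have "poly (?c p) (of_real a) = of_real (poly p a)" for p
      by (induction p) (auto simp: map_poly_pCons)
    then have "poly q a = 0" using z za by simp
    then show thesis using linear by (metis poly_eq_0_iff_dvd dvdE)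
  next
    case False
    define d where "d = [:a\<^sup>2 + b\<^sup>2, -2 * a, 1:]"
    have dz: "poly (?c d) z = 0"
      by (simp add: d_def map_poly_pCons complex_eq_iff a_def b_def power2_eq_square algebra_simps)
    define s where "s = q mod d"
    have "?c q = ?c (q div d) * ?c d + ?c s"
      unfolding s_def by (simp flip: poly_map_of_real_mult poly_map_of_real_add)
    then have sz: "poly (?c s) z = 0" using z dz by simp
    have "degree d = 2" by (simp add: d_def)
    then have "degree s < 2" using degree_mod_less[of d q] by (fastforce simp: s_def)
    then have "s = [:coeff s 0, coeff s 1:]"
      by (intro poly_eqI) (auto simp: coeff_pCons coeff_eq_0 split: nat.split)
    then have "of_real (coeff s 0) + z * of_real (coeff s 1) = 0"
      using sz by (metis (no_types, lifting) add.right_neutral map_poly_0 map_poly_pCons mult_zero_right of_real_0 poly_0 poly_pCons)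
    then have "coeff s 1 = 0" "coeff s 0 = 0"
      using False by (auto simp: complex_eq_iff b_def)
    then have "s = 0" using \<open>s = [:coeff s 0, coeff s 1:]\<close> by simp
    then have "q = d * (q div d)" unfolding s_def by (simp add: mod_eq_0_iff_dvd)
    then show thesis using quadratic False unfolding d_def by blast
  qed
qed

section \<open>Lower bounds and the norm bound for polynomials of \<open>R\<close>\<close>

context pos_contraction
begin

text \<open>Takes the place of the spectral mapping theorem: the factors of \<open>q\<close> are
  linear with root off \<open>[0, 1]\<close> or quadratic without real root, each is bounded below,
  and so are compositions.\<close>

lemma poly_op_bounded_below:
  assumes "\<And>t. t \<in> {0..1} \<Longrightarrow> poly q t \<noteq> 0"
  shows "\<exists>c>0. \<forall>x. c * norm x \<le> norm (poly_op q R x)"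
  using assms
proof (induction "degree q" arbitrary: q rule: less_induct)
  case less
  show ?case
  proof (cases "degree q = 0")
    case True
    then obtain a where q: "q = [:a:]" by (metis degree_eq_zeroE)
    then have "a \<noteq> 0" using less.prems[of 0] by auto
    then show ?thesis by (intro exI[of _ "\<bar>a\<bar>"]) (auto simp: q)
  next
    case False
    then have deg: "degree q > 0" by simp
    have r: "\<exists>c>0. \<forall>x. c * norm x \<le> norm (poly_op r R x)" if "q = d * r" "degree d > 0" for d r
    proof (rule less.hyps)
      have "d \<noteq> 0" "r \<noteq> 0" using that deg by auto
      then show "degree r < degree q" using that by (simp add: degree_mult_eq)
    next
      fix t :: real assume "t \<in> {0..1}"
      then show "poly r t \<noteq> 0" using less.prems that(1) by auto
    qed
    from deg show ?thesis
    proof (cases rule: real_poly_factor)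
      case (linear a r)
      then have "a \<notin> {0..1}" using less.prems[of a] by auto
      then show ?thesis unfolding linear
        using r[OF linear] by (intro bounded_below_mult bounded_below_linear_factor) auto
    next
      case (quadratic a b r)
      then show ?thesis unfolding quadratic(2)
        using r[OF quadratic(2)] by (intro bounded_below_mult bounded_below_quadratic_factor) auto
    qed
  qed
qed

text \<open>If \<open>N = \<parallel>p(R)\<parallel> > M\<close>, then \<open>N\<^sup>2 - p\<^sup>2\<close> has no root in \<open>[0, 1]\<close>, so that \<open>N\<^sup>2 - p(R)\<^sup>2\<close> is bounded
  below; but it is small on vectors at which \<open>p(R)\<close> almost attains its norm.\<close>

lemma norm_poly_op_le:
  assumes M: "\<And>t. t \<in> {0<..1} \<Longrightarrow> \<bar>poly p t\<bar> \<le> M"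
  shows "norm (poly_op p R x) \<le> M * norm x"
proof -
  \<comment> \<open>Factoring needs the closed interval, while the bound is given on
    \<open>(0, 1]\<close>; continuity supplies the point \<open>0\<close>.\<close>
  have M1: "\<bar>poly p t\<bar> \<le> M" if "t \<in> {0..1}" for t
  proof -
    have "continuous_on (closure {0<..1}) (\<lambda>t. \<bar>poly p t\<bar>)" by (intro continuous_intros)
    moreover have "t \<in> closure {0<..1}" using that by (simp add: closure_greaterThanAtMost)
    ultimately show ?thesis using M by (rule continuous_le_on_closure)
  qed
  define N where "N = onorm (poly_op p R)"
  have bl: "bounded_linear (poly_op p R)" by (rule bounded_linear_poly_op)
  have N: "norm (poly_op p R x) \<le> N * norm x" for x
    unfolding N_def by (rule onorm[OF bl])
  have "N \<le> M"
  proof (rule ccontr)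
    assume "\<not> N \<le> M"
    moreover have "0 \<le> M" using M1[of 0] by simp
    ultimately have NM: "N > M" "N > 0" by auto
    define q where "q = [:N\<^sup>2:] - p * p"
    have "poly q t \<noteq> 0" if "t \<in> {0..1}" for t
    proof -
      have "(poly p t)\<^sup>2 < N\<^sup>2" using power_strict_mono[of "\<bar>poly p t\<bar>" N 2] M1[OF that] NM by simp
      then show ?thesis by (simp add: q_def power2_eq_square)
    qed
    from poly_op_bounded_below[OF this] obtain c where c: "c > 0"
      "\<And>x. c * norm x \<le> norm (poly_op q R x)" by blast
    have qx: "poly_op q R x = N\<^sup>2 *\<^sub>R x - poly_op p R (poly_op p R x)" for x
      by (simp add: q_def poly_op_diff poly_op_mult)
    \<comment> \<open>Expanding \<open>(norm (q(R) x))^2\<close> and estimating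
      \<open>p(R) (p(R) x)\<close> by \<open>N\<close> times \<open>p(R) x\<close> turns the lower
      bound \<open>c\<close> into a gap: on unit vectors \<open>(norm (p(R) x))^2\<close> stays
      below \<open>N^2\<close> by \<open>c^2 / N^2\<close>, against the choice of
      \<open>N\<close>.\<close>
    have le: "(norm (poly_op p R x))\<^sup>2 \<le> (N\<^sup>2 - c\<^sup>2 / N\<^sup>2) * (norm x)\<^sup>2" for x
    proof -
      have "c\<^sup>2 * (norm x)\<^sup>2 \<le> (norm (poly_op q R x))\<^sup>2"
        using power_mono[OF c(2)[of x], of 2] c(1) by (simp add: power_mult_distrib)
      also have "\<dots> = N^4 * (norm x)\<^sup>2 - 2 * N\<^sup>2 * (norm (poly_op p R x))\<^sup>2
          + (norm (poly_op p R (poly_op p R x)))\<^sup>2"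
        unfolding qx norm_diff_sq using poly_op_sym[of p x "poly_op p R x"]
        by (simp add: ip_simps ip_self power_mult_distrib)
      also have "\<dots> \<le> N^4 * (norm x)\<^sup>2 - 2 * N\<^sup>2 * (norm (poly_op p R x))\<^sup>2
          + N\<^sup>2 * (norm (poly_op p R x))\<^sup>2"
        using power_mono[OF N[of "poly_op p R x"], of 2] by (simp add: power_mult_distrib)
      finally have "N\<^sup>2 * (norm (poly_op p R x))\<^sup>2 \<le> (N^4 - c\<^sup>2) * (norm x)\<^sup>2"
        by (simp add: algebra_simps)
      then have "(norm (poly_op p R x))\<^sup>2 \<le> (N^4 - c\<^sup>2) * (norm x)\<^sup>2 / N\<^sup>2"
        using NM by (simp add: pos_le_divide_eq mult.commute)
      also have "\<dots> = (N\<^sup>2 - c\<^sup>2 / N\<^sup>2) * (norm x)\<^sup>2"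
        using NM by (simp add: field_simps power2_eq_square power4_eq_xxxx)
      finally show ?thesis .
    qed
    \<comment> \<open>The maximum with \<open>0\<close> prepares for the square root; the sign of
      the difference is not known here.\<close>
    define L where "L = max 0 (N\<^sup>2 - c\<^sup>2 / N\<^sup>2)"
    then have L: "0 \<le> L" "N\<^sup>2 - c\<^sup>2 / N\<^sup>2 \<le> L" by auto
    have "norm (poly_op p R x) \<le> sqrt L * norm x" for x
    proof -
      have "(norm (poly_op p R x))\<^sup>2 \<le> L * (norm x)\<^sup>2"
        by (rule order_trans[OF le[of x] mult_right_mono[OF L(2) zero_le_power2]])
      also have "\<dots> = (sqrt L * norm x)\<^sup>2" using L(1) by (simp add: power_mult_distrib)
      finally show ?thesis by (rule power2_le_imp_le) (use L(1) in auto)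
    qed
    then have "N \<le> sqrt L" unfolding N_def using L(1) by (intro onorm_bound) auto
    then have "N\<^sup>2 \<le> (sqrt L)\<^sup>2" using NM(2) by (intro power_mono) auto
    then have "N\<^sup>2 \<le> L" using L(1) by simp
    moreover have "L < N\<^sup>2" using NM(2) c(1) by (simp add: L_def)
    ultimately show False by simp
  qed
  then show ?thesis using N[of x] by (smt (verit) mult_right_mono norm_ge_zero)
qed

end

section \<open>Functions approximable by polynomials on (0, 1]\<close>

lemma poly_add_ext: "poly (p + q) = (\<lambda>t. poly p t + poly q t)"
  and poly_mult_ext: "poly (p * q) = (\<lambda>t. poly p t * poly q t)"
  by (simp_all add: fun_eq_iff)

text \<open>For any other \<open>f\<close> the condition in \<open>cont_fun_calc\<close> is vacuous
  and the description meaningless; hence the hypothesis in the rules of the calculus.\<close>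

definition poly_approximable :: "(real \<Rightarrow> real) \<Rightarrow> bool"
  where "poly_approximable f \<longleftrightarrow> (\<exists>p. uniform_limit {0<..1} (\<lambda>n. poly (p n)) f sequentially)"

lemma poly_approximable_poly: "poly_approximable (poly p)"
  unfolding poly_approximable_def by (intro exI[of _ "\<lambda>_. p"] uniform_limit_const)

lemma poly_approximable_bounded:
  assumes "poly_approximable f"
  shows "bounded (f ` {0<..1})"
proof -
  obtain p where p: "uniform_limit {0<..1} (\<lambda>n. poly (p n)) f sequentially"
    using assms by (auto simp: poly_approximable_def)
  have "bounded (poly (p n) ` {0<..1})" for n
  proof (rule bounded_subset)
    show "bounded (poly (p n) ` {0..1})"
      by (intro compact_imp_bounded compact_continuous_image continuous_intros) auto
  qed auto
  then show ?thesis
    by (intro uniform_limit_bounded[OF p]) (auto simp: bounded_iff)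
qed

lemma poly_approximable_cong:
  assumes "poly_approximable f" "\<And>t. t \<in> {0<..1} \<Longrightarrow> f t = g t"
  shows "poly_approximable g"
proof -
  obtain p where "uniform_limit {0<..1} (\<lambda>n. poly (p n)) f sequentially"
    using assms(1) by (auto simp: poly_approximable_def)
  also have "uniform_limit {0<..1} (\<lambda>n. poly (p n)) f sequentially = uniform_limit {0<..1} (\<lambda>n. poly (p n)) g sequentially"
    by (intro uniform_limit_cong') (use assms(2) in auto)
  finally have "uniform_limit {0<..1} (\<lambda>n. poly (p n)) g sequentially" .
  then show ?thesis by (auto simp: poly_approximable_def)
qed

text \<open>\<open>g\<close> is a continuous extension of \<open>f\<close> from
  \<open>(0, 1]\<close>; at \<open>0\<close> the two may differ. The approximants are the Bernstein
  polynomials of \<open>g\<close>.\<close>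

lemma poly_approximable_continuous:
  assumes g: "continuous_on {0..1} g" and eq: "\<And>t. t \<in> {0<..1} \<Longrightarrow> g t = f t"
  shows "poly_approximable f"
proof -
  define b where "b n k = smult (g (real k / real n) * real (n choose k)) ([:0, 1:] ^ k * [:1, -1:] ^ (n - k))"
    for n k :: nat
  define p where "p n = (\<Sum>k\<le>n. b n k)" for n
  have p: "poly (p n) t = (\<Sum>k\<le>n. g (real k / real n) * Bernstein n k t)" for n t
    by (simp add: p_def b_def poly_sum Bernstein_def mult.assoc)
  have "uniform_limit {0<..1} (\<lambda>n. poly (p n)) g sequentially"
    unfolding uniform_limit_sequentially_iff
  proof (intro allI impI)
    fix e :: real assume "0 < e"
    from Bernstein_Weierstrass[OF g this]
    show "\<exists>N. \<forall>n\<ge>N. \<forall>x\<in>{0<..1}. dist (poly (p n) x) (g x) < e"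
      by (simp add: p dist_real_def abs_minus_commute) (meson greaterThanAtMost_iff less_imp_le)
  qed
  then have "poly_approximable g" by (auto simp: poly_approximable_def)
  then show ?thesis using eq by (rule poly_approximable_cong)
qed

lemma poly_approximable_add:
  assumes "poly_approximable f" "poly_approximable g"
  shows "poly_approximable (\<lambda>t. f t + g t)"
proof -
  obtain p q where "uniform_limit {0<..1} (\<lambda>n. poly (p n)) f sequentially"
    "uniform_limit {0<..1} (\<lambda>n. poly (q n)) g sequentially"
    using assms by (auto simp: poly_approximable_def)
  then have "uniform_limit {0<..1} (\<lambda>n t. poly (p n) t + poly (q n) t) (\<lambda>t. f t + g t) sequentially"
    by (rule uniform_limit_add)
  then show ?thesis unfolding poly_approximable_def by (intro exI[of _ "\<lambda>n. p n + q n"]) (simp add: poly_add_ext)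
qed

lemma poly_approximable_mult:
  assumes "poly_approximable f" "poly_approximable g"
  shows "poly_approximable (\<lambda>t. f t * g t)"
proof -
  obtain p q where "uniform_limit {0<..1} (\<lambda>n. poly (p n)) f sequentially"
    "uniform_limit {0<..1} (\<lambda>n. poly (q n)) g sequentially"
    using assms by (auto simp: poly_approximable_def)
  then have "uniform_limit {0<..1} (\<lambda>n t. poly (p n) t * poly (q n) t) (\<lambda>t. f t * g t) sequentially"
    by (intro uniform_lim_mult poly_approximable_bounded assms)
  then show ?thesis unfolding poly_approximable_def by (intro exI[of _ "\<lambda>n. p n * q n"]) (simp add: poly_mult_ext)
qed

section \<open>The calculus as a limit and its algebraic properties\<close>

context pos_contraction
begin

text \<open>By \<open>norm_poly_op_le\<close>, uniform closeness on \<open>(0, 1]\<close> becomes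
  closeness of the operators. This makes the limit in \<open>cont_fun_calc\<close> independent of
  the approximating sequence.\<close>

lemma poly_op_tendsto_unique:
  assumes "uniform_limit {0<..1} (\<lambda>n. poly (p n)) f sequentially"
    and "uniform_limit {0<..1} (\<lambda>n. poly (q n)) f sequentially"
  shows "(\<lambda>n. poly_op (q n) R x - poly_op (p n) R x) \<longlonglongrightarrow> 0"
proof (rule LIMSEQ_I)
  fix r :: real assume r: "0 < r"
  \<comment> \<open>The factor 2 pays for the two distances to \<open>f\<close>; the summand 1
    covers \<open>x = 0\<close> and makes the final inequality strict.\<close>
  define e where "e = r / (2 * (norm x + 1))"
  have e: "0 < e" using r by (simp add: e_def add_nonneg_pos)
  obtain N M where N: "\<And>n t. n \<ge> N \<Longrightarrow> t \<in> {0<..1} \<Longrightarrow> dist (poly (p n) t) (f t) < e"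
    and M: "\<And>n t. n \<ge> M \<Longrightarrow> t \<in> {0<..1} \<Longrightarrow> dist (poly (q n) t) (f t) < e"
    using assms e unfolding uniform_limit_sequentially_iff by metis
  have "norm (poly_op (q n) R x - poly_op (p n) R x) < r" if "n \<ge> max N M" for n
  proof -
    have "\<bar>poly (q n - p n) t\<bar> \<le> 2 * e" if "t \<in> {0<..1}" for t
      using N[of n t] M[of n t] that \<open>n \<ge> max N M\<close> by (simp add: dist_real_def)
    from norm_poly_op_le[OF this, of x]
    have "norm (poly_op (q n) R x - poly_op (p n) R x) \<le> 2 * e * norm x" by (simp add: poly_op_diff)
    also have "\<dots> < 2 * e * (norm x + 1)" using e by simp
    also have "\<dots> = r"
      proof -
        have "2 * norm x + 2 \<noteq> 0" using norm_ge_zero[of x] by linarith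
        then show ?thesis by (simp add: e_def field_simps)
      qed
    finally show ?thesis .
  qed
  then show "\<exists>no. \<forall>n\<ge>no. norm (poly_op (q n) R x - poly_op (p n) R x - 0) < r"
    by (intro exI[of _ "max N M"]) simp
qed

text \<open>Uniformly Cauchy polynomials give Cauchy vectors, so the limit exists. The rules below
  pass from polynomials to the limit through this fact.\<close>

lemma poly_op_tendsto_fun_calc:
  assumes p: "uniform_limit {0<..1} (\<lambda>n. poly (p n)) f sequentially"
  shows "(\<lambda>n. poly_op (p n) R x) \<longlonglongrightarrow> cont_fun_calc R f x"
proof -
  have "Cauchy (\<lambda>n. poly_op (p n) R x)"
  proof (rule metric_CauchyI)
    fix r :: real assume r: "0 < r"
    define e where "e = r / (2 * (norm x + 1))"
    have e: "0 < e" using r by (simp add: e_def add_nonneg_pos)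
    obtain N where N: "\<And>n t. n \<ge> N \<Longrightarrow> t \<in> {0<..1} \<Longrightarrow> dist (poly (p n) t) (f t) < e"
      using p e unfolding uniform_limit_sequentially_iff by metis
    have "dist (poly_op (p m) R x) (poly_op (p n) R x) < r" if "m \<ge> N" "n \<ge> N" for m n
    proof -
      have "\<bar>poly (p m - p n) t\<bar> \<le> 2 * e" if "t \<in> {0<..1}" for t
        using N[of n t] N[of m t] that \<open>m \<ge> N\<close> \<open>n \<ge> N\<close> by (simp add: dist_real_def)
      from norm_poly_op_le[OF this, of x]
      have "dist (poly_op (p m) R x) (poly_op (p n) R x) \<le> 2 * e * norm x"
        by (simp add: poly_op_diff dist_norm)
      also have "\<dots> < 2 * e * (norm x + 1)" using e by simp
      also have "\<dots> = r"
      proof -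
        have "2 * norm x + 2 \<noteq> 0" using norm_ge_zero[of x] by linarith
        then show ?thesis by (simp add: e_def field_simps)
      qed
      finally show ?thesis .
    qed
    then show "\<exists>M. \<forall>m\<ge>M. \<forall>n\<ge>M. dist (poly_op (p m) R x) (poly_op (p n) R x) < r" by blast
  qed
  then obtain y where y: "(\<lambda>n. poly_op (p n) R x) \<longlonglongrightarrow> y"
    using Cauchy_convergent convergent_def by blast
  have "\<forall>q. uniform_limit {0<..1} (\<lambda>n. poly (q n)) f sequentially \<longrightarrow> (\<lambda>n. poly_op (q n) R x) \<longlonglongrightarrow> y"
  proof (intro allI impI)
    fix q :: "nat \<Rightarrow> real poly" assume "uniform_limit {0<..1} (\<lambda>n. poly (q n)) f sequentially"
    from tendsto_add[OF poly_op_tendsto_unique[OF p this, of x] y]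
    show "(\<lambda>n. poly_op (q n) R x) \<longlonglongrightarrow> y" by simp
  qed
  then have "cont_fun_calc R f x = y"
    unfolding cont_fun_calc_def using p y by (intro the_equality) (auto intro: LIMSEQ_unique)
  then show ?thesis using y by simp
qed

lemma fun_calc_poly: "cont_fun_calc R (poly p) x = poly_op p R x"
  using poly_op_tendsto_fun_calc[where p = "\<lambda>_. p" and f = "poly p" and x = x]
  by (simp add: uniform_limit_const LIMSEQ_const_iff)

lemma fun_calc_id: "cont_fun_calc R (\<lambda>t. t) x = R x"
proof -
  have "(\<lambda>t. t) = poly [:0, 1::real:]" by auto
  then show ?thesis using fun_calc_poly[of "[:0, 1:]" x] poly_op_X[OF bounded_linear_R, of x] by simp
qed

lemma fun_calc_const: "cont_fun_calc R (\<lambda>t. c) x = c *\<^sub>R x"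
proof -
  have "(\<lambda>t. c) = poly [:c:]" by auto
  then show ?thesis using fun_calc_poly[of "[:c:]" x] by simp
qed

lemma fun_calc_add:
  assumes "poly_approximable f" "poly_approximable g"
  shows "cont_fun_calc R (\<lambda>t. f t + g t) x = cont_fun_calc R f x + cont_fun_calc R g x"
proof -
  obtain p q where pq: "uniform_limit {0<..1} (\<lambda>n. poly (p n)) f sequentially"
    "uniform_limit {0<..1} (\<lambda>n. poly (q n)) g sequentially"
    using assms by (auto simp: poly_approximable_def)
  then have "uniform_limit {0<..1} (\<lambda>n. poly (p n + q n)) (\<lambda>t. f t + g t) sequentially"
    using uniform_limit_add[OF pq] by (simp add: poly_add_ext)
  from poly_op_tendsto_fun_calc[OF this, of x]
  show ?thesis unfolding poly_op_add
    using tendsto_add[OF poly_op_tendsto_fun_calc[OF pq(1), of x] poly_op_tendsto_fun_calc[OF pq(2), of x]]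
    by (rule LIMSEQ_unique)
qed

lemma fun_calc_sym:
  assumes "poly_approximable f"
  shows "ip (cont_fun_calc R f x) y = ip x (cont_fun_calc R f y)"
proof -
  obtain p where p: "uniform_limit {0<..1} (\<lambda>n. poly (p n)) f sequentially"
    using assms by (auto simp: poly_approximable_def)
  have "(\<lambda>n. ip (poly_op (p n) R x) y) \<longlonglongrightarrow> ip (cont_fun_calc R f x) y"
    by (intro ip.tendsto tendsto_const poly_op_tendsto_fun_calc p)
  moreover have "(\<lambda>n. ip x (poly_op (p n) R y)) \<longlonglongrightarrow> ip x (cont_fun_calc R f y)"
    by (intro ip.tendsto tendsto_const poly_op_tendsto_fun_calc p)
  ultimately show ?thesis by (simp add: poly_op_sym LIMSEQ_unique)
qed

lemma norm_fun_calc_le: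
  assumes "poly_approximable f" and M: "\<And>t. t \<in> {0<..1} \<Longrightarrow> \<bar>f t\<bar> \<le> M"
  shows "norm (cont_fun_calc R f x) \<le> M * norm x"
proof -
  obtain p where p: "uniform_limit {0<..1} (\<lambda>n. poly (p n)) f sequentially"
    using assms by (auto simp: poly_approximable_def)
  have "norm (cont_fun_calc R f x) \<le> M * norm x + e" if "0 < e" for e
  proof -
    define d where "d = e / (norm x + 1)"
    have d: "0 < d" using that by (simp add: d_def add_nonneg_pos)
    then obtain N where N: "\<And>n t. n \<ge> N \<Longrightarrow> t \<in> {0<..1} \<Longrightarrow> dist (poly (p n) t) (f t) < d"
      using p unfolding uniform_limit_sequentially_iff by metis
    have "norm (poly_op (p n) R x) \<le> (M + d) * norm x" if "n \<ge> N" for n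
    proof (rule norm_poly_op_le)
      fix t :: real assume "t \<in> {0<..1}"
      then show "\<bar>poly (p n) t\<bar> \<le> M + d" using N[of n t] M[of t] that by (simp add: dist_real_def)
    qed
    then have "norm (cont_fun_calc R f x) \<le> (M + d) * norm x"
      using tendsto_norm[OF poly_op_tendsto_fun_calc[OF p, of x]] by (intro LIMSEQ_le_const2) auto
    also have "d * norm x \<le> e"
    proof -
      have "e * norm x \<le> e * (norm x + 1)" "0 < norm x + 1"
        using that norm_ge_zero[of x] by (simp, linarith)
      then show ?thesis by (simp add: d_def pos_divide_le_eq)
    qed
    then have "(M + d) * norm x \<le> M * norm x + e" by (simp add: algebra_simps)
    finally show ?thesis .
  qed
  then show ?thesis by (rule field_le_epsilon)
qed

lemma bounded_linear_fun_calc: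
  assumes f: "poly_approximable f"
  shows "bounded_linear (cont_fun_calc R f)"
proof -
  obtain M where M: "\<And>t. t \<in> {0<..1} \<Longrightarrow> \<bar>f t\<bar> \<le> M"
    using poly_approximable_bounded[OF f] unfolding bounded_iff by fastforce
  obtain p where p: "uniform_limit {0<..1} (\<lambda>n. poly (p n)) f sequentially"
    using assms by (auto simp: poly_approximable_def)
  note lim = poly_op_tendsto_fun_calc[OF p]
  have "cont_fun_calc R f (x + y) = cont_fun_calc R f x + cont_fun_calc R f y" for x y
    using lim[of "x + y"] tendsto_add[OF lim[of x] lim[of y]]
    by (simp add: bounded_linear.axioms(1)[OF bounded_linear_poly_op] linear_add LIMSEQ_unique)
  moreover have "cont_fun_calc R f (r *\<^sub>R x) = r *\<^sub>R cont_fun_calc R f x" for r x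
    using lim[of "r *\<^sub>R x"] tendsto_scaleR[OF tendsto_const[of r] lim[of x]]
    by (simp add: bounded_linear.axioms(1)[OF bounded_linear_poly_op] linear_scale LIMSEQ_unique)
  ultimately show ?thesis
    using norm_fun_calc_le[OF f M] by (intro bounded_linear_intro[where K = M]) (auto simp: mult.commute)
qed

text \<open>The products \<open>p n * q n\<close> converge uniformly because both limit functions
  are bounded.\<close>

lemma fun_calc_mult:
  assumes f: "poly_approximable f" and g: "poly_approximable g"
  shows "cont_fun_calc R (\<lambda>t. f t * g t) x = cont_fun_calc R f (cont_fun_calc R g x)"
proof -
  obtain p q where p: "uniform_limit {0<..1} (\<lambda>n. poly (p n)) f sequentially"
    and q: "uniform_limit {0<..1} (\<lambda>n. poly (q n)) g sequentially"
    using assms by (auto simp: poly_approximable_def)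
  have "uniform_limit {0<..1} (\<lambda>n t. poly (p n) t * poly (q n) t) (\<lambda>t. f t * g t) sequentially"
    by (intro uniform_lim_mult p q poly_approximable_bounded f g)
  then have "uniform_limit {0<..1} (\<lambda>n. poly (p n * q n)) (\<lambda>t. f t * g t) sequentially"
    by (simp add: poly_mult_ext)
  from poly_op_tendsto_fun_calc[OF this, of x]
  have lim1: "(\<lambda>n. poly_op (p n) R (poly_op (q n) R x)) \<longlonglongrightarrow> cont_fun_calc R (\<lambda>t. f t * g t) x"
    by (simp add: poly_op_mult)
  define y where "y = cont_fun_calc R g x"
  obtain M where M: "\<And>t. t \<in> {0<..1} \<Longrightarrow> \<bar>f t\<bar> \<le> M"
    using poly_approximable_bounded[OF f] unfolding bounded_iff by fastforce
  \<comment> \<open>Operator and argument vary together, so pointwise convergence does not suffice: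
    eventually \<open>p n\<close> is bounded by \<open>M + 1\<close>, hence the operators are
    uniformly bounded and the inner error disappears.\<close>
  have "(\<lambda>n. poly_op (p n) R (poly_op (q n) R x - y)) \<longlonglongrightarrow> 0"
  proof (rule Lim_null_comparison)
    have "\<forall>\<^sub>F n in sequentially. \<forall>t\<in>{0<..1}. dist (poly (p n) t) (f t) < 1"
      using uniform_limitD[OF p] by simp
    then show "\<forall>\<^sub>F n in sequentially. norm (poly_op (p n) R (poly_op (q n) R x - y)) \<le> (M + 1) * norm (poly_op (q n) R x - y)"
    proof (rule eventually_mono, intro norm_poly_op_le)
      fix n and t :: real assume "\<forall>t\<in>{0<..1}. dist (poly (p n) t) (f t) < 1" "t \<in> {0<..1}"
      then have "dist (poly (p n) t) (f t) < 1" by blast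
      then show "\<bar>poly (p n) t\<bar> \<le> M + 1" using M[OF \<open>t \<in> {0<..1}\<close>] by (simp add: dist_real_def)
    qed
    have "(\<lambda>n. (M + 1) * norm (poly_op (q n) R x - y)) \<longlonglongrightarrow> (M + 1) * norm (y - y)"
      by (intro tendsto_intros poly_op_tendsto_fun_calc q) (simp add: y_def poly_op_tendsto_fun_calc q)
    then show "(\<lambda>n. (M + 1) * norm (poly_op (q n) R x - y)) \<longlonglongrightarrow> 0" by simp
  qed
  from tendsto_add[OF this poly_op_tendsto_fun_calc[OF p, of y]]
  have "(\<lambda>n. poly_op (p n) R (poly_op (q n) R x)) \<longlonglongrightarrow> cont_fun_calc R f y"
    by (simp add: bounded_linear.axioms(1)[OF bounded_linear_poly_op] linear_diff)
  then show ?thesis using lim1 y_def LIMSEQ_unique by blast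
qed

lemma fun_calc_commute:
  assumes "poly_approximable f" and F: "bounded_linear F" "\<And>x. F (R x) = R (F x)"
  shows "F (cont_fun_calc R f x) = cont_fun_calc R f (F x)"
proof -
  obtain p where p: "uniform_limit {0<..1} (\<lambda>n. poly (p n)) f sequentially"
    using assms by (auto simp: poly_approximable_def)
  have "(\<lambda>n. F (poly_op (p n) R x)) \<longlonglongrightarrow> F (cont_fun_calc R f x)"
    by (intro bounded_linear.tendsto[OF F(1)] poly_op_tendsto_fun_calc p)
  moreover have "(\<lambda>n. poly_op (p n) R (F x)) \<longlonglongrightarrow> cont_fun_calc R f (F x)"
    by (intro poly_op_tendsto_fun_calc p)
  ultimately show ?thesis
    by (simp add: poly_op_commute[OF bounded_linear_R F] LIMSEQ_unique)
qed

text \<open>A three-term estimate with one polynomial \<open>q\<close> within \<open>r / 3\<close>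
  of \<open>f\<close>. Its constant \<open>C\<close> depends on \<open>q\<close>, so convergence is
  obtained without a rate.\<close>

lemma fun_calc_approx_eigenvector:
  assumes f: "poly_approximable f" and \<mu>: "\<mu> \<in> {0<..1}"
    and g: "\<And>n. norm (g n) = 1" and lim: "(\<lambda>n. R (g n) - \<mu> *\<^sub>R g n) \<longlonglongrightarrow> 0"
  shows "(\<lambda>n. cont_fun_calc R f (g n) - f \<mu> *\<^sub>R g n) \<longlonglongrightarrow> 0"
proof (rule LIMSEQ_I)
  fix r :: real assume r: "0 < r"
  obtain p where "uniform_limit {0<..1} (\<lambda>n. poly (p n)) f sequentially"
    using f by (auto simp: poly_approximable_def)
  then obtain N where "\<forall>n\<ge>N. \<forall>t\<in>{0<..1}. dist (poly (p n) t) (f t) < r / 3"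
    using r unfolding uniform_limit_sequentially_iff by (metis divide_pos_pos zero_less_numeral)
  then have q: "\<bar>f t - poly (p N) t\<bar> \<le> r / 3" if "t \<in> {0<..1}" for t
    using that by (auto simp: dist_real_def abs_minus_commute intro: less_imp_le)
  define q where "q = p N"
  have close: "norm (cont_fun_calc R f x - poly_op q R x) \<le> r / 3 * norm x" for x
  proof -
    have q': "poly_approximable (poly (- q))" by (rule poly_approximable_poly)
    have "norm (cont_fun_calc R (\<lambda>t. f t + poly (- q) t) x) \<le> r / 3 * norm x"
      by (intro norm_fun_calc_le poly_approximable_add f q') (use q in \<open>simp add: q_def\<close>)
    then show ?thesis
      unfolding fun_calc_add[OF f q'] fun_calc_poly by (simp add: poly_op_minus)
  qed
  obtain C where C: "C \<ge> 0" "\<And>x. norm (poly_op q R x - poly q \<mu> *\<^sub>R x) \<le> C * norm (R x - \<mu> *\<^sub>R x)"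
    using poly_op_approx_eigenvector[OF bounded_linear_R] by blast
  have "0 < r / (3 * (C + 1))" using r C(1) by simp
  from LIMSEQ_D[OF lim this] obtain no where
    no: "\<And>n. n \<ge> no \<Longrightarrow> norm (R (g n) - \<mu> *\<^sub>R g n) < r / (3 * (C + 1))" by auto
  have "norm (cont_fun_calc R f (g n) - f \<mu> *\<^sub>R g n - 0) < r" if "n \<ge> no" for n
  proof -
    have "norm (poly_op q R (g n) - poly q \<mu> *\<^sub>R g n) \<le> C * (r / (3 * (C + 1)))"
      using C(2)[of "g n"] mult_left_mono[OF less_imp_le[OF no[OF that]] C(1)] by linarith
    also have "\<dots> < r / 3" using C(1) r by (simp add: field_simps)
    finally have 1: "norm (poly_op q R (g n) - poly q \<mu> *\<^sub>R g n) < r / 3" .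
    have 2: "norm (cont_fun_calc R f (g n) - poly_op q R (g n)) \<le> r / 3"
      using close[of "g n"] g[of n] by simp
    have 3: "norm ((poly q \<mu> - f \<mu>) *\<^sub>R g n) \<le> r / 3"
      using q[OF \<mu>] g[of n] by (simp add: q_def abs_minus_commute)
    have "cont_fun_calc R f (g n) - f \<mu> *\<^sub>R g n
        = (cont_fun_calc R f (g n) - poly_op q R (g n)) + (poly_op q R (g n) - poly q \<mu> *\<^sub>R g n)
          + (poly q \<mu> - f \<mu>) *\<^sub>R g n" by (simp add: algebra_simps)
    also have "norm \<dots> \<le> norm (cont_fun_calc R f (g n) - poly_op q R (g n))
        + norm (poly_op q R (g n) - poly q \<mu> *\<^sub>R g n) + norm ((poly q \<mu> - f \<mu>) *\<^sub>R g n)"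
      by (intro norm_triangle_le add_mono norm_triangle_ineq order_refl)
    finally show ?thesis using 1 2 3 by simp
  qed
  then show "\<exists>no. \<forall>n\<ge>no. norm (cont_fun_calc R f (g n) - f \<mu> *\<^sub>R g n - 0) < r" by blast
qed

end

section \<open>Self-adjoint operators in a real Hilbert space\<close>

locale self_adjoint_op = real_hilbert ip for ip :: "'a::banach \<Rightarrow> 'a \<Rightarrow> real" +
  fixes D :: "'a set" and A :: "'a \<Rightarrow> 'a"
  assumes self_adjoint: "self_adjoint scaleR ip D A"
begin

lemma subspace_D: "subspace D"
  using self_adjoint by (simp add: self_adjoint_def subspace_raw_def)

lemma closure_D: "closure D = UNIV"
  using self_adjoint by (simp add: self_adjoint_def)

lemma A_add: "x \<in> D \<Longrightarrow> y \<in> D \<Longrightarrow> A (x + y) = A x + A y"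
  using self_adjoint by (simp add: self_adjoint_def)

lemma A_scaleR: "x \<in> D \<Longrightarrow> A (r *\<^sub>R x) = r *\<^sub>R A x"
  using self_adjoint by (simp add: self_adjoint_def)

lemma A_diff: "x \<in> D \<Longrightarrow> y \<in> D \<Longrightarrow> A (x - y) = A x - A y"
  using A_add[of x "(-1) *\<^sub>R y"] A_scaleR[of y "-1"] subspace_scale[OF subspace_D, of y "-1"] by simp

lemmas D_closed = subspace_0[OF subspace_D] subspace_add[OF subspace_D] subspace_diff[OF subspace_D]
  subspace_scale[OF subspace_D]

lemma A_zero [simp]: "A 0 = 0"
  using A_diff[of 0 0] D_closed(1) by simp

text \<open>The inclusion of the adjoint in \<open>A\<close>, which is what self-adjointness adds to
  symmetry; it places limits, orthogonal vectors and elements of the generator into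
  \<open>D\<close>.\<close>

lemma A_adjI:
  assumes "\<And>x. x \<in> D \<Longrightarrow> ip (A x) y = ip x z"
  shows "y \<in> D" "A y = z"
proof -
  have "(y, z) \<in> adjoint_graph ip D A" using assms by (simp add: adjoint_graph_def)
  then have "(y, z) \<in> op_graph D A" using self_adjoint by (simp add: self_adjoint_def)
  then show "y \<in> D" "A y = z" by (auto simp: op_graph_def)
qed

lemma A_sym:
  assumes "x \<in> D" "y \<in> D"
  shows "ip (A x) y = ip x (A y)"
proof -
  have "(y, A y) \<in> op_graph D A" using assms by (auto simp: op_graph_def)
  then have "(y, A y) \<in> adjoint_graph ip D A" using self_adjoint by (simp add: self_adjoint_def)
  then show ?thesis using assms by (simp add: adjoint_graph_def)
qed

section \<open>Closedness, the range of \<open>A - \<kappa>\<close>, approximate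
  eigenvectors\<close>

lemma A_closed:
  assumes "\<And>n. x n \<in> D" "x \<longlonglongrightarrow> y" "(\<lambda>n. A (x n)) \<longlonglongrightarrow> z"
  shows "y \<in> D" "A y = z"
proof -
  have "ip (A w) y = ip w z" if "w \<in> D" for w
  proof (rule LIMSEQ_unique)
    show "(\<lambda>n. ip (A w) (x n)) \<longlonglongrightarrow> ip (A w) y"
      by (intro ip.tendsto tendsto_const assms)
    have "(\<lambda>n. ip w (A (x n))) \<longlonglongrightarrow> ip w z"
      by (intro ip.tendsto tendsto_const assms)
    then show "(\<lambda>n. ip (A w) (x n)) \<longlonglongrightarrow> ip w z" using A_sym that assms(1) by simp
  qed
  from A_adjI[OF this] show "y \<in> D" "A y = z" by simp_all
qed

text \<open>The lower bound gives injectivity and a closed range. By self-adjointness the orthogonal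
  complement of the range is the kernel of \<open>A - \<kappa>\<close>, which is trivial by the same
  bound.\<close>

lemma shifted_bij:
  assumes c: "c > 0" "\<And>x. x \<in> D \<Longrightarrow> c * norm x \<le> norm (A x - \<kappa> *\<^sub>R x)"
  shows "bij_betw (\<lambda>x. A x - \<kappa> *\<^sub>R x) D UNIV"
proof -
  let ?F = "\<lambda>x. A x - \<kappa> *\<^sub>R x"
  have F_diff: "?F (x - y) = ?F x - ?F y" if "x \<in> D" "y \<in> D" for x y
    using that by (simp add: A_diff algebra_simps)
  have "inj_on ?F D"
  proof (rule inj_onI)
    fix x y assume xy: "x \<in> D" "y \<in> D" "?F x = ?F y"
    then have "c * norm (x - y) \<le> 0"
      using c(2)[of "x - y"] F_diff[of x y] D_closed(3)[of x y] by simp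
    then show "x = y" using c(1) by (simp add: mult_le_0_iff)
  qed
  moreover have "?F ` D = UNIV"
  proof (rule closed_subspace_eq_UNIV)
    show "subspace (?F ` D)"
    proof (rule subspaceI)
      show "0 \<in> ?F ` D" using D_closed(1) by (intro image_eqI[of _ _ 0]) simp_all
    next
      fix u v assume "u \<in> ?F ` D" "v \<in> ?F ` D"
      then obtain x y where "x \<in> D" "y \<in> D" "u = ?F x" "v = ?F y" by blast
      then show "u + v \<in> ?F ` D"
        by (intro image_eqI[of _ _ "x + y"]) (simp_all add: A_add D_closed scaleR_add_right)
    next
      fix r u assume "u \<in> ?F ` D"
      then obtain x where "x \<in> D" "u = ?F x" by blast
      then show "r *\<^sub>R u \<in> ?F ` D"
        by (intro image_eqI[of _ _ "r *\<^sub>R x"]) (simp_all add: A_scaleR D_closed scaleR_diff_right mult.commute)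
    qed
  next
    show "closed (?F ` D)"
      unfolding closed_sequential_limits
    proof (intro allI impI, elim conjE)
      fix v l assume "\<forall>n. v n \<in> ?F ` D" and v: "v \<longlonglongrightarrow> l"
      then have "\<forall>n. \<exists>x. x \<in> D \<and> v n = ?F x" by blast
      then obtain x where x: "\<And>n. x n \<in> D" "\<And>n. v n = ?F (x n)" by metis
      have "Cauchy x"
      proof (rule metric_CauchyI)
        fix e :: real assume "0 < e"
        then have "0 < c * e" using c(1) by simp
        then obtain N where N: "\<And>m n. m \<ge> N \<Longrightarrow> n \<ge> N \<Longrightarrow> dist (v m) (v n) < c * e"
          using metric_CauchyD[OF LIMSEQ_imp_Cauchy[OF v]] by blast
        have "dist (x m) (x n) < e" if "m \<ge> N" "n \<ge> N" for m n
        proof -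
          have "c * norm (x m - x n) \<le> norm (v m - v n)"
            using c(2)[of "x m - x n"] F_diff[of "x m" "x n"] x D_closed(3) by simp
          also have "\<dots> < c * e" using N[OF that] by (simp add: dist_norm)
          finally show ?thesis using c(1) by (simp add: dist_norm)
        qed
        then show "\<exists>M. \<forall>m\<ge>M. \<forall>n\<ge>M. dist (x m) (x n) < e" by blast
      qed
      then obtain y where y: "x \<longlonglongrightarrow> y" using Cauchy_convergent convergent_def by blast
      have "(\<lambda>n. v n + \<kappa> *\<^sub>R x n) \<longlonglongrightarrow> l + \<kappa> *\<^sub>R y" by (intro tendsto_intros v y)
      then have "(\<lambda>n. A (x n)) \<longlonglongrightarrow> l + \<kappa> *\<^sub>R y" by (simp add: x(2))
      from A_closed[OF x(1) y this] show "l \<in> ?F ` D" by (intro image_eqI[of _ _ y]) auto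
    qed
  next
    fix y assume orth: "\<And>v. v \<in> ?F ` D \<Longrightarrow> ip v y = 0"
    have "ip (A x) y = ip x (\<kappa> *\<^sub>R y)" if "x \<in> D" for x
      using orth[of "?F x"] that by (simp add: ip_simps)
    from A_adjI[OF this] have "y \<in> D" "A y = \<kappa> *\<^sub>R y" by simp_all
    then show "y = 0" using c(1) c(2)[of y] by (simp add: mult_le_0_iff)
  qed
  ultimately show ?thesis by (simp add: bij_betw_def)
qed

text \<open>If \<open>norm (A x - \<kappa> x)\<close> were bounded below by a positive multiple of
  \<open>norm x\<close>, then \<open>shifted_bij\<close> would put \<open>\<kappa>\<close> into the
  resolvent set; so each constant \<open>1 / (n + 1)\<close> is violated by some unit
  vector.\<close>

lemma weyl_sequence:
  assumes "\<kappa> \<in> spectrum scaleR D A"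
  obtains g where "\<And>n. g n \<in> D" "\<And>n. norm (g n) = 1" "(\<lambda>n. A (g n) - \<kappa> *\<^sub>R g n) \<longlonglongrightarrow> 0"
proof -
  have ex: "\<exists>g\<in>D. norm g = 1 \<and> norm (A g - \<kappa> *\<^sub>R g) < c" if c: "0 < c" for c
  proof (rule ccontr)
    assume neg: "\<not> ?thesis"
    have le: "c * norm x \<le> norm (A x - \<kappa> *\<^sub>R x)" if x: "x \<in> D" for x
    proof (cases "x = 0")
      case False
      let ?g = "inverse (norm x) *\<^sub>R x"
      have "?g \<in> D" "norm ?g = 1" using False x by (auto simp: D_closed)
      then have "c \<le> norm (A ?g - \<kappa> *\<^sub>R ?g)" using neg by force
      also have "A ?g - \<kappa> *\<^sub>R ?g = inverse (norm x) *\<^sub>R (A x - \<kappa> *\<^sub>R x)"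
        using x by (simp add: A_scaleR algebra_simps)
      also have "norm \<dots> = norm (A x - \<kappa> *\<^sub>R x) / norm x" by (simp add: divide_inverse)
      finally show ?thesis using False by (simp add: pos_le_divide_eq)
    qed simp
    then have "\<forall>x\<in>D. norm x \<le> (1 / c) * norm (A x - \<kappa> *\<^sub>R x)"
      using c by (simp add: field_simps)
    then have "\<kappa> \<in> resolvent_set scaleR D A"
      using shifted_bij[OF c le] unfolding resolvent_set_def by blast
    then show False using assms by (simp add: spectrum_def)
  qed
  have "\<forall>n. \<exists>g. g \<in> D \<and> norm g = 1 \<and> norm (A g - \<kappa> *\<^sub>R g) < inverse (real (Suc n))"
    using ex[of "inverse (real (Suc n))" for n] by (metis inverse_positive_iff_positive of_nat_0_less_iff zero_less_Suc)
  then obtain g where g: "\<And>n. g n \<in> D" "\<And>n. norm (g n) = 1"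
    "\<And>n. norm (A (g n) - \<kappa> *\<^sub>R g n) < inverse (real (Suc n))" by metis
  have "(\<lambda>n. A (g n) - \<kappa> *\<^sub>R g n) \<longlonglongrightarrow> 0"
    using LIMSEQ_inverse_real_of_nat
    by (rule Lim_null_comparison[rotated]) (use g(3) in \<open>auto intro!: always_eventually less_imp_le\<close>)
  with g that show ?thesis by blast
qed

text \<open>Projecting \<open>(y, 0)\<close> onto the closed graph of \<open>A\<close> gives \<open>(x, A x)\<close>, and orthogonality of the
  remainder to the graph says that \<open>A x \<in> D\<close> and \<open>A (A x) = y - x\<close>.\<close>

lemma I_plus_sq_surj: "\<exists>x. x \<in> D \<and> A x \<in> D \<and> x + A (A x) = y"
proof -
  interpret P: real_hilbert "\<lambda>p q. ip (fst p) (fst q) + ip (snd p) (snd q)"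
    by (intro real_hilbert_prod) unfold_locales
  let ?G = "(\<lambda>x. (x, A x)) ` D"
  have "subspace ?G"
  proof (rule subspaceI)
    show "0 \<in> ?G" using D_closed(1) by (intro image_eqI[of _ _ 0]) (simp_all add: zero_prod_def)
  next
    fix u v assume "u \<in> ?G" "v \<in> ?G"
    then obtain x y where "x \<in> D" "y \<in> D" "u = (x, A x)" "v = (y, A y)" by blast
    then show "u + v \<in> ?G" by (intro image_eqI[of _ _ "x + y"]) (simp_all add: A_add D_closed)
  next
    fix r u assume "u \<in> ?G"
    then obtain x where "x \<in> D" "u = (x, A x)" by blast
    then show "r *\<^sub>R u \<in> ?G" by (intro image_eqI[of _ _ "r *\<^sub>R x"]) (simp_all add: A_scaleR D_closed)
  qed
  moreover have "closed ?G"
    unfolding closed_sequential_limits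
  proof (intro allI impI, elim conjE)
    fix v l assume "\<forall>n. v n \<in> ?G" and v: "v \<longlonglongrightarrow> l"
    then have "\<forall>n. \<exists>x. x \<in> D \<and> v n = (x, A x)" by blast
    then have v': "\<And>n. fst (v n) \<in> D" "\<And>n. snd (v n) = A (fst (v n))" by (metis fst_conv, metis fst_conv snd_conv)
    have "(\<lambda>n. fst (v n)) \<longlonglongrightarrow> fst l" "(\<lambda>n. A (fst (v n))) \<longlonglongrightarrow> snd l"
      using tendsto_fst[OF v] tendsto_snd[OF v] by (simp_all add: v'(2))
    from A_closed[OF v'(1) this] show "l \<in> ?G" by (intro image_eqI[of _ _ "fst l"]) (auto simp: prod_eq_iff)
  qed
  ultimately obtain v where v: "v \<in> ?G"
    "\<And>w. w \<in> ?G \<Longrightarrow> ip (fst w) (fst ((y, 0) - v)) + ip (snd w) (snd ((y, 0) - v)) = 0"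
    using P.projection_exists[of ?G "(y, 0)"] by blast
  then obtain x where x: "x \<in> D" "v = (x, A x)" by blast
  have "ip (A w) (A x) = ip w (y - x)" if "w \<in> D" for w
    using v(2)[of "(w, A w)"] that by (simp add: x)
  from A_adjI[OF this] x(1) show ?thesis by (intro exI[of _ x]) auto
qed

text \<open>The cross term is \<open>2 * ip x (A (A x)) = 2 * (norm (A x))^2\<close>, so nothing
  cancels; this yields injectivity and both norm bounds for the inverse.\<close>

lemma norm_I_plus_sq:
  assumes "x \<in> D" "A x \<in> D"
  shows "(norm (x + A (A x)))\<^sup>2 = (norm x)\<^sup>2 + 2 * (norm (A x))\<^sup>2 + (norm (A (A x)))\<^sup>2"
  unfolding norm_add_sq using A_sym[of x "A x"] assms by (simp add: ip_self)

lemma I_plus_sq_inj: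
  assumes "x \<in> D" "A x \<in> D" "y \<in> D" "A y \<in> D" "x + A (A x) = y + A (A y)"
  shows "x = y"
proof -
  have "(x - y) + A (A (x - y)) = (x + A (A x)) - (y + A (A y))"
    using assms(1-4) by (simp add: A_diff)
  then have "(x - y) + A (A (x - y)) = 0" by (simp add: assms(5))
  moreover have "A (x - y) \<in> D" using assms by (simp add: A_diff D_closed)
  ultimately have "(norm (x - y))\<^sup>2 + 2 * (norm (A (x - y)))\<^sup>2 + (norm (A (A (x - y))))\<^sup>2 = 0"
    using norm_I_plus_sq[of "x - y"] D_closed(3) assms by simp
  then have "(norm (x - y))\<^sup>2 = 0" by (smt (verit) zero_le_power2)
  then show ?thesis by simp
qed

section \<open>The bounded operator (I + A^2)^-1\<close>

abbreviation "R \<equiv> inv_I_plus_sq D A"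

lemma R_eqI:
  assumes "x \<in> D" "A x \<in> D" "x + A (A x) = y"
  shows "R y = x"
  unfolding inv_I_plus_sq_def using assms I_plus_sq_inj by (intro the_equality) auto

lemma R: "R y \<in> D" "A (R y) \<in> D" "R y + A (A (R y)) = y"
proof -
  obtain x where "x \<in> D" "A x \<in> D" "x + A (A x) = y" using I_plus_sq_surj[of y] by blast
  moreover from this have "R y = x" by (rule R_eqI)
  ultimately show "R y \<in> D" "A (R y) \<in> D" "R y + A (A (R y)) = y" by simp_all
qed

lemma norm_R_le: "norm (R y) \<le> norm y" "norm (A (R y)) \<le> norm y"
proof -
  have "(norm y)\<^sup>2 = (norm (R y))\<^sup>2 + 2 * (norm (A (R y)))\<^sup>2 + (norm (A (A (R y))))\<^sup>2"
    using norm_I_plus_sq[OF R(1,2), of y] by (simp add: R(3))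
  then have "(norm (R y))\<^sup>2 \<le> (norm y)\<^sup>2" "(norm (A (R y)))\<^sup>2 \<le> (norm y)\<^sup>2"
    using zero_le_power2[of "norm (R y)"] zero_le_power2[of "norm (A (R y))"] zero_le_power2[of "norm (A (A (R y)))"]
    by linarith+
  then show "norm (R y) \<le> norm y" "norm (A (R y)) \<le> norm y"
    by (auto intro: power2_le_imp_le)
qed

text \<open>The right-hand side is the graph inner product of \<open>R x\<close> and
  \<open>R y\<close>, which makes symmetry and positivity of \<open>R\<close> visible.\<close>

lemma ip_R: "ip (R x) y = ip (R x) (R y) + ip (A (R x)) (A (R y))"
proof -
  have "ip (R x) y = ip (R x) (R y + A (A (R y)))" by (simp add: R(3))
  then show ?thesis using A_sym[OF R(1)[of x] R(2)[of y]] by (simp add: ip_simps)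
qed

lemma pos_contraction_R: "pos_contraction ip R"
proof (intro pos_contraction.intro pos_contraction_axioms.intro)
  show "real_hilbert ip" by unfold_locales
  show "bounded_linear R"
  proof (rule bounded_linear_intro[where K = 1])
    show "R (x + y) = R x + R y" for x y
      using R[of x] R[of y] by (intro R_eqI) (simp_all add: A_add D_closed algebra_simps)
    show "R (r *\<^sub>R x) = r *\<^sub>R R x" for r x
    proof (rule R_eqI)
      show "r *\<^sub>R R x + A (A (r *\<^sub>R R x)) = r *\<^sub>R x"
        using R[of x] by (simp add: A_scaleR flip: scaleR_add_right)
    qed (use R[of x] in \<open>simp_all add: A_scaleR D_closed\<close>)
  qed (simp add: norm_R_le)
  show "ip (R x) y = ip x (R y)" for x y
    using ip_R[of x y] ip_R[of y x] ip_commute by metis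
  show "0 \<le> ip (R x) x" for x using ip_R[of x x] by (simp add: ip_self)
  show "ip (R x) x \<le> (norm x)\<^sup>2" for x
    using Cauchy_Schwarz[of "R x" x] mult_right_mono[OF norm_R_le(1)[of x], of "norm x"]
    by (simp add: power2_eq_square)
qed

sublocale R: pos_contraction ip R by (rule pos_contraction_R)

text \<open>\<open>(1 + \<kappa>\<^sup>2) (R g - (1 + \<kappa>\<^sup>2)\<^bsup>-1\<^esup> g) = \<kappa>\<^sup>2 R g - A\<^sup>2 R g = - (A + \<kappa>) R (A - \<kappa>) g\<close>.\<close>

lemma R_approx_eigenvector:
  assumes "g \<in> D"
  shows "norm (R g - (1 / (1 + \<kappa>\<^sup>2)) *\<^sub>R g) \<le> (1 + \<bar>\<kappa>\<bar>) * norm (A g - \<kappa> *\<^sub>R g)"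
proof -
  define h where "h = R g"
  have h: "h \<in> D" "A h \<in> D" "h + A (A h) = g" using R[of g] by (simp_all add: h_def)
  have AAh: "A (A h) = g - h" using h(3) by (simp add: algebra_simps)
  \<comment> \<open>Here \<open>g \<in> D\<close> enters: it puts \<open>A (A h) = g - h\<close>
    into \<open>D\<close>, so that \<open>R\<close> and \<open>A\<close> commute at
    \<open>g\<close>.\<close>
  have D': "A (A h) \<in> D" using assms h(1) by (simp add: AAh D_closed)
  have RA: "R (A g) = A h"
  proof (rule R_eqI)
    show "A h + A (A (A h)) = A g" using assms h by (simp add: AAh A_diff)
  qed (use h D' in auto)
  define k where "k = A g - \<kappa> *\<^sub>R g"
  have Rk: "R k = A h - \<kappa> *\<^sub>R h" by (simp add: k_def R.R.diff R.R.scaleR RA h_def)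
  have "(1 + \<kappa>\<^sup>2) *\<^sub>R (h - (1 / (1 + \<kappa>\<^sup>2)) *\<^sub>R g) = (1 + \<kappa>\<^sup>2) *\<^sub>R h - g"
    by (simp add: scaleR_diff_right add_nonneg_eq_0_iff)
  also have "\<dots> = \<kappa>\<^sup>2 *\<^sub>R h - A (A h)" by (simp add: AAh algebra_simps)
  also have "\<dots> = - (A (R k) + \<kappa> *\<^sub>R R k)"
    using h by (simp add: Rk A_diff A_scaleR D_closed algebra_simps power2_eq_square)
  finally have eq: "(1 + \<kappa>\<^sup>2) *\<^sub>R (h - (1 / (1 + \<kappa>\<^sup>2)) *\<^sub>R g) = - (A (R k) + \<kappa> *\<^sub>R R k)" .
  have "norm (h - (1 / (1 + \<kappa>\<^sup>2)) *\<^sub>R g) \<le> (1 + \<kappa>\<^sup>2) * norm (h - (1 / (1 + \<kappa>\<^sup>2)) *\<^sub>R g)"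
    by (simp add: mult_le_cancel_right1)
  also have "\<dots> = norm (A (R k) + \<kappa> *\<^sub>R R k)"
    using arg_cong[OF eq, of norm] unfolding norm_minus_cancel norm_scaleR by simp
  also have "\<dots> \<le> norm (A (R k)) + \<bar>\<kappa>\<bar> * norm (R k)"
    using norm_triangle_ineq[of "A (R k)" "\<kappa> *\<^sub>R R k"] by simp
  also have "\<dots> \<le> norm k + \<bar>\<kappa>\<bar> * norm k"
    by (intro add_mono mult_left_mono norm_R_le) auto
  finally show ?thesis by (simp add: h_def k_def algebra_simps)
qed

end

section \<open>The semigroup generated by a semibounded self-adjoint operator\<close>

text \<open>First and second order Taylor estimates with \<open>u\<close> bounded from below only:
  \<open>u\<close> will be \<open>t\<close> times a point that corresponds to the spectrum of
  \<open>A\<close>, with no upper bound. Both rest on \<open>1 + u \<le> exp u\<close>.\<close>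

lemma exp_minus_one_bounds:
  fixes u m :: real
  assumes "- m \<le> u" "0 \<le> m"
  shows "\<bar>exp (- u) - 1\<bar> \<le> \<bar>u\<bar> * exp m" and "\<bar>exp (- u) - 1 + u\<bar> \<le> u\<^sup>2 * exp m"
proof -
  have upper: "exp (- u) - 1 \<le> - u * exp (- u)"
    using exp_ge_add_one_self[of u] mult_right_mono[OF exp_ge_add_one_self[of u], of "exp (- u)"]
    by (simp add: algebra_simps flip: exp_add)
  have lower: "- u \<le> exp (- u) - 1" using exp_ge_add_one_self[of "- u"] by simp
  have "1 \<le> exp m" using assms by simp
  show 1: "\<bar>exp (- u) - 1\<bar> \<le> \<bar>u\<bar> * exp m"
  proof (cases "u \<ge> 0")
    case True
    then have "\<bar>exp (- u) - 1\<bar> \<le> \<bar>u\<bar> * 1" using lower by simp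
    also have "\<dots> \<le> \<bar>u\<bar> * exp m" using \<open>1 \<le> exp m\<close> by (intro mult_left_mono) auto
    finally show ?thesis .
  next
    case False
    then have "\<bar>exp (- u) - 1\<bar> \<le> \<bar>u\<bar> * exp (- u)" using upper by simp
    also have "\<dots> \<le> \<bar>u\<bar> * exp m" using assms by (intro mult_left_mono) auto
    finally show ?thesis .
  qed
  have "\<bar>exp (- u) - 1 + u\<bar> = exp (- u) - 1 + u" using lower by simp
  also have "\<dots> \<le> - u * (exp (- u) - 1)" using upper by (simp add: algebra_simps)
  also have "\<dots> \<le> \<bar>u\<bar> * \<bar>exp (- u) - 1\<bar>" by (metis abs_ge_self abs_minus_cancel abs_mult)
  also have "\<dots> \<le> \<bar>u\<bar> * (\<bar>u\<bar> * exp m)" using 1 by (intro mult_left_mono) auto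
  finally show "\<bar>exp (- u) - 1 + u\<bar> \<le> u\<^sup>2 * exp m" by (simp add: power2_eq_square mult.assoc)
qed

text \<open>Approximation by vectors of \<open>E\<close> with errors \<open>e / 2\<close>. Linearity
  and the bound are eventual conditions because the families in use are controlled for
  \<open>0 < t \<le> 1\<close> only.\<close>

lemma tendsto_zero_dense:
  fixes F :: "'t \<Rightarrow> 'a::real_normed_vector \<Rightarrow> 'b::real_normed_vector"
  assumes lin: "\<forall>\<^sub>F t in net. \<forall>x y. F t (x - y) = F t x - F t y"
    and bound: "\<forall>\<^sub>F t in net. \<forall>x. norm (F t x) \<le> L * norm x"
    and dense: "closure E = UNIV" and lim: "\<And>x. x \<in> E \<Longrightarrow> ((\<lambda>t. F t x) \<longlongrightarrow> 0) net"
  shows "((\<lambda>t. F t x) \<longlongrightarrow> 0) net"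
proof (rule tendstoI)
  fix e :: real assume e: "0 < e"
  define M where "M = \<bar>L\<bar> + 1"
  have M: "0 < M" "L \<le> M" by (auto simp: M_def)
  have "0 < e / (2 * M)" using e M by simp
  then obtain y where y: "y \<in> E" "dist y x < e / (2 * M)"
    using dense by (metis UNIV_I closure_approachable)
  have "\<forall>\<^sub>F t in net. dist (F t y) 0 < e / 2"
    using tendstoD[OF lim[OF y(1)], of "e / 2"] e by simp
  with lin bound show "\<forall>\<^sub>F t in net. dist (F t x) 0 < e"
  proof eventually_elim
    case (elim t)
    have "norm (F t (x - y)) \<le> M * norm (x - y)"
      using elim(2) M(2) by (meson mult_right_mono norm_ge_zero order_trans)
    also have "\<dots> < M * (e / (2 * M))"
      using y(2) M(1) by (intro mult_strict_left_mono) (simp_all add: dist_norm norm_minus_commute)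
    also have "\<dots> = e / 2" using M(1) by simp
    finally have "norm (F t x - F t y) < e / 2" using elim(1) by simp
    then show ?case using elim(3) norm_triangle_ineq[of "F t x - F t y" "F t y"] by simp
  qed
qed

section \<open>A resolvent below the spectrum and the symbol of the semigroup\<close>

locale semibounded_op = self_adjoint_op ip D A
  for ip :: "'a::banach \<Rightarrow> 'a \<Rightarrow> real" and D A +
  fixes c :: real
  assumes lower_bound: "x \<in> D \<Longrightarrow> c * (norm x)\<^sup>2 \<le> ip (A x) x"
begin

text \<open>The point \<open>c - 1\<close> lies at distance 1 below the lower bound
  \<open>c\<close>; the constant 1 makes the resolvent a contraction.\<close>

lemma shifted_norm_ge: "x \<in> D \<Longrightarrow> 1 * norm x \<le> norm (A x - (c - 1) *\<^sub>R x)"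
proof -
  assume x: "x \<in> D"
  have "norm x * norm x \<le> ip (A x - (c - 1) *\<^sub>R x) x"
    using lower_bound[OF x] by (simp add: ip_simps ip_self power2_eq_square algebra_simps)
  also have "\<dots> \<le> norm (A x - (c - 1) *\<^sub>R x) * norm x"
    using Cauchy_Schwarz[of "A x - (c - 1) *\<^sub>R x" x] by linarith
  finally show "1 * norm x \<le> norm (A x - (c - 1) *\<^sub>R x)" by (cases "x = 0") auto
qed

lemmas shifted_bij_betw = shifted_bij[OF zero_less_one shifted_norm_ge]

text \<open>The resolvent \<open>Q = (A - c + 1)\<^bsup>-1\<^esup>\<close> satisfies \<open>0 \<le> Q \<le> I\<close>, and \<open>A = c - 1 + Q\<^bsup>-1\<^esup>\<close>.\<close>

definition Q :: "'a \<Rightarrow> 'a" where "Q = inv_into D (\<lambda>x. A x - (c - 1) *\<^sub>R x)"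

lemma Q_in: "Q y \<in> D" and A_Q: "A (Q y) = y + (c - 1) *\<^sub>R Q y"
proof -
  have img: "(\<lambda>x. A x - (c - 1) *\<^sub>R x) ` D = UNIV" using shifted_bij_betw by (simp add: bij_betw_def)
  show "Q y \<in> D" unfolding Q_def using img by (intro inv_into_into) simp
  have "A (Q y) - (c - 1) *\<^sub>R Q y = y"
    unfolding Q_def using img by (intro f_inv_into_f[of y "\<lambda>x. A x - (c - 1) *\<^sub>R x"]) simp
  then show "A (Q y) = y + (c - 1) *\<^sub>R Q y" by (simp add: algebra_simps)
qed

lemma Q_eqI: "x \<in> D \<Longrightarrow> A x - (c - 1) *\<^sub>R x = y \<Longrightarrow> Q y = x"
  unfolding Q_def using shifted_bij_betw by (auto simp: bij_betw_def intro: inv_into_f_eq)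

lemma range_Q: "range Q = D"
  using Q_in Q_eqI by (metis UNIV_I image_subset_iff rangeI subsetI subset_antisym)

lemma norm_Q_le: "norm (Q y) \<le> norm y"
  using shifted_norm_ge[OF Q_in[of y]] by (simp add: A_Q)

lemma pos_contraction_Q: "pos_contraction ip Q"
proof (intro pos_contraction.intro pos_contraction_axioms.intro)
  show "real_hilbert ip" by unfold_locales
  show "bounded_linear Q"
  proof (rule bounded_linear_intro[where K = 1])
    show "Q (x + y) = Q x + Q y" for x y
      by (intro Q_eqI) (simp_all add: A_add D_closed Q_in A_Q algebra_simps)
    show "Q (r *\<^sub>R x) = r *\<^sub>R Q x" for r x
      by (intro Q_eqI) (simp_all add: A_scaleR D_closed Q_in A_Q algebra_simps)
  qed (simp add: norm_Q_le)
  show "ip (Q x) y = ip x (Q y)" for x y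
    using A_sym[OF Q_in[of x] Q_in[of y]] by (simp add: A_Q ip_simps)
  show "0 \<le> ip (Q x) x" for x
  proof -
    have "ip (Q x) x = ip (A (Q x)) (Q x) - (c - 1) * ip (Q x) (Q x)"
      by (simp add: A_Q ip_simps ip_commute)
    also have "\<dots> \<ge> (norm (Q x))\<^sup>2"
      using lower_bound[OF Q_in[of x]] by (simp add: ip_self algebra_simps)
    finally show ?thesis by (rule order_trans[rotated]) simp
  qed
  show "ip (Q x) x \<le> (norm x)\<^sup>2" for x
    using Cauchy_Schwarz[of "Q x" x] mult_right_mono[OF norm_Q_le[of x], of "norm x"]
    by (simp add: power2_eq_square)
qed

sublocale Q: pos_contraction ip Q by (rule pos_contraction_Q)

text \<open>\<open>c - 1 + 1 / s\<close> is the point for \<open>A\<close> that corresponds to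
  \<open>s\<close> for \<open>Q\<close>, so this is \<open>exp (- t \<lambda>)\<close>. At
  \<open>s = 0\<close> the convention \<open>1 / 0 = 0\<close> gives a meaningless value, which the
  calculus ignores.\<close>

definition symbol :: "real \<Rightarrow> real \<Rightarrow> real" where "symbol t s = exp (- (t * (c - 1 + 1 / s)))"

definition S :: "real \<Rightarrow> 'a \<Rightarrow> 'a" where "S t = cont_fun_calc Q (symbol t)"

text \<open>For \<open>t > 0\<close> the factor \<open>exp (- t / s)\<close> is at most
  \<open>s / t\<close>, so the value \<open>0\<close> at \<open>s = 0\<close> is a continuous
  extension; for \<open>t = 0\<close> the symbol is constant 1.\<close>

lemma poly_approximable_symbol:
  assumes "0 \<le> t"
  shows "poly_approximable (symbol t)"
proof (cases "t = 0")
  case True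
  then show ?thesis
    by (intro poly_approximable_cong[OF poly_approximable_poly[of 1]]) (simp add: symbol_def)
next
  case False
  with assms have t: "t > 0" by simp
  define g where "g s = (if s = 0 then 0 else symbol t s)" for s
  have "continuous (at s within {0..1}) g" if "s \<in> {0..1}" for s
  proof (cases "s = 0")
    case True
    have "(g \<longlongrightarrow> 0) (at 0 within {0..1})"
    proof (rule Lim_null_comparison)
      have "norm (g r) \<le> exp (- (t * (c - 1))) / t * r" if r: "r \<in> {0..1}" for r
      proof (cases "r = 0")
        case False
        then have r: "r > 0" using r by simp
        have "t / r \<le> exp (t / r)" using exp_ge_add_one_self[of "t / r"] by linarith
        then have "exp (- (t / r)) \<le> r / t"
          using t r by (simp add: exp_minus field_simps)
        then have "exp (- (t * (c - 1))) * exp (- (t / r)) \<le> exp (- (t * (c - 1))) * (r / t)"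
          by (intro mult_left_mono) auto
        then show ?thesis using r
          by (simp add: g_def symbol_def algebra_simps flip: exp_add)
      qed (simp add: g_def)
      then show "\<forall>\<^sub>F r in at 0 within {0..1}. norm (g r) \<le> exp (- (t * (c - 1))) / t * r"
        by (auto simp: eventually_at_filter)
      have "((\<lambda>r. exp (- (t * (c - 1))) / t * r) \<longlongrightarrow> exp (- (t * (c - 1))) / t * 0) (at 0 within {0..1})"
        by (intro tendsto_intros)
      then show "((\<lambda>r. exp (- (t * (c - 1))) / t * r) \<longlongrightarrow> 0) (at 0 within {0..1})" by simp
    qed
    then show ?thesis using True by (simp add: continuous_within g_def)
  next
    case False
    then have s: "s \<noteq> 0" by simp
    have "isCont (symbol t) s" unfolding symbol_def using s by (intro continuous_intros) auto
    moreover have "\<forall>\<^sub>F r in nhds s. symbol t r = g r"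
    proof -
      have "\<forall>\<^sub>F r in nhds s. r \<in> - {0}" using s by (intro eventually_nhds_in_open) auto
      then show ?thesis by eventually_elim (simp add: g_def)
    qed
    ultimately have "isCont g s" using isCont_cong by blast
    then show ?thesis by (rule continuous_at_imp_continuous_at_within)
  qed
  then have "continuous_on {0..1} g" by (simp add: continuous_on_eq_continuous_within)
  then show ?thesis by (rule poly_approximable_continuous) (simp add: g_def)
qed

section \<open>Semigroup law and growth bound\<close>

lemma bounded_linear_S: "0 \<le> t \<Longrightarrow> bounded_linear (S t)"
  unfolding S_def by (intro Q.bounded_linear_fun_calc poly_approximable_symbol)

lemma S_sym: "0 \<le> t \<Longrightarrow> ip (S t x) y = ip x (S t y)"
  unfolding S_def by (intro Q.fun_calc_sym poly_approximable_symbol)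

lemma S_zero: "S 0 x = x"
proof -
  have "symbol 0 = (\<lambda>s. 1)" by (simp add: symbol_def fun_eq_iff)
  then show ?thesis by (simp add: S_def Q.fun_calc_const)
qed

lemma S_add: "0 \<le> s \<Longrightarrow> 0 \<le> t \<Longrightarrow> S (s + t) x = S s (S t x)"
proof -
  assume "0 \<le> s" "0 \<le> t"
  moreover have "symbol (s + t) = (\<lambda>r. symbol s r * symbol t r)"
    by (simp add: symbol_def fun_eq_iff algebra_simps add_divide_distrib flip: exp_add)
  ultimately show ?thesis by (simp add: S_def Q.fun_calc_mult poly_approximable_symbol)
qed

lemma exponent_ge: "s \<in> {0<..1} \<Longrightarrow> c \<le> c - 1 + 1 / s"
  by simp

lemma norm_S_le: "0 \<le> t \<Longrightarrow> norm (S t x) \<le> exp (- (c * t)) * norm x"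
  unfolding S_def
proof (intro Q.norm_fun_calc_le poly_approximable_symbol)
  fix s assume "0 \<le> t" "s \<in> {0<..1::real}"
  then have "t * c \<le> t * (c - 1 + 1 / s)" using exponent_ge by (intro mult_left_mono)
  then show "\<bar>symbol t s\<bar> \<le> exp (- (c * t))" by (simp add: symbol_def mult.commute)
qed

text \<open>\<open>s\<close> times \<open>c - 1 + 1 / s\<close>: the symbol of \<open>A Q\<close>,
  in which the pole at \<open>0\<close> has cancelled.\<close>

definition weight :: "real \<Rightarrow> real" where "weight s = s * (c - 1) + 1"

lemma weight:
  assumes "s \<in> {0<..1}"
  shows "s * (c - 1 + 1 / s) = weight s" "\<bar>weight s\<bar> \<le> \<bar>c - 1\<bar> + 1"
proof -
  show "s * (c - 1 + 1 / s) = weight s" using assms by (simp add: weight_def algebra_simps)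
  have "\<bar>s * (c - 1)\<bar> \<le> 1 * \<bar>c - 1\<bar>" unfolding abs_mult using assms by (intro mult_right_mono) auto
  then have "\<bar>s * (c - 1)\<bar> + \<bar>1\<bar> \<le> \<bar>c - 1\<bar> + 1" by simp
  then show "\<bar>weight s\<bar> \<le> \<bar>c - 1\<bar> + 1"
    unfolding weight_def by (rule order_trans[OF abs_triangle_ineq])
qed

text \<open>The symbols of the difference quotient after one and after two applications of
  \<open>Q\<close>. Each factor \<open>s\<close> absorbs one factor \<open>w\<close> of the Taylor
  estimate, so the bounds are uniform in \<open>s\<close>: the first also in \<open>t\<close>, the
  second of order \<open>t\<close>.\<close>

lemma symbol_bounds:
  assumes t: "0 < t" "t \<le> 1" and s: "s \<in> {0<..1}"
  shows "\<bar>s * ((symbol t s - 1) / t)\<bar> \<le> (\<bar>c - 1\<bar> + 1) * exp \<bar>c\<bar>"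
    and "\<bar>s * (s * ((symbol t s - 1) / t)) + s * weight s\<bar> \<le> t * ((\<bar>c - 1\<bar> + 1)\<^sup>2 * exp \<bar>c\<bar>)"
proof -
  define w where "w = c - 1 + 1 / s"
  have sw: "s * w = weight s" using weight(1)[OF s] by (simp add: w_def)
  \<comment> \<open>\<open>w \<ge> c\<close> and \<open>t \<le> 1\<close> bound \<open>t * w\<close>
    below by \<open>- \<bar>c\<bar>\<close>, which fixes \<open>m\<close> in the Taylor
    estimates.\<close>
  have "t * (- w) \<le> t * \<bar>c\<bar>" using t exponent_ge[OF s] by (intro mult_left_mono) (auto simp: w_def)
  also have "\<dots> \<le> 1 * \<bar>c\<bar>" using t by (intro mult_right_mono) auto
  finally have tw: "- \<bar>c\<bar> \<le> t * w" by simp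
  note b = exp_minus_one_bounds[OF tw abs_ge_zero]
  have sym: "symbol t s = exp (- (t * w))" by (simp add: symbol_def w_def)
  have "\<bar>s * ((symbol t s - 1) / t)\<bar> = s / t * \<bar>exp (- (t * w)) - 1\<bar>"
    using s t by (simp add: sym abs_mult)
  also have "\<dots> \<le> s / t * (\<bar>t * w\<bar> * exp \<bar>c\<bar>)"
    using b(1) s t by (intro mult_left_mono) auto
  also have "\<dots> = \<bar>weight s\<bar> * exp \<bar>c\<bar>" using s t by (simp add: abs_mult flip: sw)
  also have "\<dots> \<le> (\<bar>c - 1\<bar> + 1) * exp \<bar>c\<bar>" using weight(2)[OF s] by (intro mult_right_mono) auto
  finally show "\<bar>s * ((symbol t s - 1) / t)\<bar> \<le> (\<bar>c - 1\<bar> + 1) * exp \<bar>c\<bar>" .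
  have "s * (s * ((symbol t s - 1) / t)) + s * weight s = s\<^sup>2 / t * (exp (- (t * w)) - 1 + t * w)"
    using t by (simp add: sym power2_eq_square field_simps flip: sw)
  then have "\<bar>s * (s * ((symbol t s - 1) / t)) + s * weight s\<bar> = s\<^sup>2 / t * \<bar>exp (- (t * w)) - 1 + t * w\<bar>"
    using s t by (simp add: abs_mult)
  also have "\<dots> \<le> s\<^sup>2 / t * ((t * w)\<^sup>2 * exp \<bar>c\<bar>)"
    using b(2) s t by (intro mult_left_mono) auto
  also have "\<dots> = t * ((weight s)\<^sup>2 * exp \<bar>c\<bar>)" using t by (simp add: power_mult_distrib power2_eq_square flip: sw)
  also have "\<dots> \<le> t * ((\<bar>c - 1\<bar> + 1)\<^sup>2 * exp \<bar>c\<bar>)"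
    using weight(2)[OF s] t by (intro mult_left_mono mult_right_mono) (auto simp: abs_le_square_iff[symmetric])
  finally show "\<bar>s * (s * ((symbol t s - 1) / t)) + s * weight s\<bar> \<le> t * ((\<bar>c - 1\<bar> + 1)\<^sup>2 * exp \<bar>c\<bar>)" .
qed

lemma poly_approximable_linear: "poly_approximable (\<lambda>s. a * s + b)"
  by (intro poly_approximable_cong[OF poly_approximable_poly[of "[:b, a:]"]]) simp

lemma fun_calc_linear: "cont_fun_calc Q (\<lambda>s. a * s + b) x = a *\<^sub>R Q x + b *\<^sub>R x"
proof -
  have "(\<lambda>s. a * s + b) = poly [:b, a:]" by auto
  then show ?thesis by (simp add: Q.fun_calc_poly Q.poly_op_pCons Q.R.zero Q.R.scaleR)
qed

section \<open>Difference quotients and the generator\<close>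

definition quot :: "real \<Rightarrow> 'a \<Rightarrow> 'a" where "quot t x = (S t x - x) /\<^sub>R t"

lemma quot_Q:
  assumes t: "0 < t"
  shows "poly_approximable (\<lambda>s. s * ((symbol t s - 1) / t))"
    and "quot t (Q y) = cont_fun_calc Q (\<lambda>s. s * ((symbol t s - 1) / t)) y"
proof -
  have id: "poly_approximable (\<lambda>s. s)" using poly_approximable_linear[of 1 0] by simp
  have cst: "poly_approximable (\<lambda>s. a)" for a using poly_approximable_linear[of 0 a] by simp
  have eq: "(\<lambda>s. s * ((symbol t s - 1) / t)) = (\<lambda>s. (1 / t) * (symbol t s + - 1) * s)"
    by (simp add: fun_eq_iff)
  have sm: "poly_approximable (\<lambda>s. symbol t s + - 1)"
    using t by (intro poly_approximable_add cst poly_approximable_symbol) simp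
  have m: "poly_approximable (\<lambda>s. (1 / t) * (symbol t s + - 1))"
    by (intro poly_approximable_mult cst sm)
  show "poly_approximable (\<lambda>s. s * ((symbol t s - 1) / t))"
    unfolding eq by (intro poly_approximable_mult[OF m id])
  have "cont_fun_calc Q (\<lambda>s. s * ((symbol t s - 1) / t)) y
      = cont_fun_calc Q (\<lambda>s. (1 / t) * (symbol t s + - 1)) (Q y)"
    unfolding eq Q.fun_calc_mult[OF m id] Q.fun_calc_id ..
  also have "\<dots> = (1 / t) *\<^sub>R (S t (Q y) + (- 1) *\<^sub>R Q y)"
    unfolding Q.fun_calc_mult[OF cst sm] Q.fun_calc_const S_def
    using t Q.fun_calc_add[OF poly_approximable_symbol[of t] cst[of "-1"]] Q.fun_calc_const by simp
  finally show "quot t (Q y) = cont_fun_calc Q (\<lambda>s. s * ((symbol t s - 1) / t)) y"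
    by (simp add: quot_def divide_inverse)
qed

lemma norm_quot_Q_le:
  assumes "0 < t" "t \<le> 1"
  shows "norm (quot t (Q y)) \<le> (\<bar>c - 1\<bar> + 1) * exp \<bar>c\<bar> * norm y"
  unfolding quot_Q(2)[OF assms(1)]
  using symbol_bounds(1)[OF assms] by (intro Q.norm_fun_calc_le quot_Q assms(1))

lemma quot_diff: "0 \<le> t \<Longrightarrow> quot t (x - y) = quot t x - quot t y"
  unfolding quot_def linear_diff[OF bounded_linear.linear[OF bounded_linear_S]]
  by (simp add: algebra_simps)

lemma A_Q_eq: "A (Q y) = cont_fun_calc Q weight y"
proof -
  have "weight = (\<lambda>s. (c - 1) * s + 1)" by (simp add: weight_def fun_eq_iff)
  then show ?thesis by (simp add: fun_calc_linear A_Q)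
qed

lemma norm_quot_Q_Q_le:
  assumes "0 < t" "t \<le> 1"
  shows "norm (quot t (Q (Q y)) + A (Q (Q y))) \<le> t * ((\<bar>c - 1\<bar> + 1)\<^sup>2 * exp \<bar>c\<bar>) * norm y"
proof -
  note q = quot_Q[OF assms(1)]
  have id: "poly_approximable (\<lambda>s. s)" using poly_approximable_linear[of 1 0] by simp
  have w: "poly_approximable weight"
    unfolding weight_def using poly_approximable_linear[of "c - 1" 1] by (simp add: mult.commute)
  have comm: "Q (cont_fun_calc Q f y) = cont_fun_calc Q f (Q y)" if "poly_approximable f" for f
    by (rule Q.fun_calc_commute[OF that Q.bounded_linear_R]) simp
  have "cont_fun_calc Q (\<lambda>s. s * (s * ((symbol t s - 1) / t)) + s * weight s) y
      = quot t (Q (Q y)) + A (Q (Q y))"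
    unfolding Q.fun_calc_add[OF poly_approximable_mult[OF id q(1)] poly_approximable_mult[OF id w]]
      Q.fun_calc_mult[OF id q(1)] Q.fun_calc_mult[OF id w] Q.fun_calc_id
    by (simp only: comm[OF q(1)] comm[OF w] q(2) A_Q_eq)
  moreover have "norm (cont_fun_calc Q (\<lambda>s. s * (s * ((symbol t s - 1) / t)) + s * weight s) y)
      \<le> t * ((\<bar>c - 1\<bar> + 1)\<^sup>2 * exp \<bar>c\<bar>) * norm y"
    using symbol_bounds(2)[OF assms]
    by (intro Q.norm_fun_calc_le poly_approximable_add poly_approximable_mult id q(1) w)
  ultimately show ?thesis by simp
qed

lemma eventually_at_right_unit: "\<forall>\<^sub>F t in at_right (0::real). 0 < t \<and> t \<le> 1"
  unfolding eventually_at_right_field by (intro exI[of _ 1]) auto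

text \<open>The quotient composed with \<open>Q\<close> is bounded uniformly in \<open>t\<close>,
  and on the range of \<open>Q Q\<close> it converges with order \<open>t\<close>. As
  \<open>D\<close> is both dense and the range of \<open>Q\<close>, this gives convergence at
  \<open>Q y\<close> for all \<open>y\<close>, that is, on \<open>D\<close>.\<close>

lemma quot_tendsto:
  assumes "x \<in> D"
  shows "((\<lambda>t. quot t x) \<longlongrightarrow> - A x) (at_right 0)"
proof -
  define K where "K = (\<bar>c - 1\<bar> + 1) * exp \<bar>c\<bar> + (\<bar>c - 1\<bar> + 1)"
  have "((\<lambda>t. quot t (Q y) + A (Q y)) \<longlongrightarrow> 0) (at_right 0)" for y
  proof (rule tendsto_zero_dense[where E = D and L = K and x = y and F = "\<lambda>t y. quot t (Q y) + A (Q y)"])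
    show "\<forall>\<^sub>F t in at_right 0. \<forall>x y. quot t (Q (x - y)) + A (Q (x - y))
        = quot t (Q x) + A (Q x) - (quot t (Q y) + A (Q y))"
      using eventually_at_right_unit
      by eventually_elim (auto simp: Q.R.diff quot_diff A_diff Q_in)
    have w: "norm (A (Q x)) \<le> (\<bar>c - 1\<bar> + 1) * norm x" for x
      unfolding A_Q_eq using poly_approximable_linear[of "c - 1" 1] weight(2)
      by (intro Q.norm_fun_calc_le) (auto simp: weight_def[abs_def] mult.commute)
    show "\<forall>\<^sub>F t in at_right 0. \<forall>x. norm (quot t (Q x) + A (Q x)) \<le> K * norm x"
      using eventually_at_right_unit
    proof eventually_elim
      case (elim t)
      show ?case
      proof
        fix x
        show "norm (quot t (Q x) + A (Q x)) \<le> K * norm x"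
          using norm_triangle_le[OF add_mono[OF norm_quot_Q_le[of t x] w[of x]]] elim
          by (simp add: K_def distrib_right)
      qed
    qed
    show "closure D = UNIV" by (rule closure_D)
    fix x assume "x \<in> D"
    then obtain y where x: "x = Q y" using range_Q by blast
    show "((\<lambda>t. quot t (Q x) + A (Q x)) \<longlongrightarrow> 0) (at_right 0)"
    proof (rule Lim_null_comparison)
      show "\<forall>\<^sub>F t in at_right 0. norm (quot t (Q x) + A (Q x)) \<le> t * ((\<bar>c - 1\<bar> + 1)\<^sup>2 * exp \<bar>c\<bar>) * norm y"
        using eventually_at_right_unit by eventually_elim (use norm_quot_Q_Q_le x in auto)
      have "((\<lambda>t. t * ((\<bar>c - 1\<bar> + 1)\<^sup>2 * exp \<bar>c\<bar>) * norm y) \<longlongrightarrow> 0 * ((\<bar>c - 1\<bar> + 1)\<^sup>2 * exp \<bar>c\<bar>) * norm y) (at_right 0)"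
        by (intro tendsto_intros)
      then show "((\<lambda>t. t * ((\<bar>c - 1\<bar> + 1)\<^sup>2 * exp \<bar>c\<bar>) * norm y) \<longlongrightarrow> 0) (at_right 0)" by simp
    qed
  qed
  moreover obtain y where "x = Q y" using assms range_Q by blast
  ultimately have "((\<lambda>t. quot t x + A x) \<longlongrightarrow> 0) (at_right 0)" by simp
  from tendsto_add[OF this tendsto_const[of "- A x"]] show ?thesis by simp
qed

lemma S_tendsto: "((\<lambda>t. S t x) \<longlongrightarrow> x) (at_right 0)"
proof -
  have "((\<lambda>t. S t x - x) \<longlongrightarrow> 0) (at_right 0)"
  proof (rule tendsto_zero_dense[where E = D and L = "exp \<bar>c\<bar> + 1" and x = x and F = "\<lambda>t x. S t x - x"])
    show "\<forall>\<^sub>F t in at_right 0. \<forall>x y. S t (x - y) - (x - y) = S t x - x - (S t y - y)"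
      using eventually_at_right_unit
      by eventually_elim (auto simp: linear_diff[OF bounded_linear.linear[OF bounded_linear_S]])
    show "\<forall>\<^sub>F t in at_right 0. \<forall>x. norm (S t x - x) \<le> (exp \<bar>c\<bar> + 1) * norm x"
      using eventually_at_right_unit
    proof eventually_elim
      case (elim t)
      have "t * (- c) \<le> t * \<bar>c\<bar>" using elim by (intro mult_left_mono) auto
      also have "\<dots> \<le> 1 * \<bar>c\<bar>" using elim by (intro mult_right_mono) auto
      finally have "- (c * t) \<le> \<bar>c\<bar>" by (simp add: mult.commute)
      then have "exp (- (c * t)) * norm x \<le> exp \<bar>c\<bar> * norm x" for x :: 'a
        by (intro mult_right_mono) auto
      moreover have "norm (S t x) \<le> exp (- (c * t)) * norm x" for x using norm_S_le elim by simp
      ultimately have "norm (S t x) \<le> exp \<bar>c\<bar> * norm x" for x using order_trans by blast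
      then have "norm (S t x - x) \<le> exp \<bar>c\<bar> * norm x + norm x" for x
        using norm_triangle_ineq4[of "S t x" x] by (smt (verit))
      then show ?case by (simp add: algebra_simps)
    qed
    show "closure D = UNIV" by (rule closure_D)
    fix x assume "x \<in> D"
    have "((\<lambda>t. t *\<^sub>R quot t x) \<longlongrightarrow> 0 *\<^sub>R (- A x)) (at_right 0)"
      by (intro tendsto_intros quot_tendsto \<open>x \<in> D\<close>)
    then have "((\<lambda>t. t *\<^sub>R quot t x) \<longlongrightarrow> 0) (at_right 0)" by simp
    then show "((\<lambda>t. S t x - x) \<longlongrightarrow> 0) (at_right 0)"
      by (rule Lim_transform_eventually)
        (use eventually_at_right_unit in \<open>eventually_elim, simp add: quot_def\<close>)
  qed
  from tendsto_add[OF this tendsto_const[of x]] show ?thesis by simp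
qed

lemma C0_semigroup_S: "C0_semigroup S"
  unfolding C0_semigroup_def using bounded_linear_S S_zero S_add S_tendsto by blast

text \<open>One inclusion is the limit on \<open>D\<close>. Conversely, symmetry of
  \<open>S t\<close> moves the quotient from \<open>x\<close> to \<open>z \<in> D\<close>, and the
  limit puts \<open>x\<close> into the domain of the adjoint of \<open>A\<close>.\<close>

lemma generator_S: "generator_graph S = op_graph D (\<lambda>x. - A x)"
proof
  show "op_graph D (\<lambda>x. - A x) \<subseteq> generator_graph S"
    using quot_tendsto by (auto simp: op_graph_def generator_graph_def quot_def)
  show "generator_graph S \<subseteq> op_graph D (\<lambda>x. - A x)"
  proof (rule subrelI)
    fix x y assume "(x, y) \<in> generator_graph S"
    then have xy: "((\<lambda>t. quot t x) \<longlongrightarrow> y) (at_right 0)" by (simp add: generator_graph_def quot_def)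
    have "ip (A z) x = ip z (- y)" if "z \<in> D" for z
    proof -
      have "((\<lambda>t. ip (quot t z) x) \<longlongrightarrow> ip (- A z) x) (at_right 0)"
        by (intro ip.tendsto tendsto_const quot_tendsto that)
      moreover have "((\<lambda>t. ip z (quot t x)) \<longlongrightarrow> ip z y) (at_right 0)"
        by (intro ip.tendsto tendsto_const xy)
      then have "((\<lambda>t. ip (quot t z) x) \<longlongrightarrow> ip z y) (at_right 0)"
        by (rule Lim_transform_eventually)
          (use eventually_at_right_unit in \<open>eventually_elim, simp add: quot_def ip_simps S_sym\<close>)
      ultimately have "ip (- A z) x = ip z y" by (intro tendsto_unique[of "at_right 0"]) auto
      then show ?thesis by simp
    qed
    from A_adjI[OF this] show "(x, y) \<in> op_graph D (\<lambda>x. - A x)"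
      by (auto simp: op_graph_def)
  qed
qed

end

section \<open>Strongly continuous semigroups\<close>

text \<open>By Baire, one of the closed sets \<open>E k\<close>, which cover the space, contains a
  ball around some \<open>z\<close>. Subtracting the values at \<open>z + y\<close> and
  \<open>z\<close> gives the factor 2.\<close>

lemma banach_steinhaus:
  fixes F :: "nat \<Rightarrow> 'a::banach \<Rightarrow> 'b::real_normed_vector"
  assumes bl: "\<And>n. bounded_linear (F n)" and pt: "\<And>x. \<exists>K. \<forall>n. norm (F n x) \<le> K"
  shows "\<exists>K\<ge>0. \<forall>n x. norm (F n x) \<le> K * norm x"
proof -
  define E where "E k = {x. \<forall>n. norm (F n x) \<le> real k}" for k
  have cl: "closed (E k)" for k
  proof -
    have "E k = (\<Inter>n. {x. norm (F n x) \<le> real k})" by (auto simp: E_def)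
    also have "closed \<dots>"
      by (intro closed_INT ballI closed_Collect_le continuous_on_norm linear_continuous_on bl continuous_on_const)
    finally show ?thesis .
  qed
  have "\<exists>k. interior (E k) \<noteq> {}"
  proof (rule ccontr)
    assume "\<not> ?thesis"
    then have "interior (\<Union>(range E)) = {}"
      using Baire_category_alt[of "euclidean :: 'a topology" "range E"] cl
      by (auto simp: completely_metrizable_space_euclidean)
    moreover have "\<Union>(range E) = UNIV"
    proof -
      have "x \<in> \<Union>(range E)" for x
      proof -
        obtain K where K: "\<And>n. norm (F n x) \<le> K" using pt by blast
        obtain k where k: "K \<le> real k" using real_arch_simple by blast
        have "x \<in> E k" unfolding E_def using order_trans[OF K k] by simp
        then show ?thesis by blast
      qed
      then show ?thesis by blast
    qed
    ultimately show False by simp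
  qed
  then obtain k z where "z \<in> interior (E k)" by blast
  then obtain r where r: "r > 0" "cball z r \<subseteq> E k" by (auto simp: mem_interior_cball)
  have "norm (F n x) \<le> (2 * real k / r) * norm x" for n x
  proof (cases "x = 0")
    case True
    then show ?thesis using linear_0[OF bounded_linear.linear[OF bl]] by simp
  next
    case False
    interpret Fn: bounded_linear "F n" by (rule bl)
    define y where "y = (r / norm x) *\<^sub>R x"
    have "norm y = r" using False r by (simp add: y_def)
    then have "z + y \<in> cball z r" "z \<in> cball z r" using r by (simp_all add: dist_norm)
    then have "z + y \<in> E k" "z \<in> E k" using r(2) by blast+
    then have "norm (F n (z + y)) \<le> k" "norm (F n z) \<le> k" by (simp_all add: E_def)
    then have "norm (F n y) \<le> 2 * k"
      using norm_triangle_ineq4[of "F n (z + y)" "F n z"] by (simp add: Fn.add)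
    also have "norm (F n y) = r / norm x * norm (F n x)" using r by (simp add: y_def Fn.scaleR)
    finally show ?thesis using False r by (simp add: field_simps)
  qed
  then show ?thesis using r by (intro exI[of _ "2 * real k / r"]) auto
qed

text \<open>If no bound held near \<open>0\<close>, there would be times \<open>t n\<close> tending
  to \<open>0\<close> with operator norms above \<open>n\<close>, although \<open>S (t n) y\<close>
  converges for each \<open>y\<close>. The bound on a first interval spreads by the semigroup
  law.\<close>

lemma C0_semigroup_locally_bounded:
  assumes S: "C0_semigroup S" and T: "0 \<le> T"
  obtains M where "M \<ge> 1" "\<And>t x. 0 \<le> t \<Longrightarrow> t \<le> T \<Longrightarrow> norm (S t x) \<le> M * norm x"
proof -
  have bl: "\<And>t. 0 \<le> t \<Longrightarrow> bounded_linear (S t)" and add: "\<And>s t x. 0 \<le> s \<Longrightarrow> 0 \<le> t \<Longrightarrow> S (s + t) x = S s (S t x)"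
    and lim: "\<And>x. ((\<lambda>t. S t x) \<longlongrightarrow> x) (at_right 0)" and zero: "\<And>x. S 0 x = x"
    using S by (auto simp: C0_semigroup_def)
  have "\<exists>\<delta>>0. \<exists>M. \<forall>t x. 0 \<le> t \<and> t \<le> \<delta> \<longrightarrow> norm (S t x) \<le> M * norm x"
  proof (rule ccontr)
    assume neg: "\<not> ?thesis"
    have "\<exists>t x. 0 \<le> t \<and> t \<le> inverse (real (Suc n)) \<and> norm (S t x) > real n * norm x" for n
      using neg by (metis inverse_positive_iff_positive not_le of_nat_0_less_iff zero_less_Suc)
    then obtain t x where t: "\<And>n. 0 \<le> t n" "\<And>n. t n \<le> inverse (real (Suc n))"
      and x: "\<And>n. norm (S (t n) (x n)) > real n * norm (x n)" by metis
    have t0: "t \<longlonglongrightarrow> 0"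
      by (rule Lim_null_comparison[OF _ LIMSEQ_inverse_real_of_nat]) (use t in auto)
    have "\<exists>K. \<forall>n. norm (S (t n) y) \<le> K" for y
    proof -
      have "((\<lambda>t. S t y) \<longlongrightarrow> S 0 y) (at 0 within {0..})"
        using lim[of y] by (simp add: zero at_within_Ici_at_right)
      then have "continuous (at 0 within {0..}) (\<lambda>t. S t y)" by (simp add: continuous_within)
      then have "(\<lambda>n. S (t n) y) \<longlonglongrightarrow> S 0 y"
        using t0 t(1) unfolding continuous_within_sequentially o_def by auto
      then have "Bseq (\<lambda>n. S (t n) y)" by (intro convergent_imp_Bseq convergentI)
      then show ?thesis by (auto simp: Bseq_def)
    qed
    then obtain K where K: "\<And>n x. norm (S (t n) x) \<le> K * norm x"
      using banach_steinhaus[of "\<lambda>n. S (t n)"] bl t(1) by blast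
    obtain n :: nat where "K \<le> n" using real_arch_simple by blast
    then have "K * norm (x n) \<le> n * norm (x n)" by (intro mult_right_mono) auto
    then show False using K[of n "x n"] x[of n] by linarith
  qed
  then obtain \<delta> M0 where \<delta>: "\<delta> > 0" "\<And>t x. 0 \<le> t \<Longrightarrow> t \<le> \<delta> \<Longrightarrow> norm (S t x) \<le> M0 * norm x" by blast
  define M where "M = max 1 M0"
  have M: "M \<ge> 1" "norm (S t x) \<le> M * norm x" if "0 \<le> t" "t \<le> \<delta>" for t x
    using \<delta>(2)[OF that, of x] mult_right_mono[of M0 M "norm x"] by (auto simp: M_def)
  have M1: "1 \<le> M" by (simp add: M_def)
  have "norm (S t x) \<le> M ^ Suc n * norm x" if "0 \<le> t" "t \<le> (real n + 1) * \<delta>" for n t x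
    using that
  proof (induction n arbitrary: t)
    case 0
    then show ?case using M(2)[of t x] by simp
  next
    case (Suc n)
    show ?case
    proof (cases "t \<le> \<delta>")
      case True
      then have "norm (S t x) \<le> M * norm x" using M(2) Suc.prems by simp
      also have "\<dots> \<le> M ^ Suc (Suc n) * norm x"
        using power_increasing[of 1 "Suc (Suc n)" M] M1 by (intro mult_right_mono) auto
      finally show ?thesis .
    next
      case False
      have "S t x = S \<delta> (S (t - \<delta>) x)" using add[of \<delta> "t - \<delta>" x] False \<delta>(1) by simp
      also have "norm \<dots> \<le> M * norm (S (t - \<delta>) x)" using M(2) \<delta>(1) by simp
      also have "\<dots> \<le> M * (M ^ Suc n * norm x)"
      proof (intro mult_left_mono Suc.IH)
        show "t - \<delta> \<le> (real n + 1) * \<delta>" using Suc.prems by (simp add: algebra_simps)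
      qed (use False M1 in auto)
      finally show ?thesis by (simp add: mult.assoc)
    qed
  qed
  moreover obtain n :: nat where "T / \<delta> \<le> n" using real_arch_simple by blast
  then have "T \<le> (real n + 1) * \<delta>" using \<delta>(1) by (simp add: pos_divide_le_eq algebra_simps)
  ultimately have "norm (S t x) \<le> M ^ Suc n * norm x" if "0 \<le> t" "t \<le> T" for t x
    using that by (meson order_trans)
  moreover have "M ^ Suc n \<ge> 1" using M1 by (rule one_le_power)
  ultimately show ?thesis using that by blast
qed

lemma generator_invariant:
  assumes S: "C0_semigroup S" and xy: "(x, y) \<in> generator_graph S" and t: "0 \<le> t"
  shows "(S t x, S t y) \<in> generator_graph S"
proof -
  interpret St: bounded_linear "S t" using S t by (simp add: C0_semigroup_def)
  have comm: "S h (S t x) = S t (S h x)" if "0 \<le> h" for h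
    using S t that unfolding C0_semigroup_def by (metis add.commute)
  have "((\<lambda>h. S t ((S h x - x) /\<^sub>R h)) \<longlongrightarrow> S t y) (at_right 0)"
    using xy by (intro St.tendsto) (simp add: generator_graph_def)
  then have "((\<lambda>h. (S h (S t x) - S t x) /\<^sub>R h) \<longlongrightarrow> S t y) (at_right 0)"
  proof (rule Lim_transform_eventually)
    show "\<forall>\<^sub>F h in at_right 0. S t ((S h x - x) /\<^sub>R h) = (S h (S t x) - S t x) /\<^sub>R h"
      unfolding eventually_at_right_field
      by (intro exI[of _ 1]) (auto simp: St.scaleR St.diff comm)
  qed
  then show ?thesis by (simp add: generator_graph_def)
qed

text \<open>For right increments the operator \<open>S t\<close> is fixed. On the left the base
  point \<open>s = t - h\<close> moves with \<open>h\<close>, which is why a bound \<open>M\<close>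
  uniform on \<open>[0, T]\<close> is used.\<close>

lemma C0_semigroup_has_vector_derivative:
  assumes S: "C0_semigroup S" and xy: "(x, y) \<in> generator_graph S" and t: "t \<in> {0..T}"
  shows "((\<lambda>t. S t x) has_vector_derivative S t y) (at t within {0..T})"
proof -
  have bl: "\<And>t. 0 \<le> t \<Longrightarrow> bounded_linear (S t)" and add: "\<And>s t x. 0 \<le> s \<Longrightarrow> 0 \<le> t \<Longrightarrow> S (s + t) x = S s (S t x)"
    and lim: "\<And>x. ((\<lambda>t. S t x) \<longlongrightarrow> x) (at_right 0)"
    using S by (auto simp: C0_semigroup_def)
  from t obtain M where M: "M \<ge> 1" "\<And>t x. 0 \<le> t \<Longrightarrow> t \<le> T \<Longrightarrow> norm (S t x) \<le> M * norm x"
    using C0_semigroup_locally_bounded[OF S, of T] by (metis atLeastAtMost_iff order_trans)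
  define \<epsilon> where "\<epsilon> h = norm ((S h x - x) /\<^sub>R h - y) + norm (S h y - y)" for h
  have "((\<lambda>h. (S h x - x) /\<^sub>R h) \<longlongrightarrow> y) (at_right 0)" using xy by (simp add: generator_graph_def)
  then have "(\<epsilon> \<longlongrightarrow> norm (y - y) + norm (y - y)) (at_right 0)"
    unfolding \<epsilon>_def by (intro tendsto_intros lim)
  then have \<epsilon>: "(\<epsilon> \<longlongrightarrow> 0) (at_right 0)" by simp
  have step: "norm (S (a + h) x - S a x - h *\<^sub>R S a y) \<le> M * (h * norm ((S h x - x) /\<^sub>R h - y))"
    if a: "0 \<le> a" "a \<le> T" and h: "0 < h" for a h
  proof -
    interpret Sa: bounded_linear "S a" using a by (simp add: bl)
    have "S (a + h) x - S a x - h *\<^sub>R S a y = S a (S h x - x - h *\<^sub>R y)"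
      using add[of a h x] a h by (simp add: Sa.diff Sa.scaleR)
    also have "S h x - x - h *\<^sub>R y = h *\<^sub>R ((S h x - x) /\<^sub>R h - y)"
      using h by (simp add: scaleR_diff_right)
    finally show ?thesis using M(2)[OF a, of "h *\<^sub>R ((S h x - x) /\<^sub>R h - y)"] h by simp
  qed
  have main: "norm (S s x - S t x - (s - t) *\<^sub>R S t y) \<le> M * \<epsilon> \<bar>s - t\<bar> * \<bar>s - t\<bar>" if s: "s \<in> {0..T}" for s
  proof (cases s t rule: linorder_cases)
    case greater
    have "norm (S s x - S t x - (s - t) *\<^sub>R S t y) \<le> M * ((s - t) * norm ((S (s - t) x - x) /\<^sub>R (s - t) - y))"
      using step[of t "s - t"] t greater by simp
    also have "\<dots> \<le> M * ((s - t) * \<epsilon> \<bar>s - t\<bar>)"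
      using greater M by (intro mult_left_mono) (auto simp: \<epsilon>_def)
    finally show ?thesis using greater by (simp add: mult_ac)
  next
    case less
    define h where "h = t - s"
    have h: "0 < h" "t = s + h" using less by (auto simp: h_def)
    interpret Ss: bounded_linear "S s" using s by (simp add: bl)
    \<comment> \<open>Everything is rewritten from the left end point \<open>s\<close>; replacing
      \<open>S t y\<close> by \<open>S s y\<close> costs the term with
      \<open>S h y - y\<close>.\<close>
    have "S s x - S t x - (s - t) *\<^sub>R S t y
        = h *\<^sub>R S s (S h y - y) - (S (s + h) x - S s x - h *\<^sub>R S s y)"
      using add[of s h y] s h by (simp add: Ss.diff algebra_simps)
    also have "norm \<dots> \<le> norm (h *\<^sub>R S s (S h y - y)) + norm (S (s + h) x - S s x - h *\<^sub>R S s y)"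
      by (rule norm_triangle_ineq4)
    also have "\<dots> \<le> h * (M * norm (S h y - y)) + M * (h * norm ((S h x - x) /\<^sub>R h - y))"
      using M(2)[of s "S h y - y"] step[of s h] s h(1) by (intro add_mono) auto
    also have "\<dots> = M * \<epsilon> h * h" by (simp add: \<epsilon>_def algebra_simps)
    finally show ?thesis using less by (simp add: h_def)
  qed simp
  show ?thesis
    unfolding has_vector_derivative_def has_derivative_within_alt
  proof (intro conjI allI impI bounded_linear_scaleR_left)
    fix e :: real assume e: "0 < e"
    have "\<forall>\<^sub>F h in at_right 0. dist (\<epsilon> h) 0 < e / M" using tendstoD[OF \<epsilon>, of "e / M"] e M(1) by simp
    then obtain d where d: "d > 0" "\<And>h. 0 < h \<Longrightarrow> h < d \<Longrightarrow> dist (\<epsilon> h) 0 < e / M"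
      by (auto simp: eventually_at_right_field)
    show "\<exists>d>0. \<forall>s\<in>{0..T}. norm (s - t) < d \<longrightarrow> norm (S s x - S t x - (s - t) *\<^sub>R S t y) \<le> e * norm (s - t)"
    proof (intro exI conjI ballI impI)
      fix s assume s: "s \<in> {0..T}" "norm (s - t) < d"
      show "norm (S s x - S t x - (s - t) *\<^sub>R S t y) \<le> e * norm (s - t)"
      proof (cases "s = t")
        case False
        then have "\<bar>\<epsilon> \<bar>s - t\<bar>\<bar> < e / M" using d(2)[of "\<bar>s - t\<bar>"] s(2) by simp
        then have "M * \<epsilon> \<bar>s - t\<bar> \<le> e" using M(1) by (simp add: pos_less_divide_eq abs_less_iff mult.commute)
        then show ?thesis using main[OF s(1)] mult_right_mono[of "M * \<epsilon> \<bar>s - t\<bar>" e "\<bar>s - t\<bar>"] by simp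
      qed simp
    qed (rule d(1))
  qed
qed

section \<open>Uniqueness of the semigroup\<close>

context semibounded_op
begin

text \<open>The lower bound \<open>c\<close> makes \<open>exp (2 * c * t) * (norm (v t))^2\<close>
  nonincreasing along solutions of \<open>v' = - A v\<close>.\<close>

lemma energy_decay:
  assumes v: "\<And>t. t \<in> {0..T} \<Longrightarrow> (v has_vector_derivative - A (v t)) (at t within {0..T})"
    and vD: "\<And>t. t \<in> {0..T} \<Longrightarrow> v t \<in> D" and v0: "v 0 = 0" and T: "0 \<le> T"
  shows "v T = 0"
proof (cases "T = 0")
  case False
  define \<psi> where "\<psi> t = exp (2 * c * t) * ip (v t) (v t)" for t
  have deriv: "(\<psi> has_vector_derivative exp (2 * c * t) * (2 * c * ip (v t) (v t) - 2 * ip (A (v t)) (v t)))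
      (at t within {0..T})" if t: "t \<in> {0..T}" for t
    unfolding \<psi>_def
    by (rule derivative_eq_intros ip.has_vector_derivative v[OF t] refl
        | simp add: ip_commute algebra_simps has_real_derivative_iff_has_vector_derivative[symmetric])+
  have "\<psi> T \<le> \<psi> 0"
  proof (rule DERIV_nonpos_imp_decreasing_open[OF T])
    fix t assume t: "0 < t" "t < T"
    then have "(\<psi> has_real_derivative exp (2 * c * t) * (2 * c * ip (v t) (v t) - 2 * ip (A (v t)) (v t))) (at t)"
      using deriv[of t] by (simp add: has_real_derivative_iff_has_vector_derivative at_within_Icc_at)
    moreover have "exp (2 * c * t) * (2 * c * ip (v t) (v t) - 2 * ip (A (v t)) (v t)) \<le> 0"
      using lower_bound[OF vD, of t] t by (simp add: mult_le_0_iff ip_self)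
    ultimately show "\<exists>y. (\<psi> has_real_derivative y) (at t) \<and> y \<le> 0" by blast
  next
    show "continuous_on {0..T} \<psi>"
      using has_vector_derivative_continuous[OF deriv] by (auto simp: continuous_on_eq_continuous_within)
  qed
  then show ?thesis by (simp add: \<psi>_def v0 ip_self mult_le_0_iff)
qed (simp add: v0)

text \<open>Makes the description in \<open>exp_minus\<close> unique. For \<open>x \<in> D\<close>
  both orbits solve the same equation, so \<open>energy_decay\<close> applies to their difference;
  density does the rest.\<close>

lemma semigroup_unique:
  assumes S': "C0_semigroup S'" "generator_graph S' = op_graph D (\<lambda>x. - A x)" and t: "0 \<le> t"
  shows "S' t x = S t x"
proof -
  have D_eq: "S' t x = S t x" if x: "x \<in> D" for x
  proof -
    have "S' t x - S t x = 0"
    proof (rule energy_decay[OF _ _ _ t])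
      fix s assume s: "s \<in> {0..t}"
      have g: "(x, - A x) \<in> generator_graph S'" "(x, - A x) \<in> generator_graph S"
        using x by (auto simp: S'(2) generator_S op_graph_def)
      have "(S' s x, S' s (- A x)) \<in> op_graph D (\<lambda>x. - A x)" "(S s x, S s (- A x)) \<in> op_graph D (\<lambda>x. - A x)"
        using generator_invariant[OF S'(1) g(1), of s] generator_invariant[OF C0_semigroup_S g(2), of s] s
        by (simp_all add: S'(2) generator_S)
      then have inD: "S' s x \<in> D" "S s x \<in> D" and eq: "S' s (- A x) = - A (S' s x)" "S s (- A x) = - A (S s x)"
        by (auto simp: op_graph_def)
      show "S' s x - S s x \<in> D" using inD by (simp add: D_closed)
      have "((\<lambda>s. S' s x - S s x) has_vector_derivative S' s (- A x) - S s (- A x)) (at s within {0..t})"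
        by (intro has_vector_derivative_diff C0_semigroup_has_vector_derivative S'(1) C0_semigroup_S g s)
      then show "((\<lambda>s. S' s x - S s x) has_vector_derivative - A (S' s x - S s x)) (at s within {0..t})"
        using inD by (simp add: eq A_diff)
    next
      show "S' 0 x - S 0 x = 0" using S'(1) by (simp add: C0_semigroup_def S_zero)
    qed
    then show ?thesis by simp
  qed
  have bl: "bounded_linear (S' t)" using S' t by (simp add: C0_semigroup_def)
  have "closed {x. S' t x = S t x}"
    by (intro closed_Collect_eq linear_continuous_on bl bounded_linear_S t)
  then have "closure D \<subseteq> {x. S' t x = S t x}" using D_eq by (intro closure_minimal) auto
  then show ?thesis by (auto simp: closure_D)
qed

lemma exp_minus_eq: "0 \<le> t \<Longrightarrow> exp_minus D A t x = S t x"
  unfolding exp_minus_def using C0_semigroup_S generator_S semigroup_unique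
  by (intro the_equality) blast+

section \<open>Invariance of the domain, commutation, approximate eigenvectors\<close>

lemma S_invariant:
  assumes "x \<in> D" "0 \<le> t"
  shows "S t x \<in> D" "A (S t x) = S t (A x)"
proof -
  have "(x, - A x) \<in> generator_graph S" using assms by (auto simp: generator_S op_graph_def)
  from generator_invariant[OF C0_semigroup_S this assms(2)]
  have "S t x \<in> D" "S t (- A x) = - A (S t x)" by (auto simp: generator_S op_graph_def)
  then show "S t x \<in> D" "A (S t x) = S t (A x)"
    using linear_neg[OF bounded_linear.linear[OF bounded_linear_S[OF assms(2)]], of "A x"] by simp_all
qed

lemma S_commute_R: "0 \<le> t \<Longrightarrow> S t (R x) = R (S t x)"
proof -
  assume t: "0 \<le> t"
  have "R (S t x) = S t (R x)"
  proof (rule R_eqI)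
    have "S t (R x) + A (A (S t (R x))) = S t (R x + A (A (R x)))"
      using R(1,2)[of x] t by (simp add: S_invariant linear_add[OF bounded_linear.linear[OF bounded_linear_S]])
    then show "S t (R x) + A (A (S t (R x))) = S t x" by (simp add: R)
  qed (use R[of x] t in \<open>simp_all add: S_invariant\<close>)
  then show ?thesis by simp
qed

text \<open>The derivative of \<open>exp (\<kappa> t) S t g\<close> is
  \<open>- exp (\<kappa> t) S t k\<close> with \<open>k = A g - \<kappa> g\<close>; the mean value
  inequality bounds the change on \<open>[0, T]\<close>.\<close>

lemma S_approx_eigenvector:
  assumes g: "g \<in> D" and t: "t \<in> {0..T}"
  shows "norm (exp (\<kappa> * t) *\<^sub>R S t g - g) \<le> T * exp ((\<bar>\<kappa>\<bar> + \<bar>c\<bar>) * T) * norm (A g - \<kappa> *\<^sub>R g)"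
proof -
  define k where "k = A g - \<kappa> *\<^sub>R g"
  define f where "f t = exp (\<kappa> * t) *\<^sub>R S t g" for t
  \<comment> \<open>Bounds \<open>exp (\<kappa> * s)\<close> times the growth bound
    \<open>exp (- (c * s))\<close> of \<open>S s\<close>, whatever the signs of
    \<open>\<kappa>\<close> and \<open>c\<close>.\<close>
  define L where "L = exp ((\<bar>\<kappa>\<bar> + \<bar>c\<bar>) * T)"
  have gen: "(g, - A g) \<in> generator_graph S" using g by (auto simp: generator_S op_graph_def)
  have deriv: "(f has_vector_derivative - (exp (\<kappa> * s) *\<^sub>R S s k)) (at s within {0..T})" if s: "s \<in> {0..T}" for s
  proof -
    interpret Ss: bounded_linear "S s" using s by (simp add: bounded_linear_S)
    have "((\<lambda>t. exp (\<kappa> * t)) has_vector_derivative exp (\<kappa> * s) * \<kappa>) (at s within {0..T})"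
      unfolding has_real_derivative_iff_has_vector_derivative[symmetric]
      by (auto intro!: derivative_eq_intros)
    from bounded_bilinear.has_vector_derivative[OF bounded_bilinear_scaleR this
        C0_semigroup_has_vector_derivative[OF C0_semigroup_S gen s]]
    show ?thesis unfolding f_def
      by (rule has_vector_derivative_eq_rhs) (simp add: k_def Ss.diff Ss.scaleR Ss.neg algebra_simps)
  qed
  have "norm (f t - f 0) \<le> (L * norm k) * norm (t - 0)"
  proof (rule differentiable_bound[of "{0..T}"])
    fix s assume s: "s \<in> {0..T}"
    show "(f has_derivative (\<lambda>h. h *\<^sub>R - (exp (\<kappa> * s) *\<^sub>R S s k))) (at s within {0..T})"
      using deriv[OF s] by (simp add: has_vector_derivative_def)
    have "\<kappa> * s \<le> \<bar>\<kappa>\<bar> * T" "- (c * s) \<le> \<bar>c\<bar> * T"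
      using s mult_mono[of \<kappa> "\<bar>\<kappa>\<bar>" s T] mult_mono[of "- c" "\<bar>c\<bar>" s T] by auto
    then have "exp (\<kappa> * s + - (c * s)) \<le> L" by (simp add: L_def distrib_right)
    have "norm (exp (\<kappa> * s) *\<^sub>R S s k) \<le> exp (\<kappa> * s) * (exp (- (c * s)) * norm k)"
      using norm_S_le[of s k] s by simp
    also have "\<dots> = exp (\<kappa> * s + - (c * s)) * norm k" unfolding exp_add by simp
    also have "\<dots> \<le> L * norm k" using \<open>exp (\<kappa> * s + - (c * s)) \<le> L\<close> by (intro mult_right_mono) auto
    finally have b: "norm (exp (\<kappa> * s) *\<^sub>R S s k) \<le> L * norm k" .
    show "onorm (\<lambda>h. h *\<^sub>R - (exp (\<kappa> * s) *\<^sub>R S s k)) \<le> L * norm k"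
    proof (rule onorm_bound)
      fix h
      have "norm (h *\<^sub>R - (exp (\<kappa> * s) *\<^sub>R S s k)) = \<bar>h\<bar> * norm (exp (\<kappa> * s) *\<^sub>R S s k)"
        by (simp only: norm_scaleR norm_minus_cancel)
      also have "\<dots> \<le> \<bar>h\<bar> * (L * norm k)" using b by (rule mult_left_mono) simp
      finally show "norm (h *\<^sub>R - (exp (\<kappa> * s) *\<^sub>R S s k)) \<le> L * norm k * norm h"
        by (simp add: mult_ac)
    qed (simp add: L_def)
  qed (use t in auto)
  also have "\<dots> \<le> L * norm k * T" using t by (intro mult_left_mono) (auto simp: L_def)
  finally show ?thesis by (simp add: f_def S_zero L_def k_def mult_ac)
qed

end

section \<open>Extension by density\<close>

lemma bounded_linear_eq_on_dense:
  assumes "bounded_linear F" "bounded_linear G" "closure E = UNIV" "\<And>x. x \<in> E \<Longrightarrow> F x = G x"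
  shows "F = G"
proof -
  have "closed {x. F x = G x}" by (intro closed_Collect_eq linear_continuous_on assms)
  then have "closure E \<subseteq> {x. F x = G x}" using assms(4) by (intro closure_minimal) auto
  then show ?thesis using assms(3) by auto
qed

text \<open>The bound makes \<open>h\<close> vanish on the kernel of \<open>\<iota>\<close>, so
  \<open>h\<close> descends to the range of \<open>\<iota>\<close>; Lipschitz continuity then
  extends it to the closure.\<close>

lemma bounded_linear_extension:
  fixes \<iota> :: "'a::real_normed_vector \<Rightarrow> 'b::real_normed_vector" and h :: "'a \<Rightarrow> 'c::banach"
  assumes \<iota>: "linear \<iota>" "closure (range \<iota>) = UNIV" and h: "linear h"
    and bound: "\<And>x. norm (h x) \<le> K * norm (\<iota> x)"
  obtains G where "bounded_linear G" "\<And>x. G (\<iota> x) = h x"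
proof -
  define L where "L = max 0 K"
  have L: "0 \<le> L" "norm (h x) \<le> L * norm (\<iota> x)" for x
    using bound[of x] mult_right_mono[of K L "norm (\<iota> x)"] by (auto simp: L_def)
  define h' where "h' y = h (inv \<iota> y)" for y
  have h': "h' (\<iota> x) = h x" for x
  proof -
    have "\<iota> (inv \<iota> (\<iota> x)) = \<iota> x" by (simp add: f_inv_into_f)
    then have "norm (h (inv \<iota> (\<iota> x) - x)) \<le> 0" using L(2)[of "inv \<iota> (\<iota> x) - x"] by (simp add: linear_diff[OF \<iota>(1)])
    then show ?thesis by (simp add: h'_def linear_diff[OF h])
  qed
  have "L-lipschitz_on (range \<iota>) h'"
  proof (rule lipschitz_onI)
    fix y z assume "y \<in> range \<iota>" "z \<in> range \<iota>"
    then obtain a b where "y = \<iota> a" "z = \<iota> b" by blast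
    then show "dist (h' y) (h' z) \<le> L * dist y z"
      using L(2)[of "a - b"] by (simp add: h' dist_norm linear_diff[OF h] linear_diff[OF \<iota>(1)])
  qed (rule L(1))
  then have "uniformly_continuous_on (range \<iota>) h'" by (rule lipschitz_on_uniformly_continuous)
  then obtain G where G: "uniformly_continuous_on (closure (range \<iota>)) G" "\<And>x. x \<in> range \<iota> \<Longrightarrow> h' x = G x"
    by (rule uniformly_continuous_on_extension_on_closure) blast
  have cont: "isCont G y" for y
    using uniformly_continuous_imp_continuous[OF G(1)] \<iota>(2) by (simp add: continuous_on_eq_continuous_at)
  have G\<iota>: "G (\<iota> x) = h x" for x using G(2)[of "\<iota> x"] h' by simp
  have approx: "\<exists>a. (\<lambda>n. \<iota> (a n)) \<longlonglongrightarrow> y" for y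
  proof -
    have "y \<in> closure (range \<iota>)" using \<iota>(2) by simp
    then obtain b where "\<And>n. b n \<in> range \<iota>" "b \<longlonglongrightarrow> y" by (auto simp: closure_sequential)
    moreover from this have "\<iota> (inv \<iota> (b n)) = b n" for n by (simp add: f_inv_into_f)
    ultimately show ?thesis by (intro exI[of _ "\<lambda>n. inv \<iota> (b n)"]) simp
  qed
  have lim: "(\<lambda>n. h (a n)) \<longlonglongrightarrow> G y" if "(\<lambda>n. \<iota> (a n)) \<longlonglongrightarrow> y" for a y
    using isCont_tendsto_compose[OF cont that] by (simp add: G\<iota>)
  have "bounded_linear G"
  proof (rule bounded_linear_intro[where K = L])
    fix y z r
    obtain a b where a: "(\<lambda>n. \<iota> (a n)) \<longlonglongrightarrow> y" and b: "(\<lambda>n. \<iota> (b n)) \<longlonglongrightarrow> z" using approx by metis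
    have "(\<lambda>n. \<iota> (a n + b n)) \<longlonglongrightarrow> y + z" using tendsto_add[OF a b] by (simp add: linear_add[OF \<iota>(1)])
    then have "(\<lambda>n. h (a n + b n)) \<longlonglongrightarrow> G (y + z)" by (rule lim)
    then show "G (y + z) = G y + G z"
      using tendsto_add[OF lim[OF a] lim[OF b]] by (simp add: linear_add[OF h] LIMSEQ_unique)
    have "(\<lambda>n. \<iota> (r *\<^sub>R a n)) \<longlonglongrightarrow> r *\<^sub>R y" using tendsto_scaleR[OF tendsto_const a] by (simp add: linear_scale[OF \<iota>(1)])
    then have "(\<lambda>n. h (r *\<^sub>R a n)) \<longlonglongrightarrow> G (r *\<^sub>R y)" by (rule lim)
    then show "G (r *\<^sub>R y) = r *\<^sub>R G y"
      using tendsto_scaleR[OF tendsto_const[of r] lim[OF a]] by (simp add: linear_scale[OF h] LIMSEQ_unique)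
    show "norm (G y) \<le> norm y * L"
    proof (rule LIMSEQ_le)
      show "(\<lambda>n. norm (h (a n))) \<longlonglongrightarrow> norm (G y)" by (intro tendsto_norm lim a)
      show "(\<lambda>n. norm (\<iota> (a n)) * L) \<longlonglongrightarrow> norm y * L" by (intro tendsto_intros a)
    qed (use L in \<open>simp add: mult.commute\<close>)
  qed
  then show ?thesis using that G\<iota> by blast
qed

lemma extension_eq:
  assumes "closure (range \<iota>) = UNIV" "bounded_linear G" "\<And>x. G (\<iota> x) = \<iota> (F x)"
  shows "extension \<iota> F = G"
  unfolding extension_def
proof (rule the_equality)
  fix H assume H: "bounded_linear H \<and> (\<forall>x. H (\<iota> x) = \<iota> (F x))"
  show "H = G" by (rule bounded_linear_eq_on_dense[OF _ assms(2,1)]) (use H assms(3) in auto)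
qed (use assms in auto)


section \<open>Estimates for strong integrals\<close>

text \<open>Measurability of \<open>\<parallel>f - s\<^sub>n\<parallel>\<close> comes from writing it, almost everywhere, as a limit of norms of
  simple functions.\<close>

lemma strong_integral_functional_le:
  fixes f :: "'t \<Rightarrow> 'b::banach" and \<phi> :: "'b \<Rightarrow> real"
  assumes z: "has_strong_integral M f z" and \<phi>: "bounded_linear \<phi>"
    and h: "h \<in> borel_measurable M" and le: "\<And>t. t \<in> space M \<Longrightarrow> \<bar>\<phi> (f t)\<bar> \<le> h t"
  shows "ennreal \<bar>\<phi> z\<bar> \<le> (\<integral>\<^sup>+t. ennreal (h t) \<partial>M)"
proof -
  interpret \<phi>: bounded_linear \<phi> by fact
  obtain K where K: "K \<ge> 0" "\<And>y. norm (\<phi> y) \<le> norm y * K" using \<phi>.nonneg_bounded by blast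
  obtain r where r: "\<And>n. simple_function M (r n)" "AE t in M. (\<lambda>n. r n t) \<longlonglongrightarrow> f t"
    using z by (auto simp: has_strong_integral_def strongly_measurable_def)
  obtain s where s: "\<And>n. Bochner_Integration.simple_bochner_integrable M (s n)"
    "(\<lambda>n. \<integral>\<^sup>+t. ennreal (norm (f t - s n t)) \<partial>M) \<longlonglongrightarrow> 0"
    "(\<lambda>n. Bochner_Integration.simple_bochner_integral M (s n)) \<longlonglongrightarrow> z"
    using z by (auto simp: has_strong_integral_def)
  define d where "d n t = liminf (\<lambda>k. ennreal (norm (r k t - s n t)))" for n t
  have sf: "simple_function M (s n)" for n using s(1)[of n] by (auto elim: simple_bochner_integrable.cases)
  have [measurable]: "(\<lambda>t. ennreal (norm (r k t - s n t))) \<in> borel_measurable M" for k n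
    by (intro borel_measurable_simple_function simple_function_compose2[OF r(1) sf])
  have [measurable]: "d n \<in> borel_measurable M" for n unfolding d_def by measurable
  have d: "AE t in M. d n t = ennreal (norm (f t - s n t))" for n
    using r(2)
  proof eventually_elim
    case (elim t)
    then have "(\<lambda>k. ennreal (norm (r k t - s n t))) \<longlonglongrightarrow> ennreal (norm (f t - s n t))"
      by (intro tendsto_intros)
    then show ?case unfolding d_def by (intro lim_imp_Liminf) auto
  qed
  \<comment> \<open>The functional commutes with the integral of simple functions; replacing
    \<open>f\<close> by \<open>s n\<close> costs \<open>K\<close> times their L1 distance, which
    tends to zero.\<close>
  have est: "ennreal \<bar>\<phi> (Bochner_Integration.simple_bochner_integral M (s n))\<bar>
      \<le> (\<integral>\<^sup>+t. ennreal (h t) \<partial>M) + ennreal K * (\<integral>\<^sup>+t. ennreal (norm (f t - s n t)) \<partial>M)" for n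
  proof -
    have sb: "Bochner_Integration.simple_bochner_integrable M (\<lambda>t. \<phi> (s n t))"
      using simple_bochner_integrable_compose2[OF _ s(1) s(1), of "\<lambda>x y. \<phi> x"] by (simp add: \<phi>.zero)
    have sbn: "Bochner_Integration.simple_bochner_integrable M (\<lambda>t. norm (\<phi> (s n t)))"
      using simple_bochner_integrable_compose2[OF _ sb sb, of "\<lambda>x y. norm x"] by simp
    have "\<bar>\<phi> (Bochner_Integration.simple_bochner_integral M (s n))\<bar>
        \<le> Bochner_Integration.simple_bochner_integral M (\<lambda>t. norm (\<phi> (s n t)))"
      using simple_bochner_integral_norm_bound[OF sb]
      by (simp add: simple_bochner_integral_linear[OF \<phi>.linear s(1)])
    then have "ennreal \<bar>\<phi> (Bochner_Integration.simple_bochner_integral M (s n))\<bar>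
        \<le> (\<integral>\<^sup>+t. ennreal (norm (\<phi> (s n t))) \<partial>M)"
      using simple_bochner_integral_eq_nn_integral[OF sbn] by (metis ennreal_leI norm_ge_zero)
    also have "\<dots> \<le> (\<integral>\<^sup>+t. (ennreal (h t) + ennreal K * d n t) \<partial>M)"
    proof (rule nn_integral_mono_AE)
      show "AE t in M. ennreal (norm (\<phi> (s n t))) \<le> ennreal (h t) + ennreal K * d n t"
        using d[of n] AE_space
      proof eventually_elim
        case (elim t)
        have "\<phi> (s n t) = \<phi> (f t) - \<phi> (f t - s n t)" by (simp add: \<phi>.diff)
        then have "\<bar>\<phi> (s n t)\<bar> \<le> h t + K * norm (f t - s n t)"
          using le[OF elim(2)] K(2)[of "f t - s n t"] by (simp add: mult.commute)
        moreover have "0 \<le> h t" using le[OF elim(2)] by linarith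
        ultimately have "ennreal (norm (\<phi> (s n t))) \<le> ennreal (h t) + ennreal (K * norm (f t - s n t))"
          using K(1) by (simp add: ennreal_leI flip: ennreal_plus)
        then show ?case using K(1) elim(1) by (simp add: ennreal_mult)
      qed
    qed
    also have "\<dots> = (\<integral>\<^sup>+t. ennreal (h t) \<partial>M) + ennreal K * (\<integral>\<^sup>+t. d n t \<partial>M)"
      using h by (simp add: nn_integral_add nn_integral_cmult)
    also have "(\<integral>\<^sup>+t. d n t \<partial>M) = (\<integral>\<^sup>+t. ennreal (norm (f t - s n t)) \<partial>M)"
      using d by (rule nn_integral_cong_AE)
    finally show ?thesis .
  qed
  have "(\<lambda>n. (\<integral>\<^sup>+t. ennreal (h t) \<partial>M) + ennreal K * (\<integral>\<^sup>+t. ennreal (norm (f t - s n t)) \<partial>M))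
      \<longlonglongrightarrow> (\<integral>\<^sup>+t. ennreal (h t) \<partial>M) + ennreal K * 0"
    by (intro tendsto_add tendsto_const ennreal_tendsto_cmult s(2)) simp
  note lim = this
  have "(\<lambda>n. ennreal \<bar>\<phi> (Bochner_Integration.simple_bochner_integral M (s n))\<bar>) \<longlonglongrightarrow> ennreal \<bar>\<phi> z\<bar>"
    by (intro tendsto_ennrealI tendsto_rabs \<phi>.tendsto s(3))
  from LIMSEQ_le[OF this lim]
  have "ennreal \<bar>\<phi> z\<bar> \<le> (\<integral>\<^sup>+t. ennreal (h t) \<partial>M) + ennreal K * 0"
    using est by blast
  then show ?thesis by simp
qed

text \<open>The integral of \<open>exp (- 2 \<kappa> (T - t))\<close> over \<open>[0, T]\<close>,
  contributed by Cauchy--Schwarz.\<close>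

definition exp_weight :: "real \<Rightarrow> real \<Rightarrow> real"
  where "exp_weight \<kappa> T = (if \<kappa> = 0 then T else (1 - exp (- (2 * \<kappa> * T))) / (2 * \<kappa>))"

lemma exp_weight_pos: "0 < T \<Longrightarrow> 0 < exp_weight \<kappa> T"
  by (auto simp: exp_weight_def zero_less_divide_iff mult_less_0_iff)

lemma nn_integral_exp_weight:
  assumes "0 \<le> T"
  shows "(\<integral>\<^sup>+t. ennreal ((exp (- (\<kappa> * (T - t))))\<^sup>2) \<partial>lebesgue_on {0..T}) = ennreal (exp_weight \<kappa> T)"
proof -
  define F where "F t = (if \<kappa> = 0 then t else exp (- (2 * \<kappa> * (T - t))) / (2 * \<kappa>))" for t
  have "((\<lambda>t. (exp (- (\<kappa> * (T - t))))\<^sup>2) has_integral (F T - F 0)) {0..T}"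
  proof (rule fundamental_theorem_of_calculus[OF assms])
    fix t assume "t \<in> {0..T}"
    have "(exp (- (\<kappa> * (T - t))))\<^sup>2 = exp (- (2 * \<kappa> * (T - t)))"
      by (simp add: power2_eq_square flip: exp_add)
    then have "(F has_real_derivative (exp (- (\<kappa> * (T - t))))\<^sup>2) (at t within {0..T})"
      unfolding F_def by (cases "\<kappa> = 0") (auto intro!: derivative_eq_intros)
    then show "(F has_vector_derivative (exp (- (\<kappa> * (T - t))))\<^sup>2) (at t within {0..T})"
      by (simp add: has_real_derivative_iff_has_vector_derivative)
  qed
  from nn_integral_has_integral_lebesgue'[OF _ this]
  have "(\<integral>\<^sup>+t. ennreal ((exp (- (\<kappa> * (T - t))))\<^sup>2) * indicator {0..T} t \<partial>lborel) = ennreal (F T - F 0)"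
    by simp
  also have "F T - F 0 = exp_weight \<kappa> T" by (simp add: F_def exp_weight_def diff_divide_distrib)
  finally show ?thesis by (simp add: nn_integral_restrict_space nn_integral_completion)
qed

text \<open>Cauchy--Schwarz on \<open>[0, T]\<close>, carried out in \<open>ennreal\<close>, where
  no integrability of the product has to be known beforehand.\<close>

lemma nn_integral_L2_le:
  assumes u: "u \<in> L2 T" and T: "0 \<le> T" and C: "0 \<le> C"
  shows "(\<lambda>t. C * (norm (u t) * exp (- (\<kappa> * (T - t))))) \<in> borel_measurable (lebesgue_on {0..T})"
    and "(\<integral>\<^sup>+t. ennreal (C * (norm (u t) * exp (- (\<kappa> * (T - t))))) \<partial>lebesgue_on {0..T})
      \<le> ennreal (C * (L2_norm T u * sqrt (exp_weight \<kappa> T)))"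
proof -
  let ?M = "lebesgue_on {0..T}"
  have int: "integrable ?M (\<lambda>t. (norm (u t))\<^sup>2)" using u by (simp add: L2_def)
  \<comment> \<open>Integrability gives measurability of the squared norm; its square root is the
    norm itself.\<close>
  have "(\<lambda>t. sqrt ((norm (u t))\<^sup>2)) \<in> borel_measurable ?M"
    using borel_measurable_integrable[OF int] by measurable
  then have [measurable]: "(\<lambda>t. norm (u t)) \<in> borel_measurable ?M" by simp
  have [measurable]: "(\<lambda>t. exp (- (\<kappa> * (T - t)))) \<in> borel_measurable ?M"
    by (intro continuous_imp_measurable_on_sets_lebesgue continuous_intros) auto
  show "(\<lambda>t. C * (norm (u t) * exp (- (\<kappa> * (T - t))))) \<in> borel_measurable ?M" by measurable
  define I where "I = (\<integral>\<^sup>+t. ennreal (norm (u t)) * ennreal (exp (- (\<kappa> * (T - t)))) \<partial>?M)"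
  have ew: "0 \<le> exp_weight \<kappa> T" using exp_weight_pos[of T \<kappa>] T by (cases "T = 0") (auto simp: exp_weight_def)
  have "I\<^sup>2 \<le> (\<integral>\<^sup>+t. (ennreal (norm (u t)))\<^sup>2 \<partial>?M) * (\<integral>\<^sup>+t. (ennreal (exp (- (\<kappa> * (T - t)))))\<^sup>2 \<partial>?M)"
    unfolding I_def by (rule Cauchy_Schwarz_nn_integral) measurable
  also have "(\<integral>\<^sup>+t. (ennreal (norm (u t)))\<^sup>2 \<partial>?M) = ennreal ((L2_norm T u)\<^sup>2)"
    using nn_integral_eq_integral[OF int] by (simp add: ennreal_power L2_norm_def)
  also have "(\<integral>\<^sup>+t. (ennreal (exp (- (\<kappa> * (T - t)))))\<^sup>2 \<partial>?M) = ennreal ((sqrt (exp_weight \<kappa> T))\<^sup>2)"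
    using nn_integral_exp_weight[OF T, of \<kappa>] ew by (simp add: ennreal_power)
  also have "ennreal ((L2_norm T u)\<^sup>2) * ennreal ((sqrt (exp_weight \<kappa> T))\<^sup>2)
      = (ennreal (L2_norm T u * sqrt (exp_weight \<kappa> T)))\<^sup>2"
    using ew by (simp add: ennreal_power power_mult_distrib L2_norm_def flip: ennreal_mult)
  finally have sq: "I\<^sup>2 \<le> (ennreal (L2_norm T u * sqrt (exp_weight \<kappa> T)))\<^sup>2" .
  \<comment> \<open>Squares are compared in the reals, so an infinite \<open>I\<close> is excluded
    separately: its square would be infinite as well.\<close>
  have I: "I \<le> ennreal (L2_norm T u * sqrt (exp_weight \<kappa> T))"
  proof (cases I)
    case (real r)
    have w: "0 \<le> L2_norm T u * sqrt (exp_weight \<kappa> T)" using ew by (simp add: L2_norm_def)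
    have "ennreal (r\<^sup>2) \<le> ennreal ((L2_norm T u * sqrt (exp_weight \<kappa> T))\<^sup>2)"
      using sq by (simp only: real(2) ennreal_power[OF real(1)] ennreal_power[OF w])
    then have "r\<^sup>2 \<le> (L2_norm T u * sqrt (exp_weight \<kappa> T))\<^sup>2" by (simp only: ennreal_le_iff zero_le_power2)
    then have "r \<le> L2_norm T u * sqrt (exp_weight \<kappa> T)" using w by (rule power2_le_imp_le)
    then show ?thesis unfolding real(2) by (rule ennreal_leI)
  next
    case top
    have "(ennreal (L2_norm T u * sqrt (exp_weight \<kappa> T)))\<^sup>2 \<noteq> top" by (simp add: power2_eq_square ennreal_mult_eq_top_iff)
    moreover have "I\<^sup>2 = top" using top by (simp add: power2_eq_square ennreal_top_mult)
    ultimately show ?thesis using sq by (simp only: top_unique)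
  qed
  have "(\<integral>\<^sup>+t. ennreal (C * (norm (u t) * exp (- (\<kappa> * (T - t))))) \<partial>?M) = ennreal C * I"
    unfolding I_def using C by (simp add: ennreal_mult nn_integral_cmult)
  also have "\<dots> \<le> ennreal C * ennreal (L2_norm T u * sqrt (exp_weight \<kappa> T))"
    using I by (rule mult_left_mono) simp
  finally show "(\<integral>\<^sup>+t. ennreal (C * (norm (u t) * exp (- (\<kappa> * (T - t))))) \<partial>?M)
      \<le> ennreal (C * (L2_norm T u * sqrt (exp_weight \<kappa> T)))"
    using C ew by (simp add: ennreal_mult L2_norm_def)
qed

section \<open>The underlying real Hilbert space\<close>

lemma conj_of_real: "conj (of_real r :: 'k::rc_field) = of_real r"
proof -
  have "conj (1 :: 'k) = 1" using mult_conj[of "1 :: 'k"] by simp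
  then show ?thesis using conj_scaleR[of r "1 :: 'k"] by (simp add: of_real_def)
qed

text \<open>The real part of the inner product by polarization; a formula in the norm alone serves
  every scalar field of the class.\<close>

definition real_ip :: "'a::real_normed_vector \<Rightarrow> 'a \<Rightarrow> real"
  where "real_ip x y = ((norm (x + y))\<^sup>2 - (norm x)\<^sup>2 - (norm y)\<^sup>2) / 2"

context hilbert_space
begin

lemma scaleR_eq: "r *\<^sub>R x = scale (of_real r) x"
  by (simp add: scale_of_real)

lemma ip_add_right: "ip z (x + y) = ip z x + ip z y"
  by (metis ip_add_left ip_conj conj_add)

lemma real_ip_eq: "of_real (2 * real_ip x y) = ip x y + conj (ip x y)"
proof -
  have "of_real ((norm (x + y))\<^sup>2) = of_real ((norm x)\<^sup>2) + ip x y + conj (ip x y) + of_real ((norm y)\<^sup>2)"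
    by (simp only: ip_self[symmetric] ip_conj[symmetric] ip_add_left ip_add_right add_ac)
  moreover have "2 * real_ip x y = (norm (x + y))\<^sup>2 - (norm x)\<^sup>2 - (norm y)\<^sup>2" by (simp add: real_ip_def)
  ultimately show ?thesis by (simp only: of_real_diff) (simp add: algebra_simps)
qed

lemma real_hilbert_real_ip: "real_hilbert (real_ip :: 'a \<Rightarrow> 'a \<Rightarrow> real)"
proof
  fix x y z :: 'a and r :: real
  have "of_real (2 * real_ip (x + y) z) = (of_real (2 * real_ip x z + 2 * real_ip y z) :: 'k)"
    unfolding of_real_add real_ip_eq by (simp add: ip_add_left conj_add)
  then show "real_ip (x + y) z = real_ip x z + real_ip y z" unfolding of_real_eq_iff by simp
  have "of_real (2 * real_ip (r *\<^sub>R x) y) = (of_real (r * (2 * real_ip x y)) :: 'k)"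
    unfolding of_real_mult[of r] real_ip_eq
    by (simp add: scaleR_eq ip_scale_left conj_mult conj_of_real distrib_left)
  then show "real_ip (r *\<^sub>R x) y = r * real_ip x y" unfolding of_real_eq_iff by simp
  show "real_ip x y = real_ip y x" by (simp add: real_ip_def add.commute)
  have "norm (x + x) = 2 * norm x" by (simp flip: scaleR_2)
  then show "real_ip x x = (norm x)\<^sup>2" by (simp add: real_ip_def power_mult_distrib)
qed

text \<open>Both inner products define the same adjoint. The nontrivial inclusion recovers a scalar
  identity from its real part by multiplying the test vector with a scalar, as \<open>D\<close> and
  \<open>A\<close> respect all scalars.\<close>

lemma self_adjoint_real_ip:
  assumes sa: "self_adjoint scale ip D A"
  shows "self_adjoint scaleR real_ip D A"
proof -
  have D: "real_vector.subspace D" and Dsc: "\<And>c x. x \<in> D \<Longrightarrow> scale c x \<in> D"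
    and A: "\<And>c x. x \<in> D \<Longrightarrow> A (scale c x) = scale c (A x)"
    and adj: "adjoint_graph ip D A = op_graph D A"
    using sa by (auto simp: self_adjoint_def subspace_def real_vector.subspace_def scaleR_eq)
  interpret rh: real_hilbert "real_ip :: 'a \<Rightarrow> 'a \<Rightarrow> real" by (rule real_hilbert_real_ip)
  have "adjoint_graph real_ip D A = adjoint_graph ip D A"
  proof (intro set_eqI iffI; clarify)
    fix y z assume "(y, z) \<in> adjoint_graph ip D A"
    then have "ip (A x) y = ip x z" if "x \<in> D" for x using that by (simp add: adjoint_graph_def)
    then have "of_real (2 * real_ip (A x) y) = (of_real (2 * real_ip x z) :: 'k)" if "x \<in> D" for x
      unfolding real_ip_eq using that by simp
    then show "(y, z) \<in> adjoint_graph real_ip D A" unfolding of_real_eq_iff by (simp add: adjoint_graph_def)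
  next
    fix y z assume yz: "(y, z) \<in> adjoint_graph real_ip D A"
    have "ip (A x) y = ip x z" if x: "x \<in> D" for x
    proof -
      \<comment> \<open>The defect; testing with \<open>conj w\<close> times \<open>x\<close> turns
        the real identity into \<open>2 * (norm w)^2 = 0\<close>.\<close>
      define w where "w = ip (A x) y - ip x z"
      have "real_ip (A (scale (conj w) x)) y = real_ip (scale (conj w) x) z"
        using yz Dsc[OF x] by (simp add: adjoint_graph_def)
      then have "ip (scale (conj w) (A x)) y + conj (ip (scale (conj w) (A x)) y)
          = ip (scale (conj w) x) z + conj (ip (scale (conj w) x) z)"
        using A[OF x] by (simp flip: real_ip_eq)
      then have "conj w * ip (A x) y + w * conj (ip (A x) y) = conj w * ip x z + w * conj (ip x z)"
        by (simp add: ip_scale_left conj_mult conj_conj)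
      then have "conj w * (ip (A x) y - ip x z) + w * (conj (ip (A x) y) - conj (ip x z)) = 0"
        by (simp only: right_diff_distrib) (simp add: algebra_simps)
      then have "conj w * w + w * (conj (ip (A x) y) - conj (ip x z)) = 0"
        by (simp only: w_def)
      moreover have "conj w = conj (ip (A x) y) - conj (ip x z)"
        unfolding w_def using conj_add[of "ip (A x) y - ip x z" "ip x z"] by simp
      ultimately have "w * conj w + w * conj w = 0"
        by (simp add: mult.commute)
      then have "(norm w)\<^sup>2 *\<^sub>R (1 :: 'k) + (norm w)\<^sup>2 *\<^sub>R 1 = 0" by (simp only: mult_conj)
      then have "of_real (2 * (norm w)\<^sup>2) = (of_real 0 :: 'k)" by (simp add: of_real_def flip: scaleR_add_left)
      then have "w = 0" unfolding of_real_eq_iff by simp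
      then show ?thesis by (simp add: w_def)
    qed
    then show "(y, z) \<in> adjoint_graph ip D A" by (simp add: adjoint_graph_def)
  qed
  then show ?thesis
    using sa D adj A by (auto simp: self_adjoint_def Real_Vector_Spaces.subspace_raw_def scaleR_eq)
qed

lemma lower_semibounded_real_ip:
  assumes "lower_semibounded ip D A"
  obtains c where "\<And>x. x \<in> D \<Longrightarrow> c * (norm x)\<^sup>2 \<le> real_ip (A x) x"
proof -
  obtain c where c: "\<forall>x\<in>D. \<exists>r::real. ip (A x) x = of_real r \<and> c * (norm x)\<^sup>2 \<le> r"
    using assms by (auto simp: lower_semibounded_def)
  have "c * (norm x)\<^sup>2 \<le> real_ip (A x) x" if "x \<in> D" for x
  proof -
    obtain r where r: "ip (A x) x = of_real r" "c * (norm x)\<^sup>2 \<le> r" using c \<open>x \<in> D\<close> by blast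
    have "of_real (2 * real_ip (A x) x) = (of_real (2 * r) :: 'k)"
      unfolding real_ip_eq r(1) conj_of_real by simp
    then show ?thesis using r(2) unfolding of_real_eq_iff by simp
  qed
  then show ?thesis using that by blast
qed

lemma spectrum_real_ip: "of_real \<kappa> \<in> spectrum scale D A \<Longrightarrow> \<kappa> \<in> spectrum scaleR D A"
  by (simp add: spectrum_def resolvent_set_def scale_of_real)

end

lemma (in normed_space_over) linear_imp_real_linear:
  assumes F: "Vector_Spaces.linear scale s2 F" and s2: "normed_space_over s2"
  shows "linear F"
proof -
  interpret F: Vector_Spaces.linear scale s2 F by (rule F)
  interpret s2: normed_space_over s2 by (rule s2)
  show ?thesis
  proof
    show "F (x + y) = F x + F y" for x y by (rule F.add)
    show "F (r *\<^sub>R x) = r *\<^sub>R F x" for r x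
      using F.scale[of "of_real r" x] by (simp only: scale_of_real s2.scale_of_real)
  qed
qed


section \<open>The lower bound\<close>

context semibounded_op
begin

section \<open>The operator (I + A^2)^(beta/2)\<close>

definition P :: "real \<Rightarrow> 'a \<Rightarrow> 'a" where "P \<beta> = I_plus_sq_powr D A (\<beta> / 2)"

lemma norm_beta_eq: "norm_beta D A \<beta> x = norm (P \<beta> x)"
  by (simp add: norm_beta_def P_def)

lemma P_eq: "P \<beta> = cont_fun_calc R (\<lambda>t. t powr (- (\<beta> / 2)))"
  by (simp add: P_def I_plus_sq_powr_def)

text \<open>Exponent 0 is separate because \<open>0 powr 0 = 0\<close> breaks continuity at
  \<open>0\<close>; on \<open>(0, 1]\<close> the function is constant 1.\<close>

lemma poly_approximable_powr:
  assumes "0 \<le> a"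
  shows "poly_approximable (\<lambda>t. t powr a)"
proof (cases "a = 0")
  case True
  then show ?thesis by (intro poly_approximable_cong[OF poly_approximable_poly[of 1]]) simp
next
  case False
  then show ?thesis
    using assms by (intro poly_approximable_continuous[of "\<lambda>t. t powr a"] continuous_on_powr' continuous_intros) auto
qed

context
  fixes \<beta> :: real
  assumes \<beta>: "\<beta> \<le> 0"
begin

lemma approx_P: "poly_approximable (\<lambda>t. t powr (- (\<beta> / 2)))"
  using \<beta> by (intro poly_approximable_powr) simp

lemma bounded_linear_P: "bounded_linear (P \<beta>)"
  unfolding P_eq by (rule R.bounded_linear_fun_calc[OF approx_P])

lemma P_sym: "ip (P \<beta> x) y = ip x (P \<beta> y)"
  unfolding P_eq by (rule R.fun_calc_sym[OF approx_P])

lemma norm_P_le: "norm (P \<beta> x) \<le> norm x"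
proof -
  have "norm (P \<beta> x) \<le> 1 * norm x"
    unfolding P_eq using \<beta> by (intro R.norm_fun_calc_le approx_P) (auto intro!: powr_le1)
  then show ?thesis by simp
qed

lemma S_commute_P: "0 \<le> t \<Longrightarrow> S t (P \<beta> x) = P \<beta> (S t x)"
  unfolding P_eq by (intro R.fun_calc_commute approx_P bounded_linear_S S_commute_R)

lemma P_approx_eigenvector:
  assumes g: "\<And>n. g n \<in> D" "\<And>n. norm (g n) = 1" "(\<lambda>n. A (g n) - \<kappa> *\<^sub>R g n) \<longlonglongrightarrow> 0"
  shows "(\<lambda>n. P \<beta> (g n) - (1 + \<kappa>\<^sup>2) powr (\<beta> / 2) *\<^sub>R g n) \<longlonglongrightarrow> 0"
proof -
  \<comment> \<open>The point for \<open>R\<close> that corresponds to \<open>\<kappa>\<close>; its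
    power with exponent \<open>- \<beta> / 2\<close> produces the factor in the theorem.\<close>
  define \<mu> where "\<mu> = 1 / (1 + \<kappa>\<^sup>2)"
  have pos: "0 < 1 + \<kappa>\<^sup>2" by (simp add: add_pos_nonneg)
  have \<mu>: "\<mu> \<in> {0<..1}" using pos by (simp add: \<mu>_def)
  have "(\<lambda>n. (1 + \<bar>\<kappa>\<bar>) * norm (A (g n) - \<kappa> *\<^sub>R g n)) \<longlonglongrightarrow> (1 + \<bar>\<kappa>\<bar>) * norm (0::'a)"
    by (intro tendsto_intros g(3))
  then have "(\<lambda>n. (1 + \<bar>\<kappa>\<bar>) * norm (A (g n) - \<kappa> *\<^sub>R g n)) \<longlonglongrightarrow> 0" by simp
  then have "(\<lambda>n. R (g n) - \<mu> *\<^sub>R g n) \<longlonglongrightarrow> 0"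
    by (rule Lim_null_comparison[rotated]) (simp add: R_approx_eigenvector g(1) \<mu>_def)
  from R.fun_calc_approx_eigenvector[OF approx_P \<mu> g(2) this]
  have "(\<lambda>n. P \<beta> (g n) - \<mu> powr (- (\<beta> / 2)) *\<^sub>R g n) \<longlonglongrightarrow> 0" by (simp add: P_eq)
  moreover have "\<mu> powr (- (\<beta> / 2)) = (1 + \<kappa>\<^sup>2) powr (\<beta> / 2)"
    using pos by (simp add: \<mu>_def powr_divide powr_minus_divide)
  ultimately show ?thesis by simp
qed

section \<open>The completion and the control problem\<close>

context
  fixes \<iota> :: "'a \<Rightarrow> 'y::banach"
  assumes linear_\<iota>: "linear \<iota>" and norm_\<iota>: "\<And>x. norm (\<iota> x) = norm (P \<beta> x)"
    and dense_\<iota>: "closure (range \<iota>) = UNIV"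
begin

text \<open>As \<open>P\<close> commutes with \<open>S t\<close>, the growth bound of
  \<open>S t\<close> is also a bound in the norm of the completion; hence the extension exists and
  is what \<open>extension\<close> denotes.\<close>

lemma extension_S:
  assumes t: "0 \<le> t"
  shows "bounded_linear (extension \<iota> (exp_minus D A t))"
    and "extension \<iota> (exp_minus D A t) (\<iota> x) = \<iota> (S t x)"
proof -
  have eq: "exp_minus D A t = S t" using exp_minus_eq[OF t] by blast
  have lin: "linear (\<lambda>x. \<iota> (S t x))"
    using linear_compose[OF bounded_linear.linear[OF bounded_linear_S[OF t]] linear_\<iota>] by (simp add: o_def)
  have "norm (\<iota> (S t x)) \<le> exp (- (c * t)) * norm (\<iota> x)" for x
    using norm_S_le[OF t, of "P \<beta> x"] by (simp add: norm_\<iota> S_commute_P[OF t])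
  then obtain G where G: "bounded_linear G" "\<And>x. G (\<iota> x) = \<iota> (S t x)"
    using bounded_linear_extension[OF linear_\<iota> dense_\<iota> lin] by metis
  have "extension \<iota> (exp_minus D A t) = G"
    unfolding eq by (rule extension_eq[OF dense_\<iota> G])
  with G show "bounded_linear (extension \<iota> (exp_minus D A t))"
    "extension \<iota> (exp_minus D A t) (\<iota> x) = \<iota> (S t x)" by simp_all
qed

text \<open>On the range of \<open>\<iota>\<close> symmetry moves \<open>S t\<close> to
  \<open>g\<close>, and \<open>norm (P x)\<close> is the norm of \<open>\<iota> x\<close>, so
  Cauchy--Schwarz gives the estimate; both sides are continuous, so it holds on the closure.\<close>

lemma functional_exists:
  obtains \<phi> :: "'y \<Rightarrow> real" where "bounded_linear \<phi>" "\<And>x. \<phi> (\<iota> x) = ip (P \<beta> x) g"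
    "\<And>t y. 0 \<le> t \<Longrightarrow> \<bar>\<phi> (extension \<iota> (exp_minus D A t) y)\<bar> \<le> norm y * norm (S t g)"
proof -
  have lin: "linear (\<lambda>x. ip (P \<beta> x) g)"
    by (intro bounded_linear.linear bounded_linear_compose[OF ip.bounded_linear_left bounded_linear_P])
  have "norm (ip (P \<beta> x) g) \<le> norm g * norm (\<iota> x)" for x
    using Cauchy_Schwarz[of "P \<beta> x" g] by (simp add: norm_\<iota> mult.commute)
  then obtain \<phi> :: "'y \<Rightarrow> real" where \<phi>: "bounded_linear \<phi>" "\<And>x. \<phi> (\<iota> x) = ip (P \<beta> x) g"
    using bounded_linear_extension[OF linear_\<iota> dense_\<iota> lin] by metis
  have bound: "\<bar>\<phi> (extension \<iota> (exp_minus D A t) y)\<bar> \<le> norm y * norm (S t g)" if t: "0 \<le> t" for t y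
  proof -
    let ?V = "{y. \<bar>\<phi> (extension \<iota> (exp_minus D A t) y)\<bar> \<le> norm y * norm (S t g)}"
    have "\<iota> x \<in> ?V" for x
    proof -
      have "\<phi> (extension \<iota> (exp_minus D A t) (\<iota> x)) = ip (P \<beta> x) (S t g)"
        using t by (simp add: extension_S \<phi>(2) S_sym flip: S_commute_P)
      then show ?thesis using Cauchy_Schwarz by (simp add: norm_\<iota>)
    qed
    moreover have "closed ?V"
      by (intro closed_Collect_le continuous_on_rabs continuous_on_mult continuous_on_norm continuous_on_id
          continuous_on_const linear_continuous_on bounded_linear_compose[OF \<phi>(1) extension_S(1)[OF t]])
    ultimately have "closure (range \<iota>) \<subseteq> ?V" by (intro closure_minimal) auto
    then show ?thesis using dense_\<iota> by auto
  qed
  show ?thesis by (rule that[OF \<phi> bound])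
qed

text \<open>Pairing \<open>\<iota> (S T g) + z = 0\<close> with the functional \<open>\<iota> x \<mapsto> \<langle>P x, g\<rangle>\<close> for an approximate
  eigenvector \<open>g\<close>.\<close>

lemma admissible_control_bound:
  fixes B :: "'u::banach \<Rightarrow> 'y"
  assumes B: "bounded_linear B" and u: "u \<in> L2 T" and T: "0 < T"
    and z: "input_map \<iota> D A B T u z" and null: "\<iota> (exp_minus D A T g) + z = 0"
    and g: "g \<in> D" "norm g = 1"
    and \<delta>: "\<And>t. t \<in> {0..T} \<Longrightarrow> norm (exp (\<kappa> * t) *\<^sub>R S t g - g) \<le> \<delta>"
    and \<eta>: "norm (P \<beta> g - m *\<^sub>R g) \<le> \<eta>"
  shows "exp (- (\<kappa> * T)) * (m - \<eta> - \<delta>) \<le> onorm B * (1 + \<delta>) * (L2_norm T u * sqrt (exp_weight \<kappa> T))"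
proof -
  obtain \<phi> :: "'y \<Rightarrow> real" where \<phi>: "bounded_linear \<phi>" "\<And>x. \<phi> (\<iota> x) = ip (P \<beta> x) g"
    "\<And>t y. 0 \<le> t \<Longrightarrow> \<bar>\<phi> (extension \<iota> (exp_minus D A t) y)\<bar> \<le> norm y * norm (S t g)"
    by (rule functional_exists[of g]) (rule that)
  have \<delta>0: "0 \<le> \<delta>" using order_trans[OF norm_ge_zero \<delta>[of 0]] T by simp
  have Sg: "norm (S t g) \<le> exp (- (\<kappa> * t)) * (1 + \<delta>)" if "t \<in> {0..T}" for t
  proof -
    have "S t g = exp (- (\<kappa> * t)) *\<^sub>R (exp (\<kappa> * t) *\<^sub>R S t g)" by (simp flip: exp_add)
    also have "norm \<dots> = exp (- (\<kappa> * t)) * norm (exp (\<kappa> * t) *\<^sub>R S t g)" by (simp only: norm_scaleR) simp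
    also have "\<dots> \<le> exp (- (\<kappa> * t)) * (1 + \<delta>)"
      using \<delta>[OF that] g(2) norm_triangle_ineq2[of "exp (\<kappa> * t) *\<^sub>R S t g" g]
      by (intro mult_left_mono) (auto simp del: norm_scaleR)
    finally show ?thesis .
  qed
  have oB: "0 \<le> onorm B" using onorm_pos_le[OF B] .
  have C: "0 \<le> onorm B * (1 + \<delta>)" using oB \<delta>0 by simp
  note L2 = nn_integral_L2_le[OF u less_imp_le[OF T] C, of \<kappa>]
  have "ennreal \<bar>\<phi> z\<bar> \<le> (\<integral>\<^sup>+t. ennreal (onorm B * (1 + \<delta>) * (norm (u t) * exp (- (\<kappa> * (T - t))))) \<partial>lebesgue_on {0..T})"
  proof (rule strong_integral_functional_le[OF _ \<phi>(1) L2(1)])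
    show "has_strong_integral (lebesgue_on {0..T}) (\<lambda>s. extension \<iota> (exp_minus D A (T - s)) (B (u s))) z"
      using z by (simp add: input_map_def)
    fix t assume "t \<in> space (lebesgue_on {0..T})"
    then have t: "t \<in> {0..T}" by simp
    then have "\<bar>\<phi> (extension \<iota> (exp_minus D A (T - t)) (B (u t)))\<bar> \<le> norm (B (u t)) * norm (S (T - t) g)"
      using \<phi>(3) by simp
    also have "\<dots> \<le> (onorm B * norm (u t)) * (exp (- (\<kappa> * (T - t))) * (1 + \<delta>))"
      using onorm[OF B, of "u t"] Sg[of "T - t"] t oB by (intro mult_mono) auto
    finally show "\<bar>\<phi> (extension \<iota> (exp_minus D A (T - t)) (B (u t)))\<bar>
        \<le> onorm B * (1 + \<delta>) * (norm (u t) * exp (- (\<kappa> * (T - t))))" by (simp add: mult_ac)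
  qed
  also note L2(2)
  finally have up: "\<bar>\<phi> z\<bar> \<le> onorm B * (1 + \<delta>) * (L2_norm T u * sqrt (exp_weight \<kappa> T))"
    using C exp_weight_pos[OF T, of \<kappa>] by (simp add: L2_norm_def)
  define r where "r = exp (\<kappa> * T) *\<^sub>R S T g - g"
  have SG: "S T g = exp (- (\<kappa> * T)) *\<^sub>R (g + r)" by (simp add: r_def flip: exp_add)
  have "\<phi> z = - \<phi> (\<iota> (S T g))"
    using null linear_add[OF bounded_linear.linear[OF \<phi>(1)], of "\<iota> (S T g)" z]
      linear_0[OF bounded_linear.linear[OF \<phi>(1)]] T
    by (simp add: exp_minus_eq)
  also have "\<phi> (\<iota> (S T g)) = exp (- (\<kappa> * T)) * ip (g + r) (P \<beta> g)"
    unfolding \<phi>(2) P_sym SG by (simp add: ip_scaleR_left)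
  also have "ip (g + r) (P \<beta> g) = m + ip g (P \<beta> g - m *\<^sub>R g) + ip r (P \<beta> g)"
    using g(2) by (simp add: ip_simps ip_self)
  finally have "\<bar>\<phi> z\<bar> = exp (- (\<kappa> * T)) * \<bar>m + ip g (P \<beta> g - m *\<^sub>R g) + ip r (P \<beta> g)\<bar>"
    by (simp add: abs_mult)
  moreover have "\<bar>ip g (P \<beta> g - m *\<^sub>R g)\<bar> \<le> \<eta>"
    using Cauchy_Schwarz[of g "P \<beta> g - m *\<^sub>R g"] \<eta> g(2) by simp
  \<comment> \<open>\<open>P\<close> is a contraction for \<open>\<beta> \<le> 0\<close>, so the
    error of the semigroup is not magnified.\<close>
  moreover have "\<bar>ip r (P \<beta> g)\<bar> \<le> \<delta>"
  proof -
    have "norm r * norm (P \<beta> g) \<le> \<delta> * 1"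
      using \<delta>[of T] T norm_P_le[of g] g(2) \<delta>0 by (intro mult_mono) (auto simp: r_def)
    then show ?thesis using Cauchy_Schwarz[of r "P \<beta> g"] by linarith
  qed
  ultimately have "exp (- (\<kappa> * T)) * (m - \<eta> - \<delta>) \<le> \<bar>\<phi> z\<bar>" by simp
  then show ?thesis using up by linarith
qed

text \<open>Each unit vector \<open>g n\<close> competes in the supremum, and \<open>b n\<close>
  bounds all of its admissible controls from below. As \<open>\<eta>\<close> and
  \<open>\<delta>\<close> vanish, \<open>b n\<close> tends to the stated constant.\<close>

lemma control_cost_ge:
  fixes B :: "'u::banach \<Rightarrow> 'y"
  assumes B: "bounded_linear B" "onorm B \<noteq> 0" and T: "0 < T" and \<kappa>: "\<kappa> \<in> spectrum scaleR D A"
  shows "ennreal (exp (- (\<kappa> * T)) * (1 + \<kappa>\<^sup>2) powr (\<beta> / 2) / (onorm B * sqrt (exp_weight \<kappa> T)))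
    \<le> control_cost \<iota> D A B T"
proof -
  define m where "m = (1 + \<kappa>\<^sup>2) powr (\<beta> / 2)"
  define W where "W = sqrt (exp_weight \<kappa> T)"
  have W: "0 < W" using exp_weight_pos[OF T] by (simp add: W_def)
  have oB: "0 < onorm B" using B onorm_pos_le[OF B(1)] by simp
  obtain g where g: "\<And>n. g n \<in> D" "\<And>n. norm (g n) = 1" "(\<lambda>n. A (g n) - \<kappa> *\<^sub>R g n) \<longlonglongrightarrow> 0"
    using weyl_sequence[OF \<kappa>] by blast
  define \<eta> where "\<eta> n = norm (P \<beta> (g n) - m *\<^sub>R g n)" for n
  define \<delta> where "\<delta> n = T * exp ((\<bar>\<kappa>\<bar> + \<bar>c\<bar>) * T) * norm (A (g n) - \<kappa> *\<^sub>R g n)" for n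
  \<comment> \<open>Possibly negative for some \<open>n\<close>, where \<open>ennreal\<close> makes
    it \<open>0\<close>; the limit is unaffected.\<close>
  define b where "b n = exp (- (\<kappa> * T)) * (m - \<eta> n - \<delta> n) / (onorm B * (1 + \<delta> n) * W)" for n
  have \<delta>0: "0 \<le> \<delta> n" for n using T by (simp add: \<delta>_def)
  have "\<eta> \<longlonglongrightarrow> 0" unfolding \<eta>_def m_def using P_approx_eigenvector[OF g] by (intro tendsto_norm_zero)
  moreover have "\<delta> \<longlonglongrightarrow> T * exp ((\<bar>\<kappa>\<bar> + \<bar>c\<bar>) * T) * 0"
    unfolding \<delta>_def using g(3) by (intro tendsto_mult tendsto_const tendsto_norm_zero)
  ultimately have "b \<longlonglongrightarrow> exp (- (\<kappa> * T)) * (m - 0 - T * exp ((\<bar>\<kappa>\<bar> + \<bar>c\<bar>) * T) * 0)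
      / (onorm B * (1 + T * exp ((\<bar>\<kappa>\<bar> + \<bar>c\<bar>) * T) * 0) * W)"
    unfolding b_def using oB W by (intro tendsto_intros) auto
  then have lim: "(\<lambda>n. ennreal (b n)) \<longlonglongrightarrow> ennreal (exp (- (\<kappa> * T)) * m / (onorm B * W))"
    by (intro tendsto_ennrealI) simp
  have "ennreal (b n) \<le> control_cost \<iota> D A B T" for n
  proof -
    have "ennreal (b n) \<le> ennreal (L2_norm T u)"
      if u: "u \<in> L2 T" "input_map \<iota> D A B T u z" "\<iota> (exp_minus D A T (g n)) + z = 0" for u z
    proof (rule ennreal_leI)
      have "exp (- (\<kappa> * T)) * (m - \<eta> n - \<delta> n) \<le> onorm B * (1 + \<delta> n) * (L2_norm T u * sqrt (exp_weight \<kappa> T))"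
        using S_approx_eigenvector[OF g(1), of _ T \<kappa> n]
        by (intro admissible_control_bound[OF B(1) u(1) T u(2,3) g(1,2)]) (auto simp: \<delta>_def \<eta>_def)
      moreover have "0 < onorm B * (1 + \<delta> n) * W" using oB W \<delta>0[of n] by simp
      ultimately show "b n \<le> L2_norm T u"
        unfolding b_def by (simp add: pos_divide_le_eq W_def mult_ac)
    qed
    then have "ennreal (b n) \<le> (INF u\<in>{u\<in>L2 T. \<exists>z. input_map \<iota> D A B T u z \<and> \<iota> (exp_minus D A T (g n)) + z = 0}.
        ennreal (L2_norm T u))"
      by (intro INF_greatest) blast
    also have "\<dots> \<le> control_cost \<iota> D A B T"
      unfolding control_cost_def by (rule SUP_upper) (simp add: g(2))
    finally show ?thesis .
  qed
  then have "ennreal (exp (- (\<kappa> * T)) * m / (onorm B * W)) \<le> control_cost \<iota> D A B T"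
    by (intro LIMSEQ_le_const2[OF lim]) auto
  then show ?thesis by (simp add: m_def W_def)
qed

end

end

end

text \<open>Origin of the case distinction in the theorem: the left-hand side is the time-dependent
  factor in the square of the bound of \<open>control_cost_ge\<close>.\<close>

lemma exp_weight_quotient:
  assumes "0 < T"
  shows "exp (- (2 * \<kappa> * T)) / exp_weight \<kappa> T = (if \<kappa> = 0 then 1 / T else 2 * \<kappa> / (exp (2 * \<kappa> * T) - 1))"
proof (cases "\<kappa> = 0")
  case False
  then have ne: "exp (2 * \<kappa> * T) \<noteq> 1" using assms by simp
  have "exp (- (2 * \<kappa> * T)) / ((1 - exp (- (2 * \<kappa> * T))) / (2 * \<kappa>)) = 2 * \<kappa> / (exp (2 * \<kappa> * T) - 1)"
    using ne False by (simp add: exp_minus field_simps)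
  then show ?thesis using False by (simp add: exp_weight_def)
qed (simp add: exp_weight_def)

theorem theorem2p13:
  fixes sX :: "'k::rc_field \<Rightarrow> 'x::banach \<Rightarrow> 'x" and ipX :: "'x \<Rightarrow> 'x \<Rightarrow> 'k"
    and sU :: "'k \<Rightarrow> 'u::banach \<Rightarrow> 'u" and ipU :: "'u \<Rightarrow> 'u \<Rightarrow> 'k"
    and sY :: "'k \<Rightarrow> 'y::banach \<Rightarrow> 'y" and \<iota> :: "'x \<Rightarrow> 'y"
    and D :: "'x set" and A :: "'x \<Rightarrow> 'x" and B :: "'u \<Rightarrow> 'y"
    and \<kappa> \<beta> T :: real
  assumes "hilbert_space sX ipX" and "hilbert_space sU ipU"
    and "self_adjoint sX ipX D A" and "lower_semibounded ipX D A"
    and "of_real \<kappa> \<in> spectrum sX D A"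
    and "\<And>r::real. of_real r \<in> spectrum sX D A \<Longrightarrow> \<kappa> \<le> r"
    and "\<beta> \<le> 0"
    and "is_completion sX (norm_beta D A \<beta>) sY \<iota>"
    and "bounded_operator sU sY B"
    and "T > 0"
    and "null_controllable \<iota> D A B T"
  shows "(control_cost \<iota> D A B T)\<^sup>2 \<ge>
    ennreal (onorm B powi (-2) * (1 + \<kappa>\<^sup>2) powr \<beta> *
      (if \<kappa> = 0 then 1 / T else 2 * \<kappa> / (exp (2 * \<kappa> * T) - 1)))"
proof (cases "onorm B = 0")
  \<comment> \<open>\<open>0 powi (-2) = 0\<close> makes the lower bound \<open>0\<close>.\<close>
  case True
  then show ?thesis by simp
next
  case False
  interpret X: hilbert_space sX ipX by fact
  interpret U: hilbert_space sU ipU by fact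
  obtain c where "\<And>x. x \<in> D \<Longrightarrow> c * (norm x)\<^sup>2 \<le> real_ip (A x) x"
    using X.lower_semibounded_real_ip[OF assms(4)] by blast
  \<comment> \<open>Restricting the scalars leaves the norm, \<open>D\<close> and \<open>A\<close>
    untouched, so \<open>norm_beta\<close>, \<open>exp_minus\<close> and \<open>control_cost\<close>
    keep their meaning in the real space.\<close>
  then interpret op: semibounded_op real_ip D A c
    by (intro semibounded_op.intro self_adjoint_op.intro self_adjoint_op_axioms.intro semibounded_op_axioms.intro
        X.real_hilbert_real_ip X.self_adjoint_real_ip assms(3))
  have Y: "normed_space_over sY" using assms(8) by (simp add: is_completion_def)
  have lin: "linear \<iota>"
    using assms(8) X.linear_imp_real_linear[OF _ Y] by (simp add: is_completion_def)
  have nrm: "norm (\<iota> x) = norm (op.P \<beta> x)" for x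
    using assms(8) by (simp add: is_completion_def op.norm_beta_eq)
  have dense: "closure (range \<iota>) = UNIV" using assms(8) by (simp add: is_completion_def)
  have B: "bounded_linear B"
  proof -
    obtain C where "\<And>x. norm (B x) \<le> C * norm x" using assms(9) by (auto simp: bounded_operator_def)
    moreover have "linear B"
      using assms(9) U.linear_imp_real_linear[OF _ Y] by (simp add: bounded_operator_def)
    ultimately show ?thesis
      by (intro bounded_linear_intro[where K = C]) (auto simp: linear_add linear_scale mult.commute)
  qed
  define L where "L = exp (- (\<kappa> * T)) * (1 + \<kappa>\<^sup>2) powr (\<beta> / 2) / (onorm B * sqrt (exp_weight \<kappa> T))"
  have L: "ennreal L \<le> control_cost \<iota> D A B T"
    unfolding L_def
    by (rule op.control_cost_ge[OF assms(7) lin nrm dense B False assms(10) X.spectrum_real_ip[OF assms(5)]])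
  have "0 \<le> L" using onorm_pos_le[OF B] exp_weight_pos[OF assms(10), of \<kappa>] by (simp add: L_def)
  have "L\<^sup>2 = (exp (- (\<kappa> * T)))\<^sup>2 * ((1 + \<kappa>\<^sup>2) powr (\<beta> / 2))\<^sup>2 / ((onorm B)\<^sup>2 * exp_weight \<kappa> T)"
    using exp_weight_pos[OF assms(10), of \<kappa>] by (simp add: L_def power_mult_distrib power_divide)
  also have "(exp (- (\<kappa> * T)))\<^sup>2 = exp (- (2 * \<kappa> * T))"
    by (simp add: power2_eq_square flip: exp_add)
  also have "((1 + \<kappa>\<^sup>2) powr (\<beta> / 2))\<^sup>2 = (1 + \<kappa>\<^sup>2) powr \<beta>"
    by (simp add: power2_eq_square flip: powr_add)
  also have "exp (- (2 * \<kappa> * T)) * (1 + \<kappa>\<^sup>2) powr \<beta> / ((onorm B)\<^sup>2 * exp_weight \<kappa> T)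
      = onorm B powi (-2) * (1 + \<kappa>\<^sup>2) powr \<beta> * (exp (- (2 * \<kappa> * T)) / exp_weight \<kappa> T)"
    by (simp add: power_int_minus divide_inverse)
  also note exp_weight_quotient[OF assms(10)]
  finally have "ennreal (onorm B powi (-2) * (1 + \<kappa>\<^sup>2) powr \<beta> *
      (if \<kappa> = 0 then 1 / T else 2 * \<kappa> / (exp (2 * \<kappa> * T) - 1))) = (ennreal L)\<^sup>2"
    using \<open>0 \<le> L\<close> by (simp add: ennreal_power)
  then show ?thesis using power_mono[OF L, of 2] by simp
qed

end
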